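(* Let $\mathfrak{F}$ denote the set of all non-affine functions $f\in C[0,1]$, and let $\mathfrak{G}\subseteq\mathfrak{F}$ be the subset of those functions $f$ such that $\lim_{\delta\to 0}\omega_2(f;\delta)/\delta=0$. Then \[ \limsup_{n\rightarrow \infty}\ \sup_{f\in \mathfrak{G}}\frac{\omega_2^{\varphi}\left(f;1/\sqrt{n}\right)}{\|B_nf-f\|}\leq 4+ \frac{\sqrt{2}\left(\sqrt{2}+1\right)}{1-0.99/\sqrt{3}}\log 4=15.0477\ldots \] Moreover, $\mathfrak{F}\cap C^1[0,1]\subseteq \mathfrak{G}$.
   Context: $C[0,1]$ is the space of real continuous functions on $[0,1]$, $C^1[0,1]$ the subspace of continuously differentiable functions, and $\|\cdot\|$ the supremum norm on $[0,1]$. For $n\in\mathbb{N}=\{1,2,\ldots\}$, the $n$th Bernstein polynomial of $f$ is $B_nf(x)=\sum_{k=0}^n f(k/n)\binom{n}{k}x^k(1-x)^{n-k}$. Let $\varphi(x)=\sqrt{x(1-x)}$ and $\Delta_h^2f(x)=f(x+h)-2f(x)+f(x-h)$ for $h\ge 0$, $x\pm h\in[0,1]$. The Ditzian-Totik modulus of smoothness is $\omega_{2}^{\varphi}(f;\delta )=\sup \{ | \Delta_{h\varphi (x)}^{2}f(x) | : 0\leq h\leq \delta,\ x\in[0,1],\ x\pm h\varphi (x)\in [0,1] \}$, and the usual second modulus of continuity is $\omega_2(f;\delta)=\sup\{|\Delta_h^2f(x)|: 0\le h\le\delta,\ x\pm h\in[0,1]\}$, $\delta\ge0$. *)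

theory Defs
  imports "HOL-Analysis.Analysis"
begin

text \<open>
  Elements of \<open>C[0,1]\<close> are represented by functions of type \<^typ>\<open>real \<Rightarrow> real\<close> that are
  continuous on \<open>{0..1}\<close>. The notions below never inspect values outside \<open>{0..1}\<close>,
  so the choice of representative does not matter.
\<close>

definition bernstein_op :: "nat \<Rightarrow> (real \<Rightarrow> real) \<Rightarrow> real \<Rightarrow> real" where
  "bernstein_op n f x = (\<Sum>k\<le>n. f (real k / real n) * Bernstein n k x)"

definition sup_norm :: "(real \<Rightarrow> real) \<Rightarrow> real" where
  "sup_norm g = (SUP x\<in>{0..1}. \<bar>g x\<bar>)"

definition phi :: "real \<Rightarrow> real" where
  "phi x = sqrt (x * (1 - x))"

definition sym_diff2 :: "real \<Rightarrow> (real \<Rightarrow> real) \<Rightarrow> real \<Rightarrow> real" where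
  "sym_diff2 h f x = f (x + h) - 2 * f x + f (x - h)"

text \<open>
  For \<open>\<delta> \<ge> 0\<close> and \<open>f\<close> continuous on \<open>{0..1}\<close>, the two sets below are nonempty and bounded,
  so that the real-valued supremum is the genuine one.
\<close>

definition omega2 :: "(real \<Rightarrow> real) \<Rightarrow> real \<Rightarrow> real" where
  "omega2 f \<delta> = Sup {\<bar>sym_diff2 h f x\<bar> | h x.
     0 \<le> h \<and> h \<le> \<delta> \<and> x + h \<in> {0..1} \<and> x - h \<in> {0..1}}"

definition omega2_phi :: "(real \<Rightarrow> real) \<Rightarrow> real \<Rightarrow> real" where
  "omega2_phi f \<delta> = Sup {\<bar>sym_diff2 (h * phi x) f x\<bar> | h x.
     0 \<le> h \<and> h \<le> \<delta> \<and> x \<in> {0..1} \<and> x + h * phi x \<in> {0..1} \<and> x - h * phi x \<in> {0..1}}"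

definition affine_on_unit :: "(real \<Rightarrow> real) \<Rightarrow> bool" where
  "affine_on_unit f \<longleftrightarrow> (\<exists>a b. \<forall>x\<in>{0..1}. f x = a * x + b)"

definition FF :: "(real \<Rightarrow> real) set" where
  "FF = {f. continuous_on {0..1} f \<and> \<not> affine_on_unit f}"

definition GG :: "(real \<Rightarrow> real) set" where
  "GG = {f \<in> FF. ((\<lambda>\<delta>. omega2 f \<delta> / \<delta>) \<longlongrightarrow> 0) (at_right 0)}"

text \<open>
  The library's \<^term>\<open>f C1_differentiable_on {0..1}\<close> asks for two-sided derivatives, hence
  constrains \<open>f\<close> outside the interval; here the derivatives at the endpoints are one-sided.
\<close>

definition C1_unit :: "(real \<Rightarrow> real) set" where
  "C1_unit = {f. \<exists>f'. continuous_on {0..1} f' \<and>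
     (\<forall>x\<in>{0..1}. (f has_real_derivative f' x) (at x within {0..1}))}"

definition bound_const :: real where
  "bound_const = 4 + sqrt 2 * (sqrt 2 + 1) / (1 - 0.99 / sqrt 3) * ln 4"

end

theory Submission
  imports Defs
begin

text \<open>
  Write \<open>h = B\<^sub>n f\<close> and \<open>D = \<parallel>h - f\<parallel>\<close>. As the second differences of \<open>f\<close> and \<open>h\<close> differ by at most
  \<open>4 D\<close>, it suffices to bound those of \<open>h\<close> with step \<open>s \<phi>(x)\<close>, \<open>s \<le> 1 / sqrt n\<close>, by \<open>ratio * D\<close>, and
  these are controlled by the maximum \<open>H\<close> of \<open>\<bar>h''(x)\<bar> (x (1 - x) + 3 / (5 n)) / n\<close>.

  Split the nodal values of \<open>f\<close> into those of \<open>h\<close>, called \<open>v\<close>, and an error \<open>u\<close> with \<open>\<bar>u\<bar> \<le> D\<close>. The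
  contribution of \<open>u\<close> to \<open>h''\<close> is at most \<open>sqrt 2 n D / (x (1 - x))\<close> by Cauchy--Schwarz. For the
  contribution of \<open>v\<close> let \<open>g = B\<^sub>n v\<close>. The bound \<open>H\<close> controls the second differences of \<open>v\<close>, hence
  the fourth derivative of \<open>g\<close>. Expanding \<open>g\<close> around \<open>y = x + (1 - 2 x) / (3 n)\<close>, where the cubic
  term averages out, shows that \<open>B\<^sub>n g(x) - g(x)\<close> is \<open>g''(y) x (1 - x) / (2 n)\<close> up to a remainder
  proportional to \<open>H\<close>, while \<open>\<bar>B\<^sub>n g - g\<bar> \<le> D\<close>. If \<open>H\<close> exceeded \<open>ratio * D\<close>, these estimates would
  give \<open>H \<le> 1999 / 2000 * H\<close>. Near the endpoints, for \<open>n y \<le> 2\<close>, the expansion is replaced by a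
  direct comparison of the Bernstein basis with the Poisson distribution.
\<close>

section \<open>Bernstein sums and their central moments\<close>

text \<open>Away from the endpoints, bounding the contribution of \<open>v\<close> by its second
  differences alone returns \<open>H\<close> with a factor close to 1, which leaves no room for
  \<open>u\<close>. The gain comes from applying the operator once more: since \<open>v\<close>
  consists of values of \<open>h\<close>, two derivatives are already paid for by \<open>H\<close>,
  and a Voronovskaya relation expresses \<open>g''\<close> by \<open>D\<close> up to a remainder of
  fourth order. The resulting factor in front of \<open>H\<close> tends to about 0.72 as
  \<open>n x (1 - x)\<close> grows, so the critical range is that of bounded \<open>n x\<close>.
  There all inequalities are numerical, and the case distinctions at 2 and 10 arise. The addend
  \<open>3 / (5 n)\<close> keeps the weight positive at the endpoints. It has to exceed
  \<open>1 / (2 n)\<close> for the step from second differences to the fourth derivative, and it has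
  to stay small because it enlarges the contribution of \<open>u\<close> by the factor
  \<open>1 + 3 / (5 m)\<close> with \<open>m = n x (1 - x)\<close>. Only large \<open>n\<close>
  matter for the upper limit; with \<open>n\<close> at least \<open>10 ^ 10\<close>, errors of order
  \<open>1 / n\<close> disappear in factors such as 2001 / 2000.\<close>

definition bern :: "nat \<Rightarrow> (nat \<Rightarrow> real) \<Rightarrow> real \<Rightarrow> real" where
  "bern n v x = (\<Sum>k\<le>n. v k * Bernstein n k x)"

lemma bernstein_op_bern: "bernstein_op n f = bern n (\<lambda>k. f (real k / real n))"
  by (rule ext) (simp add: bernstein_op_def bern_def)

lemma bern_has_derivative:
  "(bern (Suc m) v has_real_derivative real (Suc m) * bern m (\<lambda>k. v (Suc k) - v k) x) (at x)"
proof -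
  \<comment> \<open>\<open>A\<close> and \<open>B\<close> come from the two factors of the basis
    polynomial. They vanish where the neighbouring polynomial of degree \<open>m\<close> does not
    exist, so that the summation by parts has no boundary terms.\<close>
  define A where "A k = (if k = 0 then 0 else real (Suc m) * Bernstein m (k - 1) x)" for k
  define B where "B k = (if k \<le> m then real (Suc m) * Bernstein m k x else 0)" for k
  have d: "(Bernstein (Suc m) k has_real_derivative A k - B k) (at x)" if "k \<le> Suc m" for k
  proof -
    have "((\<lambda>x. real (Suc m choose k) * (x ^ k * (1 - x) ^ (Suc m - k))) has_real_derivative
        real (Suc m choose k) * (real k * x ^ (k - 1) * (1 - x) ^ (Suc m - k)
        - x ^ k * (real (Suc m - k) * (1 - x) ^ (Suc m - k - 1)))) (at x)"
      by (rule derivative_eq_intros refl | simp)+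
    moreover have "real (Suc m choose k) * (real k * x ^ (k - 1) * (1 - x) ^ (Suc m - k)) = A k"
    proof (cases k)
      case (Suc j)
      have "real k * real (Suc m choose k) = real (Suc m) * real (m choose j)"
        unfolding Suc using binomial_absorption[of j "Suc m"]
        by (metis of_nat_mult diff_Suc_1)
      then have "real (Suc m choose k) * real k * (x ^ j * (1 - x) ^ (m - j))
          = real (Suc m) * real (m choose j) * (x ^ j * (1 - x) ^ (m - j))"
        by (simp only: mult.commute)
      then show ?thesis using Suc by (simp add: A_def Bernstein_def mult.assoc del: binomial_Suc_Suc)
    qed (simp add: A_def)
    moreover have "real (Suc m choose k) * (x ^ k * (real (Suc m - k) * (1 - x) ^ (Suc m - k - 1))) = B k"
    proof (cases "k \<le> m")
      case True
      have "real (Suc m - k) * real (Suc m choose k) = real (Suc m) * real (m choose k)"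
        using binomial_absorb_comp[of "Suc m" k] by (metis of_nat_mult diff_Suc_1)
      then have "real (Suc m choose k) * real (Suc m - k) * (x ^ k * (1 - x) ^ (m - k))
          = real (Suc m) * real (m choose k) * (x ^ k * (1 - x) ^ (m - k))"
        by (simp only: mult.commute)
      then show ?thesis using True by (simp add: B_def Bernstein_def Suc_diff_le ac_simps del: of_nat_Suc)
    next
      case False
      then have "k = Suc m" using that by simp
      then show ?thesis by (simp add: B_def)
    qed
    moreover have "Bernstein (Suc m) k = (\<lambda>x. real (Suc m choose k) * (x ^ k * (1 - x) ^ (Suc m - k)))"
      by (rule ext) (simp add: Bernstein_def)
    ultimately show ?thesis by (simp only: right_diff_distrib)
  qed
  have "((\<lambda>x. \<Sum>k\<le>Suc m. v k * Bernstein (Suc m) k x) has_real_derivative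
      (\<Sum>k\<le>Suc m. v k * (A k - B k))) (at x)"
    by (intro DERIV_sum DERIV_cmult d) simp
  moreover have "(\<Sum>k\<le>Suc m. v k * (A k - B k)) = real (Suc m) * bern m (\<lambda>k. v (Suc k) - v k) x"
  proof -
    have "(\<Sum>k\<le>Suc m. v k * A k) = (\<Sum>k\<le>m. v (Suc k) * (real (Suc m) * Bernstein m k x))"
      by (subst sum.atMost_Suc_shift) (simp add: A_def)
    moreover have "(\<Sum>k\<le>Suc m. v k * B k) = (\<Sum>k\<le>m. v k * (real (Suc m) * Bernstein m k x))"
      by (simp add: B_def)
    ultimately show ?thesis
      by (simp add: right_diff_distrib sum_subtractf bern_def sum_distrib_left algebra_simps)
  qed
  moreover have "bern (Suc m) v = (\<lambda>x. \<Sum>k\<le>Suc m. v k * Bernstein (Suc m) k x)"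
    by (rule ext) (simp add: bern_def)
  ultimately show ?thesis by simp
qed

text \<open>Logarithmic derivative \<open>k / x - (n - k) / (1 - x)\<close>. In this form
  differentiation keeps the basis function and multiplies it by a linear function of
  \<open>k\<close>, which yields a recurrence between moments.\<close>

lemma Bernstein_has_derivative:
  assumes "0 < x" "x < 1" "k \<le> n"
  shows "(Bernstein n k has_real_derivative (real k - real n * x) / (x * (1 - x)) * Bernstein n k x) (at x)"
proof -
  have "((\<lambda>x. real (n choose k) * (x ^ k * (1 - x) ^ (n - k))) has_real_derivative
        real (n choose k) * (real k * x ^ (k - 1) * (1 - x) ^ (n - k)
        - x ^ k * (real (n - k) * (1 - x) ^ (n - k - 1)))) (at x)"
    by (rule derivative_eq_intros refl | simp)+
  moreover have "real k * x ^ (k - 1) = real k * x ^ k / x"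
    using assms by (cases k) auto
  moreover have "real (n - k) * (1 - x) ^ (n - k - 1) = real (n - k) * (1 - x) ^ (n - k) / (1 - x)"
    using assms by (cases "n - k") auto
  moreover have "real (n choose k) * (real k * x ^ k / x * (1 - x) ^ (n - k)
        - x ^ k * (real (n - k) * (1 - x) ^ (n - k) / (1 - x)))
     = (real k - real n * x) / (x * (1 - x)) * Bernstein n k x"
  proof -
    have "real (n - k) = real n - real k" using assms by simp
    then show ?thesis using assms by (simp add: Bernstein_def divide_simps) (simp add: algebra_simps)
  qed
  moreover have "Bernstein n k = (\<lambda>x. real (n choose k) * (x ^ k * (1 - x) ^ (n - k)))"
    by (rule ext) (simp add: Bernstein_def)
  ultimately show ?thesis by simp
qed

section \<open>Central moments of the binomial distribution up to order six\<close>

definition cmom :: "nat \<Rightarrow> nat \<Rightarrow> real \<Rightarrow> real" where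
  "cmom j n x = (\<Sum>k\<le>n. (real k - real n * x) ^ j * Bernstein n k x)"

lemma cmom_has_derivative:
  assumes "0 < x" "x < 1"
  shows "(cmom (Suc j) n has_real_derivative
     cmom (j + 2) n x / (x * (1 - x)) - real n * real (Suc j) * cmom j n x) (at x)"
proof -
  have "((\<lambda>x. \<Sum>k\<le>n. (real k - real n * x) ^ Suc j * Bernstein n k x) has_real_derivative
    (\<Sum>k\<le>n. (real (Suc j) * (- real n) * (real k - real n * x) ^ j) * Bernstein n k x
       + ((real k - real n * x) / (x * (1 - x)) * Bernstein n k x) * (real k - real n * x) ^ Suc j)) (at x)"
  proof (rule DERIV_sum)
    fix k assume "k \<in> {..n}"
    then have b: "(Bernstein n k has_real_derivative (real k - real n * x) / (x * (1 - x)) * Bernstein n k x) (at x)"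
      using Bernstein_has_derivative assms by simp
    have "((\<lambda>x. (real k - real n * x) ^ Suc j) has_real_derivative
        real (Suc j) * (- real n) * (real k - real n * x) ^ j) (at x)"
      by (rule derivative_eq_intros refl | simp)+
    from DERIV_mult[OF this b]
    show "((\<lambda>x. (real k - real n * x) ^ Suc j * Bernstein n k x) has_real_derivative
        (real (Suc j) * (- real n) * (real k - real n * x) ^ j) * Bernstein n k x
       + ((real k - real n * x) / (x * (1 - x)) * Bernstein n k x) * (real k - real n * x) ^ Suc j) (at x)" .
  qed
  moreover have "(\<Sum>k\<le>n. (real (Suc j) * (- real n) * (real k - real n * x) ^ j) * Bernstein n k x
       + ((real k - real n * x) / (x * (1 - x)) * Bernstein n k x) * (real k - real n * x) ^ Suc j)
     = cmom (j + 2) n x / (x * (1 - x)) - real n * real (Suc j) * cmom j n x"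
    unfolding cmom_def sum.distrib sum_divide_distrib sum_distrib_left
    by (simp add: sum_subtractf[symmetric] sum.distrib[symmetric] sum_negf[symmetric])
       (auto intro!: sum.cong simp: algebra_simps power2_eq_square)
  moreover have "cmom (Suc j) n = (\<lambda>x. \<Sum>k\<le>n. (real k - real n * x) ^ Suc j * Bernstein n k x)"
    by (rule ext) (simp add: cmom_def)
  ultimately show ?thesis by simp
qed

text \<open>The derivative formula read backwards: a closed form of one moment, once differentiated,
  gives the next. The closed form is available only inside the unit interval, hence the transfer on
  an open set.\<close>

lemma cmom_step:
  assumes x: "0 < x" "x < 1"
    and P: "\<And>x. 0 < x \<Longrightarrow> x < 1 \<Longrightarrow> cmom (Suc j) n x = P x"
    and P': "(P has_real_derivative P') (at x)"
  shows "cmom (j + 2) n x = x * (1 - x) * (P' + real n * real (Suc j) * cmom j n x)"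
proof -
  have "(cmom (Suc j) n has_real_derivative P') (at x)"
    by (rule has_field_derivative_transform_within_open[OF P', where S = "{0<..<1}"]) (use x in \<open>auto simp: P\<close>)
  then have "P' = cmom (j + 2) n x / (x * (1 - x)) - real n * real (Suc j) * cmom j n x"
    using cmom_has_derivative[OF x] DERIV_unique by blast
  then show ?thesis using x by (simp add: field_simps)
qed

lemma cmom_0: "cmom 0 n x = 1"
  by (simp add: cmom_def)

lemma cmom_1: "cmom (Suc 0) n x = 0"
proof -
  have "cmom (Suc 0) n x = (\<Sum>k\<le>n. real k * Bernstein n k x) - real n * x * (\<Sum>k\<le>n. Bernstein n k x)"
    by (simp add: cmom_def left_diff_distrib sum_subtractf sum_distrib_left mult.assoc
        del: sum_k_Bernstein sum_Bernstein)
  then show ?thesis by simp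
qed

lemma cmom_2:
  assumes "0 < x" "x < 1"
  shows "cmom 2 n x = real n * (x * (1 - x))"
proof -
  have "cmom (0 + 2) n x = x * (1 - x) * (0 + real n * real (Suc 0) * cmom 0 n x)"
    by (rule cmom_step[OF assms, of 0 n "\<lambda>x. 0"]) (simp_all add: cmom_1)
  then show ?thesis by (simp only: cmom_0 add_0) simp
qed

lemma cmom_3: "0 < x \<Longrightarrow> x < 1 \<Longrightarrow> cmom 3 n x = real n * (x * (1 - x)) * (1 - 2 * x)"
proof -
  assume x: "0 < x" "x < 1"
  have d: "((\<lambda>x. real n * (x * (1 - x))) has_real_derivative real n * (1 - 2 * x)) (at x)"
    by (auto intro!: derivative_eq_intros simp: algebra_simps)
  have "cmom (1 + 2) n x = x * (1 - x) * (real n * (1 - 2 * x) + real n * real (Suc 1) * cmom 1 n x)"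
    by (rule cmom_step[OF x _ d]) (metis cmom_2 Suc_1)
  moreover have "(1::nat) + 2 = 3" by simp
  ultimately show ?thesis by (simp only: One_nat_def cmom_1) simp
qed

lemma cmom_4:
  assumes x: "0 < x" "x < 1"
  shows "cmom 4 n x = 3 * (real n * (x * (1 - x)))\<^sup>2 + real n * (x * (1 - x)) * (1 - 6 * (x * (1 - x)))"
proof -
  have d: "((\<lambda>x. real n * (x * (1 - x)) * (1 - 2 * x)) has_real_derivative
      real n * (1 - 6 * x + 6 * x\<^sup>2)) (at x)"
    by (auto intro!: derivative_eq_intros simp: algebra_simps power2_eq_square)
  have "cmom (2 + 2) n x = x * (1 - x) * (real n * (1 - 6 * x + 6 * x\<^sup>2) + real n * real (Suc 2) * cmom 2 n x)"
    by (rule cmom_step[OF x _ d]) (simp add: cmom_3 numeral_3_eq_3[symmetric])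
  then show ?thesis using x by (simp add: cmom_2) (simp add: algebra_simps power2_eq_square)
qed

lemma cmom_5:
  assumes x: "0 < x" "x < 1"
  shows "cmom 5 n x = (1 - 2 * x) * (10 * (real n * (x * (1 - x)))\<^sup>2
    + real n * (x * (1 - x)) * (1 - 12 * (x * (1 - x))))"
proof -
  have d: "((\<lambda>x. 3 * (real n * (x * (1 - x)))\<^sup>2 + real n * (x * (1 - x)) * (1 - 6 * (x * (1 - x))))
      has_real_derivative
      (1 - 2 * x) * (6 * (real n)\<^sup>2 * (x * (1 - x)) + real n * (1 - 12 * (x * (1 - x))))) (at x)"
    by (auto intro!: derivative_eq_intros simp: algebra_simps power2_eq_square)
  have "cmom (3 + 2) n x = x * (1 - x) * ((1 - 2 * x) * (6 * (real n)\<^sup>2 * (x * (1 - x))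
      + real n * (1 - 12 * (x * (1 - x)))) + real n * real (Suc 3) * cmom 3 n x)"
    by (rule cmom_step[OF x _ d]) (simp add: cmom_4 eval_nat_numeral(2)[symmetric])
  then show ?thesis using x by (simp add: cmom_3) (simp add: algebra_simps power2_eq_square)
qed

lemma cmom_6:
  assumes x: "0 < x" "x < 1"
  shows "cmom 6 n x = 15 * (real n * (x * (1 - x))) ^ 3
    + (real n * (x * (1 - x)))\<^sup>2 * (25 - 130 * (x * (1 - x)))
    + real n * (x * (1 - x)) * (1 - 30 * (x * (1 - x)) + 120 * (x * (1 - x))\<^sup>2)"
proof -
  have d: "((\<lambda>x. (1 - 2 * x) * (10 * (real n * (x * (1 - x)))\<^sup>2
    + real n * (x * (1 - x)) * (1 - 12 * (x * (1 - x)))))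
      has_real_derivative
      - 2 * (10 * (real n * (x * (1 - x)))\<^sup>2 + real n * (x * (1 - x)) * (1 - 12 * (x * (1 - x))))
      + (1 - 2 * x)\<^sup>2 * (20 * (real n)\<^sup>2 * (x * (1 - x)) + real n * (1 - 24 * (x * (1 - x))))) (at x)"
    by (auto intro!: derivative_eq_intros simp: algebra_simps power2_eq_square)
  have "cmom (4 + 2) n x = x * (1 - x) * (- 2 * (10 * (real n * (x * (1 - x)))\<^sup>2
      + real n * (x * (1 - x)) * (1 - 12 * (x * (1 - x))))
      + (1 - 2 * x)\<^sup>2 * (20 * (real n)\<^sup>2 * (x * (1 - x)) + real n * (1 - 24 * (x * (1 - x))))
      + real n * real (Suc 4) * cmom 4 n x)"
    by (rule cmom_step[OF x _ d]) (simp add: cmom_5 eval_nat_numeral(3)[symmetric])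
  also have "(1 - 2 * x)\<^sup>2 = 1 - 4 * (x * (1 - x))"
    by (simp add: algebra_simps power2_eq_square)
  finally have "cmom 6 n x = x * (1 - x) * (- 2 * (10 * (real n * (x * (1 - x)))\<^sup>2
      + real n * (x * (1 - x)) * (1 - 12 * (x * (1 - x))))
      + (1 - 4 * (x * (1 - x))) * (20 * (real n)\<^sup>2 * (x * (1 - x)) + real n * (1 - 24 * (x * (1 - x))))
      + real n * 5 * (3 * (real n * (x * (1 - x)))\<^sup>2 + real n * (x * (1 - x)) * (1 - 6 * (x * (1 - x)))))"
    using x by (simp add: cmom_4)
  moreover have "X * (- 2 * (10 * (N * X)\<^sup>2 + N * X * (1 - 12 * X))
      + (1 - 4 * X) * (20 * N\<^sup>2 * X + N * (1 - 24 * X)) + N * 5 * (3 * (N * X)\<^sup>2 + N * X * (1 - 6 * X)))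
     = 15 * (N * X) ^ 3 + (N * X)\<^sup>2 * (25 - 130 * X) + N * X * (1 - 30 * X + 120 * X\<^sup>2)" for X N :: real
    by algebra
  ultimately show ?thesis by metis
qed

section \<open>Linearity, positivity and Cauchy--Schwarz for Bernstein sums\<close>

lemma bern_add: "bern n (\<lambda>k. v k + w k) x = bern n v x + bern n w x"
  by (simp add: bern_def distrib_right sum.distrib)

lemma bern_diff: "bern n (\<lambda>k. v k - w k) x = bern n v x - bern n w x"
  by (simp add: bern_def left_diff_distrib sum_subtractf)

lemma bern_mono:
  assumes "0 \<le> x" "x \<le> 1" "\<And>k. k \<le> n \<Longrightarrow> v k \<le> w k"
  shows "bern n v x \<le> bern n w x"
  unfolding bern_def by (intro sum_mono mult_right_mono assms Bernstein_nonneg) auto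

lemma bern_const: "bern n (\<lambda>k. c) x = c"
  by (simp add: bern_def flip: sum_distrib_left)

lemma bern_cmult: "bern n (\<lambda>k. c * v k) x = c * bern n v x"
  by (simp add: bern_def sum_distrib_left mult.assoc)

lemma bern_cong: "(\<And>k. k \<le> n \<Longrightarrow> v k = w k) \<Longrightarrow> bern n v x = bern n w x"
  by (simp add: bern_def)

lemma bern_abs_le:
  assumes "0 \<le> x" "x \<le> 1"
  shows "\<bar>bern n v x\<bar> \<le> bern n (\<lambda>k. \<bar>v k\<bar>) x"
  unfolding bern_def
  by (rule order_trans[OF sum_abs]) (simp add: abs_mult Bernstein_nonneg assms)

lemma bern_bound:
  assumes "0 \<le> x" "x \<le> 1" "\<And>k. k \<le> n \<Longrightarrow> \<bar>v k\<bar> \<le> c"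
  shows "\<bar>bern n v x\<bar> \<le> c"
  using order_trans[OF bern_abs_le[OF assms(1,2)] bern_mono[OF assms(1,2), of n "\<lambda>k. \<bar>v k\<bar>" "\<lambda>k. c"]] assms(3)
  by (simp add: bern_const)

lemma bern_nonneg:
  assumes "0 \<le> x" "x \<le> 1" "\<And>k. k \<le> n \<Longrightarrow> 0 \<le> v k"
  shows "0 \<le> bern n v x"
  unfolding bern_def by (intro sum_nonneg mult_nonneg_nonneg assms Bernstein_nonneg) auto

lemma bern_Cauchy_Schwarz:
  assumes "0 \<le> x" "x \<le> 1"
  shows "(bern n (\<lambda>k. v k * w k) x)\<^sup>2 \<le> bern n (\<lambda>k. (v k)\<^sup>2) x * bern n (\<lambda>k. (w k)\<^sup>2) x"
proof -
  let ?s = "\<lambda>k. sqrt (Bernstein n k x)"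
  have s: "?s k * ?s k = Bernstein n k x" for k
    by (simp add: Bernstein_nonneg assms)
  have "(\<Sum>k\<le>n. (v k * ?s k) * (w k * ?s k))\<^sup>2
      \<le> (\<Sum>k\<le>n. (v k * ?s k)\<^sup>2) * (\<Sum>k\<le>n. (w k * ?s k)\<^sup>2)"
    by (rule Cauchy_Schwarz_ineq_sum)
  moreover have "(v k * ?s k) * (w k * ?s k) = v k * w k * Bernstein n k x" for k
    by (subst s[symmetric]) (simp only: ac_simps)
  moreover have "(v k * ?s k)\<^sup>2 = (v k)\<^sup>2 * Bernstein n k x" for v k
    by (simp add: power_mult_distrib Bernstein_nonneg assms)
  ultimately show ?thesis by (simp add: bern_def)
qed

lemma bern_reflect: "bern n v (1 - x) = bern n (\<lambda>k. v (n - k)) x"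
  unfolding bern_def
  by (rule sum.reindex_bij_witness[of _ "\<lambda>k. n - k" "\<lambda>k. n - k"])
     (auto simp: Bernstein_def binomial_symmetric[symmetric])

text \<open>The monic Krawtchouk polynomial of degree 2 in \<open>k\<close>, orthogonal to 1 and to
  \<open>k - n x\<close> under the binomial weights. Up to division by
  \<open>(x (1 - x))\<^sup>2\<close>, it is the factor that two differentiations put in front of a
  basis function.\<close>

definition krav :: "nat \<Rightarrow> real \<Rightarrow> nat \<Rightarrow> real" where
  "krav n x k = (real k - real n * x)\<^sup>2 - (1 - 2 * x) * (real k - real n * x) - real n * (x * (1 - x))"

definition diff2 :: "(nat \<Rightarrow> real) \<Rightarrow> nat \<Rightarrow> real" where
  "diff2 v k = v (k + 2) - 2 * v (k + 1) + v k"

lemma bern_has_derivative2: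
  "((\<lambda>x. real (m + 2) * bern (Suc m) (\<lambda>k. v (Suc k) - v k) x) has_real_derivative
    real (m + 2) * real (m + 1) * bern m (diff2 v) x) (at x)"
proof -
  have "(\<lambda>k. v (Suc (Suc k)) - v (Suc k) - (v (Suc k) - v k)) = diff2 v"
    by (rule ext) (simp add: diff2_def)
  with DERIV_cmult[OF bern_has_derivative[of m "\<lambda>k. v (Suc k) - v k" x], of "real (m + 2)"]
  show ?thesis by (simp add: mult.assoc)
qed

text \<open>The second derivative is computed in two ways, by differencing the coefficients and by
  differentiating the weights. The second form allows a merely bounded \<open>v\<close> to be
  treated by averaging.\<close>

lemma bern_diff2_krav:
  assumes x: "0 < x" "x < 1"
  shows "real (m + 2) * real (m + 1) * bern m (diff2 v) x * (x * (1 - x))\<^sup>2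
    = bern (m + 2) (\<lambda>k. krav (m + 2) x k * v k) x"
proof -
  define n where "n = m + 2"
  let ?S = "\<lambda>x. \<Sum>k\<le>n. v k * ((real k - real n * x) / (x * (1 - x)) * Bernstein n k x)"
  have e: "real n * bern (Suc m) (\<lambda>k. v (Suc k) - v k) x = ?S x" if "0 < x" "x < 1" for x
  proof -
    have "(bern n v has_real_derivative ?S x) (at x)"
      unfolding bern_def[abs_def]
      by (intro DERIV_sum DERIV_cmult Bernstein_has_derivative that) simp
    with bern_has_derivative[of "Suc m" v x] show ?thesis
      using DERIV_unique by (fastforce simp: n_def)
  qed
  let ?T = "\<Sum>k\<le>n. v k * (krav n x k / (x * (1 - x))\<^sup>2 * Bernstein n k x)"
  have "(?S has_real_derivative ?T) (at x)"
  proof (intro DERIV_sum DERIV_cmult)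
    fix k assume "k \<in> {..n}"
    then have b: "(Bernstein n k has_real_derivative (real k - real n * x) / (x * (1 - x)) * Bernstein n k x) (at x)"
      using Bernstein_has_derivative[OF x] by simp
    have a: "((\<lambda>x. (real k - real n * x) / (x * (1 - x))) has_real_derivative
       (- real n * (x * (1 - x)) - (real k - real n * x) * (1 - 2 * x)) / (x * (1 - x))\<^sup>2) (at x)"
      using x by (auto intro!: derivative_eq_intros simp: power2_eq_square algebra_simps)
    from DERIV_mult[OF a b]
    show "((\<lambda>x. (real k - real n * x) / (x * (1 - x)) * Bernstein n k x) has_real_derivative
       krav n x k / (x * (1 - x))\<^sup>2 * Bernstein n k x) (at x)"
    proof (rule back_subst[of "\<lambda>d. DERIV _ _ :> d"])
      have "(- N * w - d * q) / w\<^sup>2 * B + d / w * B * (d / w) = (d\<^sup>2 - q * d - N * w) / w\<^sup>2 * B"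
        if "w \<noteq> 0" for N w d q B :: real
        using that by (simp add: field_simps power2_eq_square)
      then show "(- real n * (x * (1 - x)) - (real k - real n * x) * (1 - 2 * x)) / (x * (1 - x))\<^sup>2 * Bernstein n k x
        + (real k - real n * x) / (x * (1 - x)) * Bernstein n k x * ((real k - real n * x) / (x * (1 - x)))
        = krav n x k / (x * (1 - x))\<^sup>2 * Bernstein n k x"
        unfolding krav_def using x by simp
    qed
  qed
  then have "((\<lambda>x. real n * bern (Suc m) (\<lambda>k. v (Suc k) - v k) x) has_real_derivative ?T) (at x)"
    by (rule has_field_derivative_transform_within_open[where S = "{0<..<1}"]) (use x e in auto)
  then have "real (m + 2) * real (m + 1) * bern m (diff2 v) x = ?T"
    using bern_has_derivative2 DERIV_unique unfolding n_def by blast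
  moreover have "?T * (x * (1 - x))\<^sup>2 = bern n (\<lambda>k. krav n x k * v k) x"
  proof -
    have "v * (c / w\<^sup>2 * B) * w\<^sup>2 = c * v * B" if "w \<noteq> 0" for v c w B :: real
      using that by simp
    then show ?thesis
      unfolding bern_def sum_distrib_right using x by (intro sum.cong) auto
  qed
  ultimately show ?thesis by (simp add: n_def)
qed

lemma bern_cmom: "bern n (\<lambda>k. (real k - real n * x) ^ j) x = cmom j n x"
  by (simp add: bern_def cmom_def)

lemma bern_id: "bern n real x = real n * x"
  by (simp add: bern_def)

lemma bern_cmom1: "bern n (\<lambda>k. real k - real n * x) x = 0"
  by (simp add: bern_diff bern_const bern_id)

lemma bern_krav: "0 < x \<Longrightarrow> x < 1 \<Longrightarrow> bern n (krav n x) x = 0"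
  by (simp add: krav_def[abs_def] bern_diff bern_cmult bern_const bern_id bern_cmom cmom_2)

text \<open>The squared norm of the Krawtchouk polynomial; its factor 2 is the origin of every
  \<open>sqrt 2\<close> in the derivative estimates.\<close>

lemma bern_krav_sq:
  assumes x: "0 < x" "x < 1"
  shows "bern n (\<lambda>k. (krav n x k)\<^sup>2) x = 2 * real n * (real n - 1) * (x * (1 - x))\<^sup>2"
proof -
  define w q where "w = real n * (x * (1 - x))" and "q = 1 - 2 * x"
  have "(krav n x k)\<^sup>2 = (real k - real n * x) ^ 4 - 2 * q * (real k - real n * x) ^ 3
      + (q\<^sup>2 - 2 * w) * (real k - real n * x) ^ 2 + 2 * q * w * (real k - real n * x)
      + w\<^sup>2" for k
  proof -
    have "(d\<^sup>2 - q * d - w)\<^sup>2 = d ^ 4 - 2 * q * d ^ 3 + (q\<^sup>2 - 2 * w) * d ^ 2 + 2 * q * w * d + w\<^sup>2" for d :: real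
      by algebra
    then show ?thesis by (simp add: krav_def w_def q_def)
  qed
  then have "bern n (\<lambda>k. (krav n x k)\<^sup>2) x = cmom 4 n x - 2 * q * cmom 3 n x
      + (q\<^sup>2 - 2 * w) * cmom 2 n x + w\<^sup>2"
    by (simp add: bern_add bern_diff bern_cmult bern_const bern_id bern_cmom)
  also have "\<dots> = 2 * w\<^sup>2 + w * (1 - 6 * (x * (1 - x))) - q\<^sup>2 * w"
    using x by (simp add: cmom_2 cmom_3 cmom_4 w_def[symmetric] q_def[symmetric])
      (simp add: algebra_simps power2_eq_square)
  also have "q\<^sup>2 = 1 - 4 * (x * (1 - x))" by (simp add: q_def algebra_simps power2_eq_square)
  finally show ?thesis by (simp add: w_def algebra_simps power2_eq_square)
qed

text \<open>Dividing \<open>m choose k\<close> by the four factors gives a constant multiple of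
  \<open>m + 4 choose (k + 2)\<close>. After scaling, the sum is a part of the partition of unity of
  degree \<open>m + 4\<close>.\<close>

lemma bern_inverse_weight:
  assumes x: "0 < x" "x < 1"
  shows "bern m (\<lambda>k. 1 / (real (k + 1) * real (k + 2) * real (m + 1 - k) * real (m + 2 - k))) x
    \<le> 1 / (real (m + 1) * real (m + 2) * real (m + 3) * real (m + 4) * (x * (1 - x))\<^sup>2)"
proof -
  let ?c = "real (m + 1) * real (m + 2) * real (m + 3) * real (m + 4) * (x * (1 - x))\<^sup>2"
  have c: "?c > 0" using x by simp
  have e: "1 / (real (k + 1) * real (k + 2) * real (m + 1 - k) * real (m + 2 - k)) * Bernstein m k x
    = Bernstein (m + 4) (k + 2) x / ?c" if km: "k \<le> m" for k
  proof -
    obtain j where m: "m = k + j" using le_Suc_ex[OF km] by blast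
    have f2: "fact (i + 2) = real (i + 1) * real (i + 2) * fact i" for i
    proof -
      have "fact (Suc (Suc i)) = real (Suc i) * real (Suc (Suc i)) * fact i"
        by (simp add: mult.commute mult.left_commute del: of_nat_Suc)
      then show ?thesis by simp
    qed
    have f4: "fact (m + 4) = real (m + 1) * real (m + 2) * real (m + 3) * real (m + 4) * fact m"
    proof -
      have "m + 4 = m + 2 + 2" "m + 2 + 1 = m + 3" by simp_all
      then show ?thesis using f2[of m] f2[of "m + 2"] by (simp only: ac_simps)
    qed
    have c1: "real (m + 4 choose (k + 2)) * (fact (k + 2) * fact (j + 2)) = fact (m + 4)"
    proof -
      have "m + 4 - (k + 2) = j + 2" "k + 2 \<le> m + 4" using m by simp_all
      with binomial_fact[of "k + 2" "m + 4", where 'a = real] show ?thesis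
        by (simp only:) (simp del: fact_Suc)
    qed
    have c2: "real (m choose k) * (fact k * fact j) = fact m"
      using m by (subst binomial_fact) auto
    have "real (m + 4 choose (k + 2)) * (real (k + 1) * real (k + 2) * real (j + 1) * real (j + 2)) * (fact k * fact j)
        = real (m + 1) * real (m + 2) * real (m + 3) * real (m + 4) * real (m choose k) * (fact k * fact j)"
      using c1 unfolding f4 unfolding f2 c2[symmetric] by (simp only: ac_simps)
    then have "real (m + 4 choose (k + 2)) * (real (k + 1) * real (k + 2) * real (j + 1) * real (j + 2))
        = real (m + 1) * real (m + 2) * real (m + 3) * real (m + 4) * real (m choose k)"
      by simp
    then have b: "real (m + 4 choose (k + 2)) = real (m + 1) * real (m + 2) * real (m + 3) * real (m + 4) * real (m choose k)
       / (real (k + 1) * real (k + 2) * real (j + 1) * real (j + 2))"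
      by (subst eq_divide_eq) auto
    have ms: "m + 1 - k = j + 1" "m + 2 - k = j + 2" "m + 4 - (k + 2) = j + 2" "m - k = j" using m by auto
    have pw: "x ^ (k + 2) * (1 - x) ^ (j + 2) = x ^ k * (1 - x) ^ j * (x * (1 - x))\<^sup>2"
      by (simp add: power_add power_mult_distrib power2_eq_square ac_simps)
    have gen: "1 / P * (C * p) = F * C / P * (p * w) / (F * w)" if "F \<noteq> 0" "w \<noteq> 0" for P C p F w :: real
      using that by simp
    show ?thesis
      unfolding Bernstein_def ms b mult.assoc[of _ "x ^ _"] pw
      by (rule gen) (use x in auto)
  qed
  have "bern m (\<lambda>k. 1 / (real (k + 1) * real (k + 2) * real (m + 1 - k) * real (m + 2 - k))) x
     = (\<Sum>k\<le>m. Bernstein (m + 4) (k + 2) x) / ?c"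
    unfolding bern_def sum_divide_distrib by (intro sum.cong refl e) simp
  also have "(\<Sum>k\<le>m. Bernstein (m + 4) (k + 2) x) = (\<Sum>k\<in>(\<lambda>k. k + 2) ` {..m}. Bernstein (m + 4) k x)"
    by (subst sum.reindex) (auto simp: inj_on_def)
  also have "\<dots> \<le> (\<Sum>k\<le>m + 4. Bernstein (m + 4) k x)"
    by (rule sum_mono2) (use x in \<open>auto intro!: Bernstein_nonneg\<close>)
  also have "\<dots> = 1" by simp
  finally show ?thesis using c by (simp add: divide_right_mono)
qed

section \<open>Second differences under a weighted bound on the second derivative\<close>

text \<open>Comparison with a majorant, by two mean value inequalities; this takes the place of a
  double integral.\<close>

lemma abs_le_of_deriv2:
  fixes G G1 G2 P P1 P2 :: "real \<Rightarrow> real"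
  assumes s: "0 \<le> s"
    and G: "\<And>t. (G has_real_derivative G1 t) (at t)" "\<And>t. (G1 has_real_derivative G2 t) (at t)"
    and P: "\<And>t. (P has_real_derivative P1 t) (at t)" "\<And>t. (P1 has_real_derivative P2 t) (at t)"
    and z: "G1 0 = 0" "P1 0 = 0" "P 0 = 0"
    and le: "\<And>t. 0 < t \<Longrightarrow> t < s \<Longrightarrow> \<bar>G2 t\<bar> \<le> P2 t"
  shows "\<bar>G s - G 0\<bar> \<le> P s"
proof (cases "s = 0")
  case False
  have c: "continuous_on A f" if "\<And>t. (f has_real_derivative f' t) (at t)" for f f' :: "real \<Rightarrow> real" and A
    using that by (meson DERIV_continuous continuous_at_imp_continuous_on)
  have 1: "\<bar>G1 t\<bar> \<le> P1 t" if t: "0 < t" "t < s" for t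
  proof -
    have "norm (G1 t - G1 0) \<le> P1 t - P1 0"
      by (rule differentiable_bound_general[of 0 t G1 P1 G2 P2])
         (use t le G(2) P(2) in \<open>auto intro!: c[OF G(2)] c[OF P(2)] simp: has_real_derivative_iff_has_vector_derivative\<close>)
    then show ?thesis using z by simp
  qed
  have "norm (G s - G 0) \<le> P s - P 0"
    by (rule differentiable_bound_general[of 0 s G P G1 P1])
       (use False s 1 G(1) P(1) in \<open>auto intro!: c[OF G(1)] c[OF P(1)] simp: has_real_derivative_iff_has_vector_derivative\<close>)
  then show ?thesis using z by simp
qed (use z in simp)

text \<open>As a function of the step, the symmetric sum has second derivative
  \<open>g2 (x + t) + g2 (x - t)\<close>. The reciprocal weights at \<open>x + t\<close> and
  \<open>x - t\<close> are added before they are estimated, since their linear terms cancel. The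
  expression \<open>(A - s\<^sup>2)\<^sup>2 - q\<^sup>2 * s\<^sup>2\<close> is the product of the
  two weights at the full step; the positivity claims let applications divide by it and by
  \<open>A\<close>.\<close>

lemma sym_diff_weighted_bound:
  fixes g g1 g2 :: "real \<Rightarrow> real" and x s K e A q :: real
  assumes g: "\<And>t. (g has_real_derivative g1 t) (at t)" "\<And>t. (g1 has_real_derivative g2 t) (at t)"
    and b: "\<And>t. 0 \<le> t \<Longrightarrow> t \<le> 1 \<Longrightarrow> \<bar>g2 t\<bar> \<le> K / (t * (1 - t) + e)"
    and K: "0 \<le> K" and e: "0 < e" and s: "0 \<le> s" "0 \<le> x - s" "x + s \<le> 1"
    and A: "A = x * (1 - x) + e" and q: "q = 1 - 2 * x"
  shows "\<bar>g (x + s) - 2 * g x + g (x - s)\<bar>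
    \<le> K * (s\<^sup>2 / A * (1 + s\<^sup>2 * (A + q\<^sup>2) / (6 * ((A - s\<^sup>2)\<^sup>2 - q\<^sup>2 * s\<^sup>2))))"
    and "0 < (A - s\<^sup>2)\<^sup>2 - q\<^sup>2 * s\<^sup>2" and "0 < A"
proof -
  define den where "den t = (A - t\<^sup>2)\<^sup>2 - q\<^sup>2 * t\<^sup>2" for t
  define W where "W t = t * (1 - t) + e" for t
  have W: "W (x + t) = A + q * t - t\<^sup>2" "W (x - t) = A - q * t - t\<^sup>2" for t
    by (auto simp: W_def A q power2_eq_square algebra_simps)
  have pos: "0 < W (x + t)" "0 < W (x - t)" if "0 \<le> t" "t \<le> s" for t
    using that s e by (auto simp: W_def intro!: add_nonneg_pos mult_nonneg_nonneg)
  have den: "den t = W (x + t) * W (x - t)" for t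
    unfolding den_def W by (simp add: power2_eq_square algebra_simps)
  have denpos: "0 < den t" if "0 \<le> t" "t \<le> s" for t
    using pos[OF that] by (simp add: den)
  have As: "0 < A - t\<^sup>2" if "0 \<le> t" "t \<le> s" for t
    using pos[OF that] by (simp add: W)
  show Apos: "0 < A" using As[of 0] s by simp
  show "0 < (A - s\<^sup>2)\<^sup>2 - q\<^sup>2 * s\<^sup>2" using denpos[of s] s by (simp add: den_def)
  have denmono: "den s \<le> den t" if "0 \<le> t" "t \<le> s" for t
  proof -
    have "t\<^sup>2 \<le> s\<^sup>2" using that by (simp add: power_mono)
    then have "(A - s\<^sup>2)\<^sup>2 \<le> (A - t\<^sup>2)\<^sup>2" "q\<^sup>2 * t\<^sup>2 \<le> q\<^sup>2 * s\<^sup>2"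
      using As[of s] s by (auto intro!: power_mono mult_left_mono)
    then show ?thesis by (simp add: den_def)
  qed
  define B where "B = (A + q\<^sup>2) / (A * den s)"
  \<comment> \<open>The exact sum exceeds \<open>2 / A\<close> by a term with factor
    \<open>t\<^sup>2\<close>. Freezing its denominator at \<open>t = s\<close> makes the bound a
    polynomial in \<open>t\<close>, easily integrated twice.\<close>
  have V: "1 / W (x + t) + 1 / W (x - t) \<le> 2 / A + 2 * B * t\<^sup>2" if t: "0 \<le> t" "t \<le> s" for t
  proof -
    have "1 / W (x + t) + 1 / W (x - t) = 2 * (A - t\<^sup>2) / den t"
      using pos[OF t] by (simp add: den divide_simps) (simp add: W)
    also have "\<dots> = 2 / A + 2 * t\<^sup>2 * (A - t\<^sup>2 + q\<^sup>2) / (A * den t)"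
      using Apos denpos[OF t]
      by (simp add: divide_simps) (simp add: den_def power2_eq_square algebra_simps)
    also have "2 * t\<^sup>2 * (A - t\<^sup>2 + q\<^sup>2) / (A * den t) \<le> 2 * t\<^sup>2 * (A + q\<^sup>2) / (A * den s)"
      using Apos denpos[OF t] denpos[of s] denmono[OF t] s t As[OF t]
      by (intro frac_le mult_left_mono mult_nonneg_nonneg mult_pos_pos) auto
    finally show ?thesis by (simp add: B_def algebra_simps)
  qed
  have "\<bar>(g (x + s) + g (x - s)) - (g (x + 0) + g (x - 0))\<bar> \<le> K * (s\<^sup>2 / A + B * s ^ 4 / 6)"
  proof (rule abs_le_of_deriv2[where ?G1.0 = "\<lambda>t. g1 (x + t) - g1 (x - t)" and ?G2.0 = "\<lambda>t. g2 (x + t) + g2 (x - t)"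
        and ?P1.0 = "\<lambda>t. K * (2 * t / A + 2 * B * t ^ 3 / 3)" and ?P2.0 = "\<lambda>t. K * (2 / A + 2 * B * t\<^sup>2)"])
    have c1: "((\<lambda>t. f (x + t)) has_real_derivative f' (x + t)) (at t)"
      and c2: "((\<lambda>t. f (x - t)) has_real_derivative - f' (x - t)) (at t)"
      if "\<And>t. (f has_real_derivative f' t) (at t)" for f f' t
    proof -
      have a: "((\<lambda>t. x + t) has_real_derivative 1) (at t)" "((\<lambda>t. x - t) has_real_derivative - 1) (at t)"
        by (auto intro!: derivative_eq_intros)
      show "((\<lambda>t. f (x + t)) has_real_derivative f' (x + t)) (at t)"
        using DERIV_chain2[OF that a(1)] by simp
      show "((\<lambda>t. f (x - t)) has_real_derivative - f' (x - t)) (at t)"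
        using DERIV_chain2[OF that a(2)] by simp
    qed
    show "((\<lambda>t. g (x + t) + g (x - t)) has_real_derivative g1 (x + t) - g1 (x - t)) (at t)" for t
      using DERIV_add[OF c1[OF g(1)] c2[OF g(1)]] by simp
    show "((\<lambda>t. g1 (x + t) - g1 (x - t)) has_real_derivative g2 (x + t) + g2 (x - t)) (at t)" for t
      using DERIV_diff[OF c1[OF g(2)] c2[OF g(2)]] by simp
    show "((\<lambda>t. K * (t\<^sup>2 / A + B * t ^ 4 / 6)) has_real_derivative K * (2 * t / A + 2 * B * t ^ 3 / 3)) (at t)" for t
      using Apos by (auto intro!: derivative_eq_intros simp: field_simps)
    show "((\<lambda>t. K * (2 * t / A + 2 * B * t ^ 3 / 3)) has_real_derivative K * (2 / A + 2 * B * t\<^sup>2)) (at t)" for t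
      using Apos by (auto intro!: derivative_eq_intros simp: field_simps)
    fix t assume t: "0 < t" "t < s"
    have "\<bar>g2 (x + t) + g2 (x - t)\<bar> \<le> K / W (x + t) + K / W (x - t)"
      using b[of "x + t"] b[of "x - t"] t s by (auto simp: W_def)
    also have "\<dots> = K * (1 / W (x + t) + 1 / W (x - t))" by (simp add: algebra_simps)
    also have "\<dots> \<le> K * (2 / A + 2 * B * t\<^sup>2)" using V[of t] t K by (intro mult_left_mono) auto
    finally show "\<bar>g2 (x + t) + g2 (x - t)\<bar> \<le> K * (2 / A + 2 * B * t\<^sup>2)" .
  qed (use s in auto)
  moreover have "s\<^sup>2 / A + B * s ^ 4 / 6 = s\<^sup>2 / A * (1 + s\<^sup>2 * (A + q\<^sup>2) / (6 * den s))"
    using Apos denpos[of s] s by (simp add: B_def field_simps)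
  ultimately show "\<bar>g (x + s) - 2 * g x + g (x - s)\<bar>
    \<le> K * (s\<^sup>2 / A * (1 + s\<^sup>2 * (A + q\<^sup>2) / (6 * ((A - s\<^sup>2)\<^sup>2 - q\<^sup>2 * s\<^sup>2))))"
    by (simp add: den_def algebra_simps)
qed


text \<open>The addend \<open>3 / (5 n)\<close> pays for the growth of the reciprocal weight inside
  the interval: everything reduces to the claim that \<open>w\<close> times the correction factor is
  at most \<open>A = w + e\<close>.\<close>

lemma sym_diff_phi_le:
  fixes g g1 g2 :: "real \<Rightarrow> real"
  assumes g: "\<And>t. (g has_real_derivative g1 t) (at t)" "\<And>t. (g1 has_real_derivative g2 t) (at t)"
    and b: "\<And>t. 0 \<le> t \<Longrightarrow> t \<le> 1 \<Longrightarrow> \<bar>g2 t\<bar> * (t * (1 - t) + 3 / 5 / n) \<le> n * H"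
    and n: "6 \<le> n" and h: "0 \<le> h" "h\<^sup>2 \<le> 1 / n"
    and x: "0 \<le> x" "x \<le> 1" "0 \<le> x - h * phi x" "x + h * phi x \<le> 1" and H: "0 \<le> H"
  shows "\<bar>sym_diff2 (h * phi x) g x\<bar> \<le> H"
proof -
  define e w s A q where "e = 3 / 5 / n" and "w = x * (1 - x)" and "s = h * phi x" and "A = w + e" and "q = 1 - 2 * x"
  have e: "0 < e" using n by (simp add: e_def)
  have w: "0 \<le> w" using x by (simp add: w_def)
  have s: "0 \<le> s" using h x by (simp add: s_def phi_def)
  have s2: "s\<^sup>2 = h\<^sup>2 * w" using w by (simp add: s_def phi_def w_def power_mult_distrib)
  have ns: "n * s\<^sup>2 \<le> w"
  proof -
    have "n * s\<^sup>2 = (n * h\<^sup>2) * w" by (simp add: s2)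
    also have "\<dots> \<le> 1 * w" using h n w by (intro mult_right_mono) (auto simp: field_simps)
    finally show ?thesis by simp
  qed
  have b': "\<bar>g2 t\<bar> \<le> (n * H) / (t * (1 - t) + e)" if "0 \<le> t" "t \<le> 1" for t
  proof -
    have "0 < t * (1 - t) + e" using that e by (intro add_nonneg_pos) auto
    then show ?thesis using b[OF that] by (simp add: pos_le_divide_eq e_def)
  qed
  define den where "den = (A - s\<^sup>2)\<^sup>2 - q\<^sup>2 * s\<^sup>2"
  note sb = sym_diff_weighted_bound[OF g b' _ e s _ _ A_def[unfolded w_def] q_def]
  have A: "0 < A" using sb(3) n H x by (simp add: s_def)
  have den: "0 < den" using sb(2) n H x by (simp add: s_def den_def)
  have main: "\<bar>g (x + s) - 2 * g x + g (x - s)\<bar> \<le> (n * H) * (s\<^sup>2 / A * (1 + s\<^sup>2 * (A + q\<^sup>2) / (6 * den)))"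
    using sb(1) n H x by (simp add: s_def den_def)
  have q2: "q\<^sup>2 = 1 - 4 * w" by (simp add: q_def w_def power2_eq_square algebra_simps)
  \<comment> \<open>Both sides have the same order, because \<open>s\<^sup>2\<close> is at most
    \<open>w / n\<close> and \<open>e\<close> is a multiple of \<open>1 / n\<close>. The assumption
    on \<open>n\<close> enters as \<open>e \<le> 1 / 10\<close>.\<close>
  have "w * (s\<^sup>2 * (A + q\<^sup>2)) \<le> e * (6 * den)"
  proof -
    have 1: "w * (s\<^sup>2 * (A + q\<^sup>2)) \<le> w * (s\<^sup>2 * (1 + e))"
      using w by (intro mult_left_mono) (auto simp: A_def q2)
    have "den = A\<^sup>2 - s\<^sup>2 * (1 + 2 * e) + 2 * w * s\<^sup>2 + (s\<^sup>2)\<^sup>2"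
      unfolding den_def q2 A_def by algebra
    then have 2: "A\<^sup>2 - s\<^sup>2 * (1 + 2 * e) \<le> den" using w by simp
    have 3: "s\<^sup>2 \<le> w / n" using ns n by (simp add: field_simps)
    have "w * (s\<^sup>2 * (1 + e)) + 6 * e * (s\<^sup>2 * (1 + 2 * e)) = s\<^sup>2 * (w * (1 + e) + 6 * e * (1 + 2 * e))"
      by (simp add: algebra_simps)
    also have "\<dots> \<le> (w / n) * (w * (1 + e) + 6 * e * (1 + 2 * e))"
      using 3 w e by (intro mult_right_mono add_nonneg_nonneg mult_nonneg_nonneg) auto
    also have "\<dots> \<le> 6 * e * A\<^sup>2"
    proof -
      have en: "e * n = 3 / 5" using n by (simp add: e_def)
      have "w * (w * (1 + e) + 6 * e * (1 + 2 * e)) \<le> 6 * (3 / 5) * (w\<^sup>2 + 2 * w * e)"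
      proof -
        have e1: "e \<le> 1 / 10" using n by (simp add: e_def field_simps)
        have "w * (w * (1 + e)) \<le> w * (w * 2)" using w e1 by (intro mult_left_mono) auto
        moreover have "w * (6 * e * (1 + 2 * e)) \<le> w * (6 * e * (6 / 5))"
          using w e e1 by (intro mult_left_mono) auto
        moreover have "w * (w * 2) \<le> 6 * (3 / 5) * w\<^sup>2" by (simp add: power2_eq_square)
        moreover have "w * (6 * e * (6 / 5)) = 6 * (3 / 5) * (2 * w * e)" by simp
        ultimately show ?thesis by (simp only: distrib_left)
      qed
      also have "\<dots> \<le> 6 * (e * n) * A\<^sup>2"
        unfolding en A_def using e by (simp add: power2_eq_square algebra_simps)
      finally show ?thesis using n by (simp add: field_simps)
    qed
    finally show ?thesis using 1 2 e mult_left_mono[OF 2, of "6 * e"] by (simp add: algebra_simps)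
  qed
  then have "w * (s\<^sup>2 * (A + q\<^sup>2) / (6 * den)) \<le> e" using den by (simp add: field_simps)
  then have 4: "w * (1 + s\<^sup>2 * (A + q\<^sup>2) / (6 * den)) \<le> A" by (simp add: A_def algebra_simps)
  have 5: "0 \<le> 1 + s\<^sup>2 * (A + q\<^sup>2) / (6 * den)" using den A by simp
  have "(n * H) * (s\<^sup>2 / A * (1 + s\<^sup>2 * (A + q\<^sup>2) / (6 * den)))
     = H * ((n * s\<^sup>2) * (1 + s\<^sup>2 * (A + q\<^sup>2) / (6 * den)) / A)" by simp
  also have "\<dots> \<le> H * (A / A)"
    using A H order_trans[OF mult_right_mono[OF ns 5] 4] by (intro mult_left_mono divide_right_mono) auto
  also have "\<dots> = H" using A by simp
  finally show ?thesis using main by (simp add: sym_diff2_def s_def)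
qed

text \<open>At the node with \<open>j (n - j) / n = c - 3 / 5\<close>, \<open>1 / c\<close> is what a constant weight would give; the
  second factor accounts for its variation between the neighbouring nodes.\<close>

definition Lw :: "real \<Rightarrow> real" where "Lw c = 1 / c * (1 + 1 / (6 * (c\<^sup>2 - 1)))"

lemma Lw_antimono: "1 < c \<Longrightarrow> c \<le> c' \<Longrightarrow> Lw c' \<le> Lw c"
proof -
  assume c: "1 < c" "c \<le> c'"
  have "c\<^sup>2 \<le> c'\<^sup>2" "1 < c\<^sup>2" using c by (auto simp: power_mono)
  then show ?thesis unfolding Lw_def using c
    by (intro mult_mono frac_le add_mono mult_left_mono) auto
qed

text \<open>In units of \<open>n\<^sup>2\<close>, \<open>node_weight\<close> equals
  \<open>p (p + 1 + 1 / n)\<close>, and the bound by \<open>Lw\<close> must not exceed its inverse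
  square root. For large \<open>p\<close> this compares \<open>(p + 3 / 5)\<^sup>2\<close> with
  \<open>p\<^sup>2 + p\<close>, so the addend has to exceed 1 / 2.\<close>

lemma Lw_sq:
  assumes p: "99 / 100 \<le> p" and e: "0 \<le> e" "e \<le> 1 / 100"
  shows "(Lw (p + 3 / 5))\<^sup>2 * (p * (p + 1 + e)) \<le> 1"
proof -
  define t where "t = p - 99 / 100"
  have t: "0 \<le> t" using p by (simp add: t_def)
  define c where "c = p + 3 / 5"
  have ct: "c = t + 159 / 100" by (simp add: c_def t_def)
  define u where "u = 6 * (c\<^sup>2 - 1)"
  have c1: "1 < c" using ct t by simp
  then have u: "0 < u" by (simp add: u_def)
  have "(1 + u)\<^sup>2 * (p * (p + 1 + e)) \<le> (1 + u)\<^sup>2 * (p * (p + 1 + 1 / 100))"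
    using p e by (intro mult_left_mono) auto
  also have "\<dots> \<le> c\<^sup>2 * u\<^sup>2"
  proof -
    have "0 \<le> c\<^sup>2 * u\<^sup>2 - (1 + u)\<^sup>2 * (p * (p + 1 + 1 / 100))"
    proof -
      have pt: "p = t + 99 / 100" by (simp add: t_def)
      \<comment> \<open>Expansion at the smallest admissible \<open>p\<close>; all coefficients are
        positive.\<close>
      have "c\<^sup>2 * u\<^sup>2 - (1 + u)\<^sup>2 * (p * (p + 1 + 1 / 100)) = 1946849537169 / 250000000000 * t ^ 0 + 37181400779 / 500000000 * t ^ 1 + 422794913 / 2500000 * t ^ 2 + 707631 / 5000 * t ^ 3 + 25617 / 500 * t ^ 4 + 171 / 25 * t ^ 5"
        unfolding u_def ct pt by algebra
      then show ?thesis using t by simp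
    qed
    then show ?thesis by simp
  qed
  finally have "(1 + u)\<^sup>2 * (p * (p + 1 + e)) \<le> c\<^sup>2 * u\<^sup>2" .
  moreover have "Lw c = (1 + u) / (c * u)"
  proof -
    have "Lw c = 1 / c * (1 + 1 / u)" by (simp only: Lw_def u_def)
    then show ?thesis using u by (simp add: field_simps)
  qed
  ultimately show ?thesis
    using c1 u by (simp add: c_def[symmetric] power_divide power_mult_distrib)
qed

text \<open>This is \<open>sym_diff_weighted_bound\<close> with step \<open>1 / n\<close> at an
  interior node, rescaled by \<open>n\<close>: the weight becomes \<open>c = p + 3 / 5\<close>, and
  the product of the neighbouring weights becomes at least \<open>c\<^sup>2 - 1\<close>.\<close>

lemma diff2_weighted_bound:
  fixes g g1 g2 :: "real \<Rightarrow> real"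
  assumes g: "\<And>t. (g has_real_derivative g1 t) (at t)" "\<And>t. (g1 has_real_derivative g2 t) (at t)"
    and b: "\<And>t. 0 \<le> t \<Longrightarrow> t \<le> 1 \<Longrightarrow> \<bar>g2 t\<bar> * (t * (1 - t) + 3 / 5 / n) \<le> n * H"
    and n: "100 \<le> n" and j: "1 \<le> j" "j \<le> n - 1" and H: "0 \<le> H"
  shows "\<bar>g ((j + 1) / n) - 2 * g (j / n) + g ((j - 1) / n)\<bar> \<le> H * Lw (j * (n - j) / n + 3 / 5)"
proof -
  define p where "p = j * (n - j) / n"
  define e w s A c x where "e = 3 / 5 / n" and "w = p / n" and "s = 1 / n" and "A = w + e"
    and "c = p + 3 / 5" and x: "x = j / n"
  have p: "99 / 100 \<le> p"
  proof -
    have "n - 1 \<le> j * (n - j)"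
    proof -
      have "j * (n - j) - (n - 1) = (j - 1) * (n - 1 - j)" by (simp add: algebra_simps)
      then show ?thesis using j by (metis diff_ge_0_iff_ge mult_nonneg_nonneg)
    qed
    then have "99 / 100 * n \<le> j * (n - j)" using n by simp
    then show ?thesis using n by (simp add: p_def field_simps)
  qed
  have w: "w = x * (1 - x)" using n by (simp add: w_def p_def x field_simps)
  have e: "0 < e" using n by (simp add: e_def)
  have b': "\<bar>g2 t\<bar> \<le> (n * H) / (t * (1 - t) + e)" if "0 \<le> t" "t \<le> 1" for t
  proof -
    have "0 < t * (1 - t) + e" using that e by (intro add_nonneg_pos) auto
    then show ?thesis using b[OF that] by (simp add: pos_le_divide_eq e_def)
  qed
  have xs: "0 \<le> x - s" "x + s \<le> 1" "0 \<le> s" using j n by (auto simp: x s_def field_simps)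
  define den where "den = (A - s\<^sup>2)\<^sup>2 - (1 - 2 * x)\<^sup>2 * s\<^sup>2"
  have nH: "0 \<le> n * H" using n H by simp
  have Aw: "A = x * (1 - x) + e" by (simp add: A_def w)
  note sb = sym_diff_weighted_bound[OF g b' nH e xs(3,1,2) Aw refl]
  have A: "0 < A" and den: "0 < den" using sb(2,3) by (auto simp: den_def)
  have main: "\<bar>g (x + s) - 2 * g x + g (x - s)\<bar> \<le> (n * H) * (s\<^sup>2 / A * (1 + s\<^sup>2 * (A + (1 - 2 * x)\<^sup>2) / (6 * den)))"
    using sb(1) by (simp add: den_def)
  have q2: "(1 - 2 * x)\<^sup>2 = 1 - 4 * w" by (simp add: w power2_eq_square algebra_simps)
  have c1: "1 < c" using p by (simp add: c_def)
  then have c2: "0 < c\<^sup>2 - 1" by simp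
  have nA: "n * A = c" using n by (simp add: A_def w_def e_def c_def field_simps)
  have dn: "c\<^sup>2 - 1 \<le> n\<^sup>2 * den"
  proof -
    have "n\<^sup>2 * den = (n * A - n * s\<^sup>2)\<^sup>2 - (1 - 4 * w) * (n * s)\<^sup>2"
      unfolding den_def q2 by algebra
    also have "n * s = 1" using n by (simp add: s_def)
    also have "n * s\<^sup>2 = s" using n by (simp add: s_def power2_eq_square)
    finally have "n\<^sup>2 * den = (c - s)\<^sup>2 - (1 - 4 * w) * 1\<^sup>2" by (simp add: nA)
    moreover have "4 * w = 4 * p * s" by (simp add: w_def s_def)
    ultimately have "n\<^sup>2 * den = c\<^sup>2 - 1 + s * (4 * p - 2 * c + s)" by (simp add: power2_eq_square algebra_simps)
    moreover have "0 \<le> s * (4 * p - 2 * c + s)" using p xs by (intro mult_nonneg_nonneg) (auto simp: c_def)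
    ultimately show ?thesis by simp
  qed
  have Aq: "A + (1 - 2 * x)\<^sup>2 \<le> 1"
    using p n unfolding q2 A_def w_def e_def by (simp add: field_simps)
  have "s\<^sup>2 * (A + (1 - 2 * x)\<^sup>2) / (6 * den) \<le> s\<^sup>2 * 1 / (6 * den)"
    using Aq den by (intro divide_right_mono mult_left_mono) auto
  also have "\<dots> = 1 / (6 * (n\<^sup>2 * den))" using n by (simp add: s_def power_divide)
  also have "\<dots> \<le> 1 / (6 * (c\<^sup>2 - 1))" using dn c2 by (intro divide_left_mono) (auto intro!: mult_pos_pos)
  finally have sg: "s\<^sup>2 * (A + (1 - 2 * x)\<^sup>2) / (6 * den) \<le> 1 / (6 * (c\<^sup>2 - 1))" .
  have "(n * H) * (s\<^sup>2 / A * (1 + s\<^sup>2 * (A + (1 - 2 * x)\<^sup>2) / (6 * den)))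
     = H * (1 / c * (1 + s\<^sup>2 * (A + (1 - 2 * x)\<^sup>2) / (6 * den)))"
  proof -
    have "n * s\<^sup>2 / A = 1 / c" using n A nA by (simp add: s_def power2_eq_square field_simps)
    moreover have "(n * H) * (s\<^sup>2 / A * Y) = H * (n * s\<^sup>2 / A * Y)" for Y by simp
    ultimately show ?thesis by simp
  qed
  also have "\<dots> \<le> H * Lw c"
    unfolding Lw_def using c1 H sg by (intro mult_left_mono) auto
  finally have "\<bar>g (x + s) - 2 * g x + g (x - s)\<bar> \<le> H * Lw c" using main by simp
  moreover have "x + s = (j + 1) / n" "x - s = (j - 1) / n" by (auto simp: x s_def add_divide_distrib diff_divide_distrib)
  ultimately show ?thesis by (simp add: x c_def p_def)
qed

section \<open>Second and fourth derivatives\<close>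

definition bern_d2 :: "nat \<Rightarrow> (nat \<Rightarrow> real) \<Rightarrow> real \<Rightarrow> real" where
  "bern_d2 n v x = real n * real (n - 1) * bern (n - 2) (diff2 v) x"

lemma bern_derivs:
  obtains g1 where "\<And>t. (bern (m + 2) v has_real_derivative g1 t) (at t)"
    "\<And>t. (g1 has_real_derivative bern_d2 (m + 2) v t) (at t)"
proof
  show "(bern (m + 2) v has_real_derivative real (m + 2) * bern (Suc m) (\<lambda>k. v (Suc k) - v k) t) (at t)" for t
    using bern_has_derivative[of "Suc m" v t] by simp
  show "((\<lambda>x. real (m + 2) * bern (Suc m) (\<lambda>k. v (Suc k) - v k) x) has_real_derivative bern_d2 (m + 2) v t) (at t)" for t
    using bern_has_derivative2[of m v t] by (simp add: bern_d2_def)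
qed

lemma bern_d2_krav:
  assumes x: "0 < x" "x < 1" and n: "2 \<le> n"
  shows "bern_d2 n v x * (x * (1 - x))\<^sup>2 = bern n (\<lambda>k. krav n x k * v k) x"
proof -
  obtain m where m: "n = m + 2" by (rule that[of "n - 2"]) (use n in auto)
  show ?thesis using bern_diff2_krav[OF x, of m v] by (simp add: m bern_d2_def)
qed

lemma bern_d2_le_sqrt2:
  assumes x: "0 < x" "x < 1" and n: "2 \<le> n" and D: "\<And>k. k \<le> n \<Longrightarrow> \<bar>v k\<bar> \<le> D"
  shows "\<bar>bern_d2 n v x\<bar> * (x * (1 - x)) \<le> sqrt 2 * real n * D"
proof -
  define w where "w = x * (1 - x)"
  have w: "0 < w" using x by (simp add: w_def)
  have D0: "0 \<le> D" using D[of 0] by simp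
  have "(bern_d2 n v x * w\<^sup>2)\<^sup>2 \<le> bern n (\<lambda>k. (krav n x k)\<^sup>2) x * bern n (\<lambda>k. (v k)\<^sup>2) x"
    unfolding w_def bern_d2_krav[OF x n] using x by (intro bern_Cauchy_Schwarz) auto
  also have "\<dots> \<le> (2 * real n * (real n - 1) * w\<^sup>2) * D\<^sup>2"
  proof (rule mult_mono)
    show "bern n (\<lambda>k. (v k)\<^sup>2) x \<le> D\<^sup>2"
      using bern_mono[of x n "\<lambda>k. (v k)\<^sup>2" "\<lambda>k. D\<^sup>2"] x D D0 by (simp add: bern_const abs_le_square_iff[symmetric])
    show "0 \<le> bern n (\<lambda>k. (v k)\<^sup>2) x" using x by (intro bern_nonneg) auto
  qed (use n in \<open>auto simp: bern_krav_sq[OF x] w_def\<close>)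
  also have "\<dots> \<le> (sqrt 2 * real n * D * w)\<^sup>2"
  proof -
    have "2 * real n * (real n - 1) * w\<^sup>2 * D\<^sup>2 \<le> 2 * real n * real n * w\<^sup>2 * D\<^sup>2"
      by (intro mult_right_mono mult_left_mono) auto
    also have "\<dots> = (sqrt 2 * real n * D * w)\<^sup>2"
      by (simp add: power_mult_distrib) (simp add: power2_eq_square)
    finally show ?thesis .
  qed
  finally have "\<bar>bern_d2 n v x * w\<^sup>2\<bar> \<le> sqrt 2 * real n * D * w"
    using D0 w by (simp add: abs_le_square_iff[symmetric] abs_mult)
  then have "(\<bar>bern_d2 n v x\<bar> * w) * w \<le> (sqrt 2 * real n * D) * w"
    using w by (simp add: abs_mult power2_eq_square mult.assoc)
  then show ?thesis using w by (simp add: w_def[symmetric])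
qed

text \<open>For points so close to an endpoint that a bound by \<open>1 / (x (1 - x))\<close> is
  useless.\<close>

lemma bern_d2_le_4:
  assumes x: "0 \<le> x" "x \<le> 1" and n: "2 \<le> n" and D: "\<And>k. k \<le> n \<Longrightarrow> \<bar>v k\<bar> \<le> D"
  shows "\<bar>bern_d2 n v x\<bar> \<le> 4 * real n * real n * D"
proof -
  have D0: "0 \<le> D" using D[of 0] by simp
  have "\<bar>diff2 v k\<bar> \<le> 4 * D" if "k \<le> n - 2" for k
  proof -
    have "k \<le> n" "k + 1 \<le> n" "k + 2 \<le> n" using that n by auto
    from D[OF this(1)] D[OF this(2)] D[OF this(3)] show ?thesis unfolding diff2_def by linarith
  qed
  then have "\<bar>bern (n - 2) (diff2 v) x\<bar> \<le> 4 * D" by (rule bern_bound[OF x])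
  then have "\<bar>bern_d2 n v x\<bar> \<le> real n * real n * (4 * D)"
    unfolding bern_d2_def abs_mult by (intro mult_mono) auto
  then show ?thesis by simp
qed

definition bern_d4 :: "nat \<Rightarrow> (nat \<Rightarrow> real) \<Rightarrow> real \<Rightarrow> real" where
  "bern_d4 n v x = real n * real (n - 1) * bern_d2 (n - 2) (diff2 v) x"

lemma bern_derivs4:
  assumes "4 \<le> n"
  obtains g1 g3 where "\<And>t. (bern n v has_real_derivative g1 t) (at t)"
    "\<And>t. (g1 has_real_derivative bern_d2 n v t) (at t)"
    "\<And>t. (bern_d2 n v has_real_derivative g3 t) (at t)"
    "\<And>t. (g3 has_real_derivative bern_d4 n v t) (at t)"
proof -
  obtain r where r: "n = r + 4" by (rule that[of "n - 4"]) (use assms in auto)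
  obtain g1 where g1: "\<And>t. (bern (r + 2 + 2) v has_real_derivative g1 t) (at t)"
    "\<And>t. (g1 has_real_derivative bern_d2 (r + 2 + 2) v t) (at t)"
    using bern_derivs[of "r + 2" v] by blast
  obtain h1 where h1: "\<And>t. (bern (r + 2) (diff2 v) has_real_derivative h1 t) (at t)"
    "\<And>t. (h1 has_real_derivative bern_d2 (r + 2) (diff2 v) t) (at t)"
    using bern_derivs[of r "diff2 v"] by blast
  have e: "r + 2 + 2 = n" "n - 2 = r + 2" using r by auto
  show ?thesis
  proof (rule that)
    show "(bern n v has_real_derivative g1 t) (at t)" "(g1 has_real_derivative bern_d2 n v t) (at t)" for t
      using g1 by (simp_all only: e)
    show "(bern_d2 n v has_real_derivative real n * real (n - 1) * h1 t) (at t)" for t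
      using DERIV_cmult[OF h1(1), of "real n * real (n - 1)" t] by (simp add: bern_d2_def[abs_def] e)
    show "((\<lambda>t. real n * real (n - 1) * h1 t) has_real_derivative bern_d4 n v t) (at t)" for t
      using DERIV_cmult[OF h1(2), of "real n * real (n - 1)" t] by (simp add: bern_d4_def e)
  qed
qed

text \<open>With \<open>j = k + 1\<close>, the middle node of the second difference at
  \<open>k\<close>, this is \<open>j (j + 1) (n - j) (n - j + 1)\<close>, close to
  \<open>n ^ 4\<close> times \<open>(x (1 - x))\<^sup>2\<close> at \<open>x = j / n\<close>. The
  shifts by 1 are those for which the reciprocals can be summed as in
  \<open>bern_inverse_weight\<close>.\<close>

definition node_weight :: "nat \<Rightarrow> nat \<Rightarrow> real" where
  "node_weight n k = real (k + 1) * real (k + 2) * real (n - 1 - k) * real (n - k)"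

text \<open>Cauchy--Schwarz against the Krawtchouk polynomial leaves the mean square
  \<open>S\<close> of the second differences. Averaging the reciprocal of \<open>node_weight\<close>
  gives the first bound. Replacing \<open>node_weight\<close> by its lower bound
  \<open>2 (n - 1) n\<close> gives the second, which is better where \<open>x (1 - x)\<close> is
  below \<open>sqrt 2 / n\<close>.\<close>

lemma bern_d4_bounds:
  assumes x: "0 < x" "x < 1" and n: "4 \<le> n" and H: "0 \<le> H"
    and v: "\<And>k. k \<le> n - 2 \<Longrightarrow> (diff2 v k)\<^sup>2 * node_weight n k \<le> (H * real n)\<^sup>2"
  shows "\<bar>bern_d4 n v x\<bar> * (x * (1 - x))\<^sup>2 \<le> sqrt 2 * (real n)\<^sup>2 * H"
    and "\<bar>bern_d4 n v x\<bar> * (x * (1 - x)) \<le> real n ^ 3 * H"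
proof -
  define w N where "w = x * (1 - x)" and "N = real n"
  obtain m where m: "n = m + 2" "2 \<le> m" by (rule that[of "n - 2"]) (use n in auto)
  have mN: "real m = N - 2" using m by (simp add: N_def)
  have N: "4 \<le> N" using n by (simp add: N_def)
  have w: "0 < w" using x by (simp add: w_def)
  have nw: "node_weight n k = real (k + 1) * real (k + 2) * real (m + 1 - k) * real (m + 2 - k)" for k
    by (simp add: node_weight_def m(1))
  have nw_pos: "0 < node_weight n k" if "k \<le> m" for k
    using that by (simp add: nw)
  define S where "S = bern m (\<lambda>k. (diff2 v k)\<^sup>2) x"
  have cs: "(bern_d4 n v x * w\<^sup>2)\<^sup>2 \<le> (N * (N - 1))\<^sup>2 * ((2 * (N - 2) * (N - 3) * w\<^sup>2) * S)"
  proof -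
    have "bern_d4 n v x * w\<^sup>2 = N * (N - 1) * (bern_d2 m (diff2 v) x * w\<^sup>2)"
      using m by (simp add: bern_d4_def N_def)
    also have "bern_d2 m (diff2 v) x * w\<^sup>2 = bern m (\<lambda>k. krav m x k * diff2 v k) x"
      unfolding w_def using m by (intro bern_d2_krav[OF x]) auto
    finally have e: "(bern_d4 n v x * w\<^sup>2)\<^sup>2 = (N * (N - 1))\<^sup>2 * (bern m (\<lambda>k. krav m x k * diff2 v k) x)\<^sup>2"
      by (simp add: power_mult_distrib)
    have "(bern m (\<lambda>k. krav m x k * diff2 v k) x)\<^sup>2 \<le> bern m (\<lambda>k. (krav m x k)\<^sup>2) x * S"
      unfolding S_def using x by (intro bern_Cauchy_Schwarz) auto
    also have "bern m (\<lambda>k. (krav m x k)\<^sup>2) x = 2 * (N - 2) * (N - 3) * w\<^sup>2"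
      unfolding bern_krav_sq[OF x] mN w_def by simp
    finally show ?thesis unfolding e by (intro mult_left_mono) auto
  qed
  have S1: "S * ((N - 1) * N * (N + 1) * (N + 2) * w\<^sup>2) \<le> (H * N)\<^sup>2"
  proof -
    have "S \<le> bern m (\<lambda>k. (H * N)\<^sup>2 * (1 / (real (k + 1) * real (k + 2) * real (m + 1 - k) * real (m + 2 - k)))) x"
      unfolding S_def
    proof (rule bern_mono)
      fix k assume k: "k \<le> m"
      have "(diff2 v k)\<^sup>2 \<le> (H * N)\<^sup>2 / node_weight n k"
        using v[of k] k nw_pos[OF k] m by (simp add: pos_le_divide_eq N_def)
      then show "(diff2 v k)\<^sup>2 \<le> (H * N)\<^sup>2 * (1 / (real (k + 1) * real (k + 2) * real (m + 1 - k) * real (m + 2 - k)))"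
        by (simp add: nw)
    qed (use x in auto)
    also have "\<dots> \<le> (H * N)\<^sup>2 * (1 / (real (m + 1) * real (m + 2) * real (m + 3) * real (m + 4) * w\<^sup>2))"
      unfolding bern_cmult w_def by (intro mult_left_mono bern_inverse_weight x) auto
    also have "real (m + 1) * real (m + 2) * real (m + 3) * real (m + 4) = (N - 1) * N * (N + 1) * (N + 2)"
      by (simp add: mN add.commute)
    finally have "S \<le> (H * N)\<^sup>2 / ((N - 1) * N * (N + 1) * (N + 2) * w\<^sup>2)" by simp
    then show ?thesis using w N by (simp add: pos_le_divide_eq)
  qed
  have S2: "S * (2 * (N - 1) * N) \<le> (H * N)\<^sup>2"
  proof -
    have "(diff2 v k)\<^sup>2 \<le> (H * N)\<^sup>2 / (2 * (N - 1) * N)" if k: "k \<le> m" for k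
    proof -
      have k': "real k \<le> N - 2" using k mN by simp
      have a: "N - 1 \<le> real (k + 1) * real (m + 1 - k)"
      proof -
        have "real (k + 1) * real (m + 1 - k) = N - 1 + real k * (N - 2 - real k)"
          using k by (simp add: of_nat_diff mN algebra_simps)
        then show ?thesis using k' by simp
      qed
      have b: "2 * N \<le> real (k + 2) * real (m + 2 - k)"
      proof -
        have "real (k + 2) * real (m + 2 - k) = 2 * N + real k * (N - 2 - real k)"
          using k by (simp add: of_nat_diff mN algebra_simps)
        then show ?thesis using k' by simp
      qed
      have "(N - 1) * (2 * N) \<le> (real (k + 1) * real (m + 1 - k)) * (real (k + 2) * real (m + 2 - k))"
        by (rule mult_mono[OF a b]) (use N in auto)
      then have "2 * (N - 1) * N \<le> node_weight n k" by (simp add: nw algebra_simps)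
      then have "(diff2 v k)\<^sup>2 * (2 * (N - 1) * N) \<le> (diff2 v k)\<^sup>2 * node_weight n k"
        by (intro mult_left_mono) auto
      also have "\<dots> \<le> (H * N)\<^sup>2" using v[of k] k m by (simp add: N_def)
      finally show ?thesis using N by (simp add: pos_le_divide_eq)
    qed
    then have "S \<le> bern m (\<lambda>k. (H * N)\<^sup>2 / (2 * (N - 1) * N)) x"
      unfolding S_def using x by (intro bern_mono) auto
    then show ?thesis using N by (simp add: bern_const pos_le_divide_eq)
  qed
  have S0: "0 \<le> S" unfolding S_def using x by (intro bern_nonneg) auto
  show "\<bar>bern_d4 n v x\<bar> * (x * (1 - x))\<^sup>2 \<le> sqrt 2 * (real n)\<^sup>2 * H"
  proof -
    have "(bern_d4 n v x * w\<^sup>2)\<^sup>2 \<le> (N * (N - 1))\<^sup>2 * (2 * ((N - 2) * (N - 3)) * (w\<^sup>2 * S))"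
      using cs by (simp only: mult.assoc)
    \<comment> \<open>\<open>(N - 2) (N - 3)\<close> is enlarged to complete the product that occurs
      in \<open>S1\<close>.\<close>
    also have "\<dots> \<le> (N * (N - 1))\<^sup>2 * (2 * ((N + 1) * (N + 2)) * (w\<^sup>2 * S))"
      using N S0 by (intro mult_left_mono mult_right_mono mult_mono) auto
    also have "\<dots> = 2 * (N * (N - 1)) * (S * ((N - 1) * N * (N + 1) * (N + 2) * w\<^sup>2))"
      by (simp add: power2_eq_square)
    also have "\<dots> \<le> 2 * (N * (N - 1)) * (H * N)\<^sup>2"
      using S1 N by (intro mult_left_mono) auto
    also have "\<dots> \<le> 2 * (N * N) * (H * N)\<^sup>2"
      using N by (intro mult_right_mono mult_left_mono) auto
    also have "\<dots> = (sqrt 2 * N\<^sup>2 * H)\<^sup>2"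
      by (simp add: power_mult_distrib) (simp add: eval_nat_numeral)
    finally have "\<bar>bern_d4 n v x * w\<^sup>2\<bar> \<le> sqrt 2 * N\<^sup>2 * H"
      using H N by (simp add: abs_le_square_iff[symmetric] abs_mult)
    then show ?thesis by (simp add: abs_mult w_def N_def)
  qed
  show "\<bar>bern_d4 n v x\<bar> * (x * (1 - x)) \<le> real n ^ 3 * H"
  proof -
    have "(bern_d4 n v x * w\<^sup>2)\<^sup>2 \<le> (N * (N - 1)) * w\<^sup>2 * ((N - 2) * (N - 3)) * (S * (2 * (N - 1) * N))"
    proof -
      have "(N * (N - 1))\<^sup>2 * ((2 * (N - 2) * (N - 3) * w\<^sup>2) * S)
          = (N * (N - 1)) * w\<^sup>2 * ((N - 2) * (N - 3)) * (S * (2 * (N - 1) * N))" by algebra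
      then show ?thesis using cs by (simp only:)
    qed
    also have "\<dots> \<le> (N * (N - 1)) * w\<^sup>2 * ((N - 2) * (N - 3)) * (H * N)\<^sup>2"
      using S2 N by (intro mult_left_mono mult_nonneg_nonneg) auto
    also have "\<dots> \<le> (N * N) * w\<^sup>2 * (N * N) * (H * N)\<^sup>2"
      using N by (intro mult_right_mono mult_mono) auto
    also have "\<dots> = (N ^ 3 * H * w)\<^sup>2"
      by (simp add: power_mult_distrib) (simp add: eval_nat_numeral)
    finally have "\<bar>bern_d4 n v x * w\<^sup>2\<bar> \<le> N ^ 3 * H * w"
      using H N w by (simp add: abs_le_square_iff[symmetric] abs_mult)
    then have "(\<bar>bern_d4 n v x\<bar> * w) * w \<le> (N ^ 3 * H) * w"
      using w by (simp add: abs_mult power2_eq_square mult.assoc)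
    then show ?thesis using w by (simp add: w_def[symmetric] N_def)
  qed
qed

section \<open>Taylor remainders\<close>

lemma abs_diff_le_of_deriv:
  fixes F P :: "real \<Rightarrow> real"
  assumes ab: "a \<le> b"
    and F: "\<And>t. (F has_real_derivative F' t) (at t)" and P: "\<And>t. (P has_real_derivative P' t) (at t)"
    and le: "\<And>t. a < t \<Longrightarrow> t < b \<Longrightarrow> \<bar>F' t\<bar> \<le> P' t"
  shows "\<bar>F b - F a\<bar> \<le> P b - P a"
proof (cases "a = b")
  case False
  have c: "continuous_on A f" if "\<And>t. (f has_real_derivative f' t) (at t)" for f f' :: "real \<Rightarrow> real" and A
    using that by (meson DERIV_continuous continuous_at_imp_continuous_on)
  have "norm (F b - F a) \<le> P b - P a"
    by (rule differentiable_bound_general[of a b F P F' P'])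
       (use False ab le F P in \<open>auto intro!: c[OF F] c[OF P] simp: has_real_derivative_iff_has_vector_derivative\<close>)
  then show ?thesis by simp
qed simp

text \<open>As \<open>(s - z) / s\<close> increases with \<open>s\<close>, its square may be frozen
  at \<open>s = y\<close>. The result is twice what the constant weight \<open>1 / y\<^sup>2\<close>
  would give.\<close>

lemma increment_left_coarse:
  fixes F :: "real \<Rightarrow> real"
  assumes zy: "0 \<le> z" "z \<le> y" and K: "0 \<le> K"
    and F: "\<And>t. (F has_real_derivative F' t) (at t)"
    and le: "\<And>s. z < s \<Longrightarrow> s < y \<Longrightarrow> \<bar>F' s\<bar> \<le> K * (s - z) ^ 3 / s\<^sup>2"
  shows "\<bar>F y - F z\<bar> \<le> K * ((y - z) ^ 4 / (2 * y\<^sup>2))"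
proof (cases "y = z")
  case False
  then have y: "0 < y" using zy by simp
  define r where "r = ((y - z) / y)\<^sup>2"
  have "\<bar>F y - F z\<bar> \<le> K * (r * (y - z)\<^sup>2 / 2) - K * (r * (z - z)\<^sup>2 / 2)"
  proof (rule abs_diff_le_of_deriv[OF zy(2) F])
    show "((\<lambda>t. K * (r * (t - z)\<^sup>2 / 2)) has_real_derivative K * (r * (t - z))) (at t)" for t
      by (auto intro!: derivative_eq_intros)
    fix s assume s: "z < s" "s < y"
    have "(s - z) / s \<le> (y - z) / y" using s zy y by (simp add: field_simps mult_right_mono)
    then have "((s - z) / s)\<^sup>2 \<le> r" unfolding r_def using s zy by (intro power_mono) auto
    then have "K * ((s - z) * ((s - z) / s)\<^sup>2) \<le> K * ((s - z) * r)"
      using s K by (intro mult_left_mono) auto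
    moreover have "K * (s - z) ^ 3 / s\<^sup>2 = K * ((s - z) * ((s - z) / s)\<^sup>2)"
      by (simp add: power_divide eval_nat_numeral)
    ultimately show "\<bar>F' s\<bar> \<le> K * (r * (s - z))" using le[OF s] by (simp add: mult.commute)
  qed
  also have "\<dots> = K * ((y - z) ^ 4 / (2 * y\<^sup>2))"
    by (simp add: r_def power_divide eval_nat_numeral)
  finally show ?thesis .
qed simp

text \<open>
  With \<open>u = (y - z) / y\<close> and \<open>s = y (1 - \<tau>)\<close>, the weight \<open>(u - \<tau>)\<^sup>3 / (1 - \<tau>)\<^sup>2\<close> is at most
  \<open>(u - \<tau>)\<^sup>3 (1 + 2 \<tau>) + \<tau>\<^sup>2 (3 - 2 \<tau>) (u - \<tau>) u\<^sup>2\<close>, whose integral over \<open>{0..u}\<close> is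
  \<open>u\<^sup>4 / 4 (1 + 2 u / 5 + u\<^sup>2 - 2 u\<^sup>3 / 5)\<close>.
\<close>

lemma increment_left:
  fixes F :: "real \<Rightarrow> real"
  assumes zy: "0 \<le> z" "z \<le> y" and y: "0 < y" and K: "0 \<le> K"
    and F: "\<And>t. (F has_real_derivative F' t) (at t)"
    and le: "\<And>s. z < s \<Longrightarrow> s < y \<Longrightarrow> \<bar>F' s\<bar> \<le> K * (s - z) ^ 3 / s\<^sup>2"
  shows "\<bar>F y - F z\<bar> \<le> K * ((y - z) ^ 4 / (4 * y\<^sup>2) * (231 / 200 + ((y - z) / y)\<^sup>2))"
proof -
  define u where "u = (y - z) / y"
  have u: "0 \<le> u" "u \<le> 1" using zy y by (auto simp: u_def)
  have z: "z = y * (1 - u)" using y by (simp add: u_def field_simps)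
  define Q where "Q \<tau> = - ((u - \<tau>) ^ 4 / 4 * (1 + 2 * u)) + 2 * (u - \<tau>) ^ 5 / 5
     + u\<^sup>2 * (u * \<tau> ^ 3 - 3 * \<tau> ^ 4 / 4 - u * \<tau> ^ 4 / 2 + 2 * \<tau> ^ 5 / 5)" for \<tau>
  define Q' where "Q' \<tau> = (u - \<tau>) ^ 3 * (1 + 2 * \<tau>) + \<tau>\<^sup>2 * (3 - 2 * \<tau>) * (u - \<tau>) * u\<^sup>2" for \<tau>
  have dQ: "(Q has_real_derivative Q' t) (at t)" for t
  proof -
    have "(Q has_real_derivative ((u - t) ^ 3 * (1 + 2 * u) - 2 * (u - t) ^ 4
      + u\<^sup>2 * (3 * u * t\<^sup>2 - 3 * t ^ 3 - 2 * u * t ^ 3 + 2 * t ^ 4))) (at t)"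
      unfolding Q_def[abs_def] by (auto intro!: derivative_eq_intros)
    moreover have "(u - t) ^ 3 * (1 + 2 * u) - 2 * (u - t) ^ 4
      + u\<^sup>2 * (3 * u * t\<^sup>2 - 3 * t ^ 3 - 2 * u * t ^ 3 + 2 * t ^ 4) = Q' t"
      unfolding Q'_def by algebra
    ultimately show ?thesis by simp
  qed
  have "\<bar>F y - F z\<bar> \<le> K * (- (y\<^sup>2) * Q ((y - y) / y)) - K * (- (y\<^sup>2) * Q ((y - z) / y))"
  proof (rule abs_diff_le_of_deriv[OF zy(2) F])
    show "((\<lambda>s. K * (- (y\<^sup>2) * Q ((y - s) / y))) has_real_derivative K * (y * Q' ((y - s) / y))) (at s)" for s
    proof -
      have "((\<lambda>s. (y - s) / y) has_real_derivative - 1 / y) (at s)"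
        using y by (auto intro!: derivative_eq_intros)
      from DERIV_cmult[OF DERIV_chain2[OF dQ this], of "K * - (y\<^sup>2)"] show ?thesis
        using y by (simp add: power2_eq_square mult.assoc)
    qed
    fix s assume s: "z < s" "s < y"
    define \<tau> where "\<tau> = (y - s) / y"
    have sy: "s = y * (1 - \<tau>)" using y by (simp add: \<tau>_def field_simps)
    have "0 < s" using s zy by simp
    then have t: "0 < \<tau>" "\<tau> < u" "\<tau> < 1" using s y zy by (auto simp: \<tau>_def u_def divide_strict_right_mono)
    have "(s - z) ^ 3 / s\<^sup>2 = y * ((u - \<tau>) ^ 3 / (1 - \<tau>)\<^sup>2)"
      using y t unfolding sy z by (simp add: power_mult_distrib right_diff_distrib[symmetric] eval_nat_numeral)
    \<comment> \<open>The linear Taylor polynomial \<open>1 + 2 \<tau>\<close> of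
      \<open>1 / (1 - \<tau>)\<^sup>2\<close> is split off exactly; only in the rest is
      \<open>(u - \<tau>) / (1 - \<tau>)\<close> replaced by \<open>u\<close>.\<close>
    also have "(u - \<tau>) ^ 3 / (1 - \<tau>)\<^sup>2 = (u - \<tau>) ^ 3 * (1 + 2 * \<tau>) + \<tau>\<^sup>2 * (3 - 2 * \<tau>) * (u - \<tau>) * ((u - \<tau>) / (1 - \<tau>))\<^sup>2"
      using t by (simp add: power_divide divide_simps) algebra
    also have "\<dots> \<le> Q' \<tau>"
    proof -
      have "(u - \<tau>) / (1 - \<tau>) \<le> u" using t u by (simp add: divide_le_eq algebra_simps mult_left_le)
      then have "((u - \<tau>) / (1 - \<tau>))\<^sup>2 \<le> u\<^sup>2" using t by (intro power_mono) auto
      then show ?thesis unfolding Q'_def using t by (intro add_left_mono mult_left_mono mult_nonneg_nonneg) auto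
    qed
    finally have "K * ((s - z) ^ 3 / s\<^sup>2) \<le> K * (y * Q' \<tau>)" using y K by (intro mult_left_mono) auto
    then show "\<bar>F' s\<bar> \<le> K * (y * Q' ((y - s) / y))" using le[OF s] by (simp add: \<tau>_def)
  qed
  also have "\<dots> = K * (y\<^sup>2 * (Q u - Q 0))" by (simp add: u_def right_diff_distrib)
  also have "Q u - Q 0 = u ^ 4 / 4 * (1 + 2 / 5 * u + u\<^sup>2 - 2 / 5 * u ^ 3)"
    by (simp add: Q_def algebra_simps eval_nat_numeral)
  also have "K * (y\<^sup>2 * (u ^ 4 / 4 * (1 + 2 / 5 * u + u\<^sup>2 - 2 / 5 * u ^ 3))) \<le> K * (y\<^sup>2 * (u ^ 4 / 4 * (231 / 200 + u\<^sup>2)))"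
  proof -
    \<comment> \<open>On the unit interval \<open>u - u ^ 3\<close> is largest at
      \<open>1 / sqrt 3\<close>, near 577 / 1000, where \<open>2 / 5 (u - u ^ 3)\<close> is about
      0.154; this is the origin of 231 / 200. The identity exhibits the almost double root
      there.\<close>
    have "231 / 200 - 1 - 2 / 5 * u + 2 / 5 * u ^ 3 = 2 / 5 * ((u - 577 / 1000)\<^sup>2 * (u + 1154 / 1000)) + (2 / 5 * (3 * (577 / 1000)\<^sup>2 - 1)) * u + (31 / 200 - 4 / 5 * (577 / 1000) ^ 3)"
      by algebra
    moreover have "0 \<le> (u - 577 / 1000)\<^sup>2 * (u + 1154 / 1000)" using u by (intro mult_nonneg_nonneg) auto
    moreover have "- 1 / 1000 \<le> (2 / 5 * (3 * (577 / 1000)\<^sup>2 - 1)) * u" using u by (simp add: power2_eq_square)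
    moreover have "1 / 1000 \<le> 31 / 200 - 4 / 5 * (577 / 1000 :: real) ^ 3" by (simp add: power3_eq_cube)
    ultimately have "2 / 5 * u - 2 / 5 * u ^ 3 + 1 \<le> 231 / 200" by linarith
    then show ?thesis using K by (intro mult_left_mono) auto
  qed
  also have "\<dots> = K * ((y - z) ^ 4 / (4 * y\<^sup>2) * (231 / 200 + ((y - z) / y)\<^sup>2))"
  proof -
    have "y\<^sup>2 * (u ^ 4 / 4) = (y - z) ^ 4 / (4 * y\<^sup>2)"
      using y by (simp add: u_def power_divide eval_nat_numeral)
    moreover have "K * (y\<^sup>2 * (u ^ 4 / 4 * Z)) = K * (y\<^sup>2 * (u ^ 4 / 4) * Z)" for Z by simp
    ultimately show ?thesis unfolding u_def[symmetric] by simp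
  qed
  finally show ?thesis .
qed

lemma increment_right_coarse:
  fixes F :: "real \<Rightarrow> real"
  assumes zy: "y \<le> z" "z \<le> 1" and K: "0 \<le> K"
    and F: "\<And>t. (F has_real_derivative F' t) (at t)"
    and le: "\<And>s. y < s \<Longrightarrow> s < z \<Longrightarrow> \<bar>F' s\<bar> \<le> K * (z - s) ^ 3 / (1 - s)\<^sup>2"
  shows "\<bar>F z - F y\<bar> \<le> K * ((z - y) ^ 4 / (2 * (1 - y)\<^sup>2))"
proof -
  have d: "((\<lambda>s. F (1 - s)) has_real_derivative - F' (1 - t)) (at t)" for t
  proof -
    have "((\<lambda>s. 1 - s) has_real_derivative - 1) (at t)" by (auto intro!: derivative_eq_intros)
    from DERIV_chain2[OF F this] show ?thesis by simp
  qed
  have le': "\<bar>- F' (1 - s)\<bar> \<le> K * (s - (1 - z)) ^ 3 / s\<^sup>2" if "1 - z < s" "s < 1 - y" for s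
  proof -
    have e: "z - (1 - s) = s - (1 - z)" "1 - (1 - s) = s" by auto
    show ?thesis using le[of "1 - s", unfolded e] that by simp
  qed
  have "\<bar>F (1 - (1 - y)) - F (1 - (1 - z))\<bar> \<le> K * (((1 - y) - (1 - z)) ^ 4 / (2 * (1 - y)\<^sup>2))"
    by (rule increment_left_coarse[OF _ _ K d]) (use zy le' in auto)
  then show ?thesis by (simp add: abs_minus_commute)
qed

lemma increment_right:
  fixes F :: "real \<Rightarrow> real"
  assumes zy: "y \<le> z" "z \<le> 1" and y: "y < 1" and K: "0 \<le> K"
    and F: "\<And>t. (F has_real_derivative F' t) (at t)"
    and le: "\<And>s. y < s \<Longrightarrow> s < z \<Longrightarrow> \<bar>F' s\<bar> \<le> K * (z - s) ^ 3 / (1 - s)\<^sup>2"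
  shows "\<bar>F z - F y\<bar> \<le> K * ((z - y) ^ 4 / (4 * (1 - y)\<^sup>2) * (231 / 200 + ((z - y) / (1 - y))\<^sup>2))"
proof -
  have d: "((\<lambda>s. F (1 - s)) has_real_derivative - F' (1 - t)) (at t)" for t
  proof -
    have "((\<lambda>s. 1 - s) has_real_derivative - 1) (at t)" by (auto intro!: derivative_eq_intros)
    from DERIV_chain2[OF F this] show ?thesis by simp
  qed
  have le': "\<bar>- F' (1 - s)\<bar> \<le> K * (s - (1 - z)) ^ 3 / s\<^sup>2" if "1 - z < s" "s < 1 - y" for s
  proof -
    have e: "z - (1 - s) = s - (1 - z)" "1 - (1 - s) = s" by auto
    show ?thesis using le[of "1 - s", unfolded e] that by simp
  qed
  have "\<bar>F (1 - (1 - y)) - F (1 - (1 - z))\<bar> \<le> K * (((1 - y) - (1 - z)) ^ 4 / (4 * (1 - y)\<^sup>2) * (231 / 200 + (((1 - y) - (1 - z)) / (1 - y))\<^sup>2))"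
    by (rule increment_left[OF _ _ _ K d]) (use zy y le' in auto)
  then show ?thesis by (simp add: abs_minus_commute)
qed

definition taylor3 :: "(real \<Rightarrow> real) \<Rightarrow> (real \<Rightarrow> real) \<Rightarrow> (real \<Rightarrow> real) \<Rightarrow> (real \<Rightarrow> real) \<Rightarrow> real \<Rightarrow> real \<Rightarrow> real" where
  "taylor3 g g1 g2 g3 y z = g y + g1 y * (z - y) + g2 y * (z - y)\<^sup>2 / 2 + g3 y * (z - y) ^ 3 / 6"

abbreviation taylor_error :: "(real \<Rightarrow> real) \<Rightarrow> (real \<Rightarrow> real) \<Rightarrow> (real \<Rightarrow> real) \<Rightarrow> (real \<Rightarrow> real) \<Rightarrow> real \<Rightarrow> real \<Rightarrow> real" where
  "taylor_error g g1 g2 g3 y z \<equiv> \<bar>g z - taylor3 g g1 g2 g3 y z\<bar>"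

lemma taylor3_self: "taylor3 g g1 g2 g3 z z = g z"
  by (simp add: taylor3_def)

text \<open>Differentiation in the expansion point, with \<open>z\<close> fixed, makes the sum
  telescope. The polynomial expanded at \<open>z\<close> has the value \<open>g z\<close>, so the
  Taylor error at \<open>y\<close> is an increment of this function, and comparing derivatives
  replaces the integral form of the remainder.\<close>

lemma taylor3_has_derivative:
  assumes "\<And>t. (g has_real_derivative g1 t) (at t)" "\<And>t. (g1 has_real_derivative g2 t) (at t)"
    "\<And>t. (g2 has_real_derivative g3 t) (at t)" "\<And>t. (g3 has_real_derivative g4 t) (at t)"
  shows "((\<lambda>s. taylor3 g g1 g2 g3 s z) has_real_derivative g4 t * (z - t) ^ 3 / 6) (at t)"
proof -
  have p: "((\<lambda>s. z - s) has_real_derivative - 1) (at t)"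
    "((\<lambda>s. (z - s)\<^sup>2) has_real_derivative - (2 * (z - t))) (at t)"
    "((\<lambda>s. (z - s) ^ 3) has_real_derivative - (3 * (z - t)\<^sup>2)) (at t)"
    by (auto intro!: derivative_eq_intros)
  have a: "((\<lambda>s. g s + g1 s * (z - s) + g2 s * (z - s)\<^sup>2 / 2 + g3 s * (z - s) ^ 3 / 6) has_real_derivative
      g1 t + (g2 t * (z - t) + - 1 * g1 t) + (g3 t * (z - t)\<^sup>2 + - (2 * (z - t)) * g2 t) / 2
      + (g4 t * (z - t) ^ 3 + - (3 * (z - t)\<^sup>2) * g3 t) / 6) (at t)"
    by (intro DERIV_add DERIV_cdivide DERIV_mult assms p)
  have b: "g1 t + (g2 t * (z - t) + - 1 * g1 t) + (g3 t * (z - t)\<^sup>2 + - (2 * (z - t)) * g2 t) / 2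
      + (g4 t * (z - t) ^ 3 + - (3 * (z - t)\<^sup>2) * g3 t) / 6 = g4 t * (z - t) ^ 3 / 6"
    by (simp add: field_simps)
  show ?thesis unfolding taylor3_def using a[unfolded b] .
qed

lemma bern_shift_moments:
  assumes x: "0 < x" "x < 1"
  shows "bern n (\<lambda>k. (real k - real n * x) - d) x = - d"
    and "bern n (\<lambda>k. ((real k - real n * x) - d)\<^sup>2) x = cmom 2 n x + d\<^sup>2"
    and "bern n (\<lambda>k. ((real k - real n * x) - d) ^ 3) x = cmom 3 n x - 3 * d * cmom 2 n x - d ^ 3"
    and "bern n (\<lambda>k. ((real k - real n * x) - d) ^ 4) x
      = cmom 4 n x - 4 * d * cmom 3 n x + 6 * d\<^sup>2 * cmom 2 n x + d ^ 4"
    and "bern n (\<lambda>k. ((real k - real n * x) - d) ^ 6) x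
      = cmom 6 n x - 6 * d * cmom 5 n x + 15 * d\<^sup>2 * cmom 4 n x - 20 * d ^ 3 * cmom 3 n x
        + 15 * d ^ 4 * cmom 2 n x + d ^ 6"
proof -
  have e: "(t - d)\<^sup>2 = t\<^sup>2 - (2 * d) * t + d\<^sup>2"
    "(t - d) ^ 3 = t ^ 3 - (3 * d) * t\<^sup>2 + (3 * d\<^sup>2) * t - d ^ 3"
    "(t - d) ^ 4 = t ^ 4 - (4 * d) * t ^ 3 + (6 * d\<^sup>2) * t\<^sup>2 - (4 * d ^ 3) * t + d ^ 4"
    "(t - d) ^ 6 = t ^ 6 - (6 * d) * t ^ 5 + (15 * d\<^sup>2) * t ^ 4 - (20 * d ^ 3) * t ^ 3
      + (15 * d ^ 4) * t\<^sup>2 - (6 * d ^ 5) * t + d ^ 6" for t :: real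
    by algebra+
  note s = bern_add[of n "\<lambda>k. _ k" "\<lambda>k. _ k"] bern_diff bern_cmult bern_const bern_cmom
  have c1: "bern n (\<lambda>k. real k - real n * x) x = 0" by (rule bern_cmom1)
  show "bern n (\<lambda>k. (real k - real n * x) - d) x = - d"
    unfolding bern_diff[of n "\<lambda>k. real k - real n * x" "\<lambda>k. d"] c1 bern_const by simp
  show "bern n (\<lambda>k. ((real k - real n * x) - d)\<^sup>2) x = cmom 2 n x + d\<^sup>2"
    unfolding e bern_add bern_diff[of n "\<lambda>k. (real k - real n * x) ^ _"] bern_cmult bern_const bern_cmom c1 by simp
  show "bern n (\<lambda>k. ((real k - real n * x) - d) ^ 3) x = cmom 3 n x - 3 * d * cmom 2 n x - d ^ 3"
    unfolding e bern_add bern_diff[of n "\<lambda>k. _ k + _ k"] bern_diff[of n "\<lambda>k. (real k - real n * x) ^ _"] bern_cmult bern_const bern_cmom c1 by simp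
  show "bern n (\<lambda>k. ((real k - real n * x) - d) ^ 4) x
      = cmom 4 n x - 4 * d * cmom 3 n x + 6 * d\<^sup>2 * cmom 2 n x + d ^ 4"
    unfolding e bern_add bern_diff[of n "\<lambda>k. _ k + _ k"] bern_diff[of n "\<lambda>k. (real k - real n * x) ^ _"] bern_cmult bern_const bern_cmom c1 by simp
  show "bern n (\<lambda>k. ((real k - real n * x) - d) ^ 6) x
      = cmom 6 n x - 6 * d * cmom 5 n x + 15 * d\<^sup>2 * cmom 4 n x - 20 * d ^ 3 * cmom 3 n x
        + 15 * d ^ 4 * cmom 2 n x + d ^ 6"
    unfolding e bern_add bern_diff[of n "\<lambda>k. _ k + _ k"] bern_diff[of n "\<lambda>k. (real k - real n * x) ^ _"] bern_cmult bern_const bern_cmom c1 by simp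
qed

text \<open>Put \<open>d = (1 - 2 x) / 3\<close>. The third central moment is \<open>1 - 2 x\<close>
  times the second, so the third moment about \<open>n y\<close> is just \<open>- d ^ 3\<close>. The
  cubic term at \<open>x\<close> itself has the same value, and both cancel exactly, without any
  bound for \<open>g3\<close>.\<close>

lemma taylor3_average:
  assumes x: "0 < x" "x < 1" and n: "0 < n" and y: "y = x + (1 - 2 * x) / (3 * real n)"
  shows "bern n (\<lambda>k. taylor3 g g1 g2 g3 y (real k / real n)) x - taylor3 g g1 g2 g3 y x
    = g2 y * (x * (1 - x)) / (2 * real n)"
proof -
  define N q d where "N = real n" and "q = 1 - 2 * x" and "d = q / 3"
  have N: "0 < N" using n by (simp add: N_def)
  have yd: "y = x + d / N" by (simp add: y d_def q_def N_def)
  have z: "real k / real n - y = ((real k - real n * x) - d) / N" for k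
    using N by (simp add: yd N_def field_simps)
  define A B C where "A = g1 y / N" and "B = g2 y / (2 * N\<^sup>2)" and "C = g3 y / (6 * N ^ 3)"
  have t: "taylor3 g g1 g2 g3 y (real k / real n)
     = g y + A * ((real k - real n * x) - d) + B * ((real k - real n * x) - d)\<^sup>2 + C * ((real k - real n * x) - d) ^ 3" for k
    by (simp add: taylor3_def z A_def B_def C_def power_divide)
  have tx: "taylor3 g g1 g2 g3 y x = g y + A * (- d) + B * d\<^sup>2 + C * (- (d ^ 3))"
    by (simp add: taylor3_def yd A_def B_def C_def power_divide)
  have "bern n (\<lambda>k. taylor3 g g1 g2 g3 y (real k / real n)) x
     = g y + A * (- d) + B * (cmom 2 n x + d\<^sup>2) + C * (cmom 3 n x - 3 * d * cmom 2 n x - d ^ 3)"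
    unfolding t bern_add bern_cmult bern_const bern_shift_moments[OF x] ..
  also have "cmom 3 n x - 3 * d * cmom 2 n x = 0"
    using x by (simp add: cmom_3 cmom_2 d_def q_def)
  finally have "bern n (\<lambda>k. taylor3 g g1 g2 g3 y (real k / real n)) x
    = g y + A * (- d) + B * (cmom 2 n x + d\<^sup>2) + C * (- (d ^ 3))" by simp
  then have "bern n (\<lambda>k. taylor3 g g1 g2 g3 y (real k / real n)) x - taylor3 g g1 g2 g3 y x = B * cmom 2 n x"
    unfolding tx by (simp add: algebra_simps)
  also have "\<dots> = g2 y * (x * (1 - x)) / (2 * real n)"
    using x n by (simp add: cmom_2 B_def N_def power2_eq_square)
  finally show ?thesis .
qed

lemma second_deriv_le_average:
  assumes x: "0 < x" "x < 1" and n: "0 < n" and y: "y = x + (1 - 2 * x) / (3 * real n)"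
    and D: "\<bar>bern n (\<lambda>k. g (real k / real n)) x - g x\<bar> \<le> D"
    and r: "\<And>k. k \<le> n \<Longrightarrow> taylor_error g g1 g2 g3 y (real k / real n) \<le> R k"
    and rx: "taylor_error g g1 g2 g3 y x \<le> Rx"
  shows "\<bar>g2 y\<bar> * (x * (1 - x)) / (2 * real n) \<le> D + bern n R x + Rx"
proof -
  let ?T = "taylor3 g g1 g2 g3 y"
  have e: "g2 y * (x * (1 - x)) / (2 * real n) = (bern n (\<lambda>k. g (real k / real n)) x - g x)
     - bern n (\<lambda>k. g (real k / real n) - ?T (real k / real n)) x + (g x - ?T x)"
    using taylor3_average[OF x n y, of g g1 g2 g3] by (simp add: bern_diff)
  have "\<bar>bern n (\<lambda>k. g (real k / real n) - ?T (real k / real n)) x\<bar> \<le> bern n R x"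
    using x r by (intro order_trans[OF bern_abs_le] bern_mono) auto
  then have "\<bar>g2 y * (x * (1 - x)) / (2 * real n)\<bar> \<le> D + bern n R x + Rx"
    unfolding e using D rx by linarith
  moreover have "\<bar>g2 y * (x * (1 - x)) / (2 * real n)\<bar> = \<bar>g2 y\<bar> * (x * (1 - x)) / (2 * real n)"
  proof -
    have "\<bar>x * (1 - x)\<bar> = x * (1 - x)" using x by simp
    then show ?thesis by (simp only: abs_divide abs_mult)
  qed
  ultimately show ?thesis by (simp only:)
qed

text \<open>The identity \<open>(1 - 2 x)\<^sup>2 = 1 - 4 w\<close> leaves polynomials in
  \<open>l\<close> and \<open>w\<close>, whose mixed terms have a favourable sign or are small. For
  the third moment a lower bound is the useful one, as it will occur with a nonpositive
  coefficient.\<close>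

lemma shift_moment_bounds:
  assumes x: "0 < x" "x \<le> 1 / 2" and n: "2 \<le> n"
    and y: "y = x + (1 - 2 * x) / (3 * real n)" and l: "l = real n * (x * (1 - x))"
  shows "bern n (\<lambda>k. (real k - real n * y)\<^sup>2) x \<le> l + 1 / 9"
    and "- (1 / 27) \<le> bern n (\<lambda>k. (real k - real n * y) ^ 3) x"
    and "bern n (\<lambda>k. (real k - real n * y) ^ 4) x \<le> 3 * l\<^sup>2 + l / 3 + 1 / 81"
    and "bern n (\<lambda>k. (real k - real n * y) ^ 6) x \<le> 15 * l ^ 3 + 10 * l\<^sup>2 + 2 * l + 1"
proof -
  define q d w where "q = 1 - 2 * x" and "d = q / 3" and "w = x * (1 - x)"
  have x1: "x < 1" using x by simp
  have k: "real k - real n * y = (real k - real n * x) - d" for k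
    using n by (simp add: y d_def q_def field_simps)
  have q: "0 \<le> q" "q \<le> 1" using x by (auto simp: q_def)
  have w: "0 < w" using x by (simp add: w_def)
  have q2: "q\<^sup>2 = 1 - 4 * w" by (simp add: q_def w_def power2_eq_square algebra_simps)
  have w4: "w \<le> 1 / 4" using q2 zero_le_power2[of q] by simp
  have q4: "q ^ 4 = (1 - 4 * w)\<^sup>2" unfolding q2[symmetric] by simp
  have q6: "q ^ 6 \<le> 1" "q ^ 4 \<le> 1" "q ^ 3 \<le> 1" "q\<^sup>2 \<le> 1" using q by (auto intro: power_le_one)
  have l0: "0 < l" using w n by (simp add: l w_def)
  note mom = cmom_2[OF x(1) x1] cmom_3[OF x(1) x1] cmom_4[OF x(1) x1] cmom_5[OF x(1) x1] cmom_6[OF x(1) x1]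
  note mom' = mom[of n, folded l, folded w_def q_def]
  show "bern n (\<lambda>k. (real k - real n * y)\<^sup>2) x \<le> l + 1 / 9"
    unfolding k bern_shift_moments[OF x(1) x1] mom' using q6 by (simp add: d_def power_divide)
  show "- (1 / 27) \<le> bern n (\<lambda>k. (real k - real n * y) ^ 3) x"
    unfolding k bern_shift_moments[OF x(1) x1] mom' using q6 by (simp add: d_def power_divide)
  have qd: "q = 3 * d" by (simp add: d_def)
  have d2: "d\<^sup>2 = (1 - 4 * w) / 9" using q2 by (simp add: d_def power_divide)
  have d4: "d ^ 4 = ((1 - 4 * w) / 9)\<^sup>2" unfolding d2[symmetric] by simp
  have d6: "d ^ 4 \<le> 1 / 81" "d ^ 6 \<le> 1" using q6 by (simp_all add: d_def power_divide)
  have lw: "0 < l * w" "0 < l\<^sup>2 * w" using l0 w by auto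
  have "bern n (\<lambda>k. (real k - real n * y) ^ 4) x = 3 * l\<^sup>2 + l * (1 - 6 * w) - 6 * d\<^sup>2 * l + d ^ 4"
    unfolding k bern_shift_moments[OF x(1) x1] mom' qd by algebra
  also have "\<dots> = 3 * l\<^sup>2 + l / 3 - (10 / 3) * (l * w) + d ^ 4"
    unfolding d2 by (simp add: field_simps)
  also have "\<dots> \<le> 3 * l\<^sup>2 + l / 3 + 1 / 81" using d6 lw by simp
  finally show "bern n (\<lambda>k. (real k - real n * y) ^ 4) x \<le> 3 * l\<^sup>2 + l / 3 + 1 / 81" .
  have "bern n (\<lambda>k. (real k - real n * y) ^ 6) x
    = (15 * l ^ 3 + l\<^sup>2 * (25 - 130 * w) + l * (1 - 30 * w + 120 * w\<^sup>2))
      - 18 * d\<^sup>2 * (10 * l\<^sup>2 + l * (1 - 12 * w)) + 15 * d\<^sup>2 * (3 * l\<^sup>2 + l * (1 - 6 * w))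
      - 45 * d ^ 4 * l + d ^ 6"
    unfolding k bern_shift_moments[OF x(1) x1] mom' qd by algebra
  also have "\<dots> = 15 * l ^ 3 + 10 * l\<^sup>2 - 70 * (l\<^sup>2 * w)
     + l * (1 / 9 - 92 / 9 * w + 496 / 9 * w\<^sup>2) + d ^ 6"
    unfolding d4 d2 by (simp add: field_simps power2_eq_square)
  also have "\<dots> \<le> 15 * l ^ 3 + 10 * l\<^sup>2 - 0 + l * 2 + 1"
  proof -
    have "w\<^sup>2 \<le> w * (1 / 4)"
      using w w4 unfolding power2_eq_square by (intro mult_left_mono) auto
    then have "1 / 9 - 92 / 9 * w + 496 / 9 * w\<^sup>2 \<le> 2" using w4 w by simp
    then have "l * (1 / 9 - 92 / 9 * w + 496 / 9 * w\<^sup>2) \<le> l * 2" using l0 by (intro mult_left_mono) auto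
    then show ?thesis using lw d6 by linarith
  qed
  finally show "bern n (\<lambda>k. (real k - real n * y) ^ 6) x \<le> 15 * l ^ 3 + 10 * l\<^sup>2 + 2 * l + 1" by simp
qed

section \<open>Numerical estimates\<close>

text \<open>Slightly below \<open>bound_const - 4 = 11.0477...\<close>.\<close>

definition ratio :: real where "ratio = 11047 / 1000"

text \<open>Bounds the mean of \<open>envelope\<close> without its sixth power, in the limit of
  large \<open>n\<close>. With \<open>a = (1 - b) (Y - 1 / Y)\<close>, expanding the square gives
  the fourth, second and third moments the coefficients \<open>1 + b\<^sup>2\<close>,
  \<open>a\<^sup>2\<close> and \<open>- 2 a b\<close>. Here \<open>Y\<close> stands for
  \<open>n y\<close>, and \<open>Y - 1 / 3\<close> for \<open>n x (1 - x)\<close>.\<close>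

definition boundary_bracket :: "real \<Rightarrow> real \<Rightarrow> real" where
  "boundary_bracket b Y = (1 + b\<^sup>2) * (3 * (Y - 1 / 3)\<^sup>2 + 1 / 3 * (Y - 1 / 3) + 1 / 81)
     + ((1 - b) * (Y - 1 / Y))\<^sup>2 * (Y - 1 / 3 + 1 / 9) + 2 * b * ((1 - b) * (Y - 1 / Y)) / 27"

text \<open>The factor of \<open>H\<close> that \<open>combined_bound\<close> produces with
  \<open>D \<le> H / ratio\<close> and 70711 / 50000 for \<open>sqrt 2\<close>. The addend 3 / 100
  covers the remainder at \<open>x\<close>, which is 2 / 81, and rounding; 2001 / 2000 covers errors
  of order \<open>1 / n\<close>.\<close>

definition boundary_total :: "real \<Rightarrow> real \<Rightarrow> real" where
  "boundary_total b Y = 2001 / 2000 * (70711 / 50000 * (1 + 3 / 5 / Y) / ratio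
     + 2 * (Y + 3 / 5) / (Y - 1 / 3) * (1 / ratio + 70711 / 50000 / (24 * Y\<^sup>2) * (boundary_bracket b Y + 3 / 100)))"

text \<open>The difference \<open>1999 / 2000 - boundary_total b Y\<close>, cleared of denominators
  by \<open>(Y - 1 / 3) Y ^ 4\<close>.\<close>

definition boundary_poly :: "real \<Rightarrow> real \<Rightarrow> real" where
  "boundary_poly b Y = 1999 / 2000 * ((Y - 1 / 3) * Y ^ 4)
     - 141492711 / 1104700000 * ((Y + 3 / 5) * (Y - 1 / 3) * Y ^ 3)
     - 2001 / 11047 * ((Y + 3 / 5) * Y ^ 4)
     - 47164237 / 400000000 * ((Y + 3 / 5)
        * (Y\<^sup>2 * ((1 + b\<^sup>2) * (3 * (Y - 1 / 3)\<^sup>2 + 1 / 3 * (Y - 1 / 3) + 1 / 81) + 3 / 100)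
           + (1 - b)\<^sup>2 * (Y\<^sup>2 - 1)\<^sup>2 * (Y - 2 / 9) + 2 / 27 * (b * (1 - b) * (Y * (Y\<^sup>2 - 1)))))"

lemma boundary_total_le:
  assumes Y: "2 \<le> Y" and p: "0 \<le> boundary_poly b Y"
  shows "boundary_total b Y \<le> 1999 / 2000"
proof -
  have Y0: "0 < Y" "0 < Y - 1 / 3" using Y by auto
  have br: "Y\<^sup>2 * (boundary_bracket b Y + 3 / 100) =
     Y\<^sup>2 * ((1 + b\<^sup>2) * (3 * (Y - 1 / 3)\<^sup>2 + 1 / 3 * (Y - 1 / 3) + 1 / 81) + 3 / 100)
           + (1 - b)\<^sup>2 * (Y\<^sup>2 - 1)\<^sup>2 * (Y - 2 / 9) + 2 / 27 * (b * (1 - b) * (Y * (Y\<^sup>2 - 1)))"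
  proof -
    have y: "Y - 1 / Y = (Y\<^sup>2 - 1) / Y" using Y0 by (simp add: field_simps power2_eq_square)
    have "Y\<^sup>2 * (((1 - b) * ((Y\<^sup>2 - 1) / Y))\<^sup>2 * Z) = (1 - b)\<^sup>2 * (Y\<^sup>2 - 1)\<^sup>2 * Z" for Z
      using Y0 by (simp add: power_mult_distrib power_divide)
    moreover have "Y\<^sup>2 * (2 * b * ((1 - b) * ((Y\<^sup>2 - 1) / Y)) / 27) = 2 / 27 * (b * (1 - b) * (Y * (Y\<^sup>2 - 1)))"
      using Y0 by (simp add: power2_eq_square)
    moreover have "Y - 1 / 3 + 1 / 9 = Y - 2 / 9" by simp
    ultimately show ?thesis
      unfolding boundary_bracket_def y by (simp only: distrib_left)
  qed
  have "(Y - 1 / 3) * Y ^ 4 * (1999 / 2000 - boundary_total b Y) = boundary_poly b Y"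
  proof -
    define B where "B = boundary_bracket b Y + 3 / 100"
    have "(Y - 1 / 3) * Y ^ 4 * (1999 / 2000 - boundary_total b Y)
      = 1999 / 2000 * ((Y - 1 / 3) * Y ^ 4)
     - 141492711 / 1104700000 * ((Y + 3 / 5) * (Y - 1 / 3) * Y ^ 3)
     - 2001 / 11047 * ((Y + 3 / 5) * Y ^ 4)
     - 47164237 / 400000000 * ((Y + 3 / 5) * (Y\<^sup>2 * B))"
    proof -
      have "(Y - 1 / 3) * Y ^ 4 * (s * (c * (1 + 3 / 5 / Y) / r)) = s * c / r * ((Y + 3 / 5) * (Y - 1 / 3) * Y ^ 3)" for s c r :: real
      proof -
        have "Y ^ 4 * (1 + 3 / 5 / Y) = (Y + 3 / 5) * Y ^ 3" using Y0 by (simp add: field_simps eval_nat_numeral)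
        moreover have "(Y - 1 / 3) * Y ^ 4 * (s * (c * (1 + 3 / 5 / Y) / r)) = s * c / r * ((Y - 1 / 3) * (Y ^ 4 * (1 + 3 / 5 / Y)))" by simp
        ultimately show ?thesis by simp
      qed
      moreover have "(Y - 1 / 3) * Y ^ 4 * (s * (2 * (Y + 3 / 5) / (Y - 1 / 3) * (1 / r + c / (24 * Y\<^sup>2) * B)))
         = 2 * s / r * ((Y + 3 / 5) * Y ^ 4) + 2 * s * c / 24 * ((Y + 3 / 5) * (Y\<^sup>2 * B))" for s c r :: real
      proof -
        have "(Y - 1 / 3) * Y ^ 4 * (s * (2 * (Y + 3 / 5) / (Y - 1 / 3) * (1 / r + c / (24 * Y\<^sup>2) * B)))
          = ((Y - 1 / 3) / (Y - 1 / 3)) * (Y ^ 4 * (s * (2 * (Y + 3 / 5) * (1 / r + c / (24 * Y\<^sup>2) * B))))"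
          by simp
        also have "(Y - 1 / 3) / (Y - 1 / 3) = 1" using Y0 by simp
        also have "Y ^ 4 * (s * (2 * (Y + 3 / 5) * (1 / r + c / (24 * Y\<^sup>2) * B)))
          = 2 * s / r * ((Y + 3 / 5) * Y ^ 4) + 2 * s * c / 24 * ((Y + 3 / 5) * ((Y ^ 4 / Y\<^sup>2) * B))"
        proof -
          have "Y ^ 4 * (s * (2 * A * (1 / r + c / (24 * w) * B))) = 2 * s / r * (A * Y ^ 4) + 2 * s * c / 24 * (A * ((Y ^ 4 / w) * B))" for A w :: real
            by (simp add: distrib_left ac_simps)
          then show ?thesis by this
        qed
        also have "Y ^ 4 / Y\<^sup>2 = Y\<^sup>2" using Y0 by (simp add: eval_nat_numeral)
        finally show ?thesis by simp
      qed
      ultimately show ?thesis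
        unfolding boundary_total_def ratio_def B_def[symmetric] by (simp only: right_diff_distrib distrib_left) simp
    qed
    also have "Y\<^sup>2 * B = Y\<^sup>2 * ((1 + b\<^sup>2) * (3 * (Y - 1 / 3)\<^sup>2 + 1 / 3 * (Y - 1 / 3) + 1 / 81) + 3 / 100)
           + (1 - b)\<^sup>2 * (Y\<^sup>2 - 1)\<^sup>2 * (Y - 2 / 9) + 2 / 27 * (b * (1 - b) * (Y * (Y\<^sup>2 - 1)))"
      unfolding B_def by (rule br)
    finally show ?thesis unfolding boundary_poly_def .
  qed
  moreover have "0 < (Y - 1 / 3) * Y ^ 4" using Y0 by simp
  ultimately have "0 \<le> 1999 / 2000 - boundary_total b Y"
    using p by (metis zero_le_mult_iff not_less)
  then show ?thesis by simp
qed

text \<open>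
  The polynomial inequalities below are certified by expanding in the Bernstein basis of the
  interval in question, where all coefficients turn out to be positive.
\<close>

lemma boundary_poly_nonneg1:
  assumes "2 \<le> Y" "Y \<le> 7 / 2"
  shows "0 \<le> boundary_poly (2 / 5) Y"
proof -
  have "boundary_poly (2 / 5) Y = 8090470815321487 / 509620549218750000 * ((7 / 2 - Y) ^ 6)
      + 102270032748756619 / 339747032812500000 * ((Y - 2) * (7 / 2 - Y) ^ 5)
      + 7278991403070509 / 4348762020000000 * ((Y - 2) ^ 2 * (7 / 2 - Y) ^ 4)
      + 68541476741205674017 / 16307857575000000000 * ((Y - 2) ^ 3 * (7 / 2 - Y) ^ 3)
      + 28260427327007719897 / 5435952525000000000 * ((Y - 2) ^ 4 * (7 / 2 - Y) ^ 2)
      + 15820997347376261257 / 5435952525000000000 * ((Y - 2) ^ 5 * (7 / 2 - Y))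
      + 3153921061192131491 / 6523143030000000000 * ((Y - 2) ^ 6)"
    unfolding boundary_poly_def by algebra
  then show ?thesis using assms by simp
qed

lemma boundary_poly_nonneg2:
  assumes "7 / 2 \<le> Y" "Y \<le> 6"
  shows "0 \<le> boundary_poly (3 / 5) Y"
proof -
  have "boundary_poly (3 / 5) Y = 499448858413408903 / 13981359375000000000 * ((6 - Y) ^ 6)
      + 9499905502464508471 / 23302265625000000000 * ((Y - 7 / 2) * (6 - Y) ^ 5)
      + 8438324186346733549 / 4660453125000000000 * ((Y - 7 / 2) ^ 2 * (6 - Y) ^ 4)
      + 56312886130019629777 / 13981359375000000000 * ((Y - 7 / 2) ^ 3 * (6 - Y) ^ 3)
      + 2189514065099583541 / 466045312500000000 * ((Y - 7 / 2) ^ 4 * (6 - Y) ^ 2)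
      + 21471957520049399 / 8091064453125000 * ((Y - 7 / 2) ^ 5 * (6 - Y))
      + 42550697898406897 / 80910644531250000 * ((Y - 7 / 2) ^ 6)"
    unfolding boundary_poly_def by algebra
  then show ?thesis using assms by simp
qed

lemma boundary_poly_nonneg3:
  assumes "6 \<le> Y" "Y \<le> 10"
  shows "0 \<le> boundary_poly (7 / 10) Y"
proof -
  have "boundary_poly (7 / 10) Y = 32425023357241627 / 848409600000000000 * ((10 - Y) ^ 6)
      + 7458008840206304179 / 20361830400000000000 * ((Y - 6) * (10 - Y) ^ 5)
      + 85709760743465974153 / 61085491200000000000 * ((Y - 6) ^ 2 * (10 - Y) ^ 4)
      + 49780073484227037131 / 18325647360000000000 * ((Y - 6) ^ 3 * (10 - Y) ^ 3)
      + 83396819660514554341 / 30542745600000000000 * ((Y - 6) ^ 4 * (10 - Y) ^ 2)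
      + 25786779636668468383 / 20361830400000000000 * ((Y - 6) ^ 5 * (10 - Y))
      + 30545116751146589711 / 183256473600000000000 * ((Y - 6) ^ 6)"
    unfolding boundary_poly_def by algebra
  then show ?thesis using assms by simp
qed

lemma exp_ge_Taylor:
  fixes x :: real
  assumes "0 \<le> x"
  shows "(\<Sum>k<n. x ^ k / fact k) \<le> exp x"
proof -
  have "(\<Sum>k<n. x ^ k /\<^sub>R fact k) \<le> (\<Sum>k. x ^ k /\<^sub>R fact k)"
    using assms by (intro sum_le_suminf summable_exp_generic) auto
  then show ?thesis by (simp add: exp_def scaleR_conv_of_real field_simps)
qed

text \<open>Collects the excess over \<open>9 / 50\<close> of the bounds for the second differences at the first four
  nodes, with Poisson weights.\<close>

definition crude_nodes :: "real \<Rightarrow> real" where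
  "crude_nodes Y = 64 / 125 + 27 / 125 * Y + 51 / 1000 * Y ^ 2 + 1 / 150 * Y ^ 3"

text \<open>After multiplication by \<open>exp Y\<close>, a Taylor polynomial may replace the
  exponential, because it is a lower bound for \<open>Y \<ge> 0\<close> and \<open>c\<close> is
  forced to be nonnegative. Only a polynomial inequality remains.\<close>

lemma crude_transfer:
  fixes Y c q :: real
  assumes Y: "0 \<le> Y" and q: "0 \<le> q" and p: "q \<le> (\<Sum>k<Suc n. Y ^ k / fact k) * c"
  shows "exp (- Y) * q \<le> c"
proof -
  have "0 < (\<Sum>k<Suc n. Y ^ k / fact k)"
    using Y by (simp add: sum.lessThan_Suc_shift sum_nonneg add_pos_nonneg del: sum.lessThan_Suc)
  with p q have c: "0 \<le> c" by (metis order_trans zero_le_mult_iff not_less)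
  have "q \<le> exp Y * c" using p mult_right_mono[OF exp_ge_Taylor[OF Y] c] by (rule order_trans)
  then have "exp (- Y) * q \<le> exp (- Y) * (exp Y * c)" by (intro mult_left_mono) auto
  also have "\<dots> = c" by (simp add: exp_minus)
  finally show ?thesis .
qed

text \<open>The first summand is the contribution of \<open>u\<close>, here by the trivial bound 4
  for second differences; the second is that of \<open>v\<close>. Cauchy--Schwarz is no option near
  0, as its factor \<open>1 + 3 / 5 / Y\<close> is unbounded.\<close>

lemma crude_small:
  assumes Y: "0 \<le> Y" "Y \<le> 2 / 5"
  shows "2001 / 2000 * (4 * (3 / 5 + Y) / ratio + (3 / 5 + Y) * (9 / 50 + exp (- Y) * crude_nodes Y)) \<le> 1999 / 2000"
proof -
  have cn: "0 \<le> crude_nodes Y" using Y by (simp add: crude_nodes_def)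
  have "Y ^ 3 \<le> Y\<^sup>2 * 2" using Y by (simp add: power3_eq_cube power2_eq_square mult_left_mono)
  then have "0 \<le> 1 + Y\<^sup>2 / 2 - Y ^ 3 / 6" using zero_le_power2[of Y] by linarith
  then have q: "0 \<le> 2001 / 2000 * ((3 / 5 + Y) * crude_nodes Y)" using Y cn by (intro mult_nonneg_nonneg add_nonneg_nonneg) auto
  define T where "T = 1 + Y + Y ^ 2 / 2 + Y ^ 3 / 6"
  have "T * (1999 / 2000 - 2001 / 2000 * (9 / 50) * (3 / 5 + Y) - 4002 / 11047 * (3 / 5 + Y)) - (2001 / 2000 * ((3 / 5 + Y) * crude_nodes Y)) = 10128171857 / 707008000 * ((2 / 5 - Y) ^ 4)
      + 43595672603 / 883760000 * (Y * (2 / 5 - Y) ^ 3)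
      + 1046577532189 / 17675200000 * (Y ^ 2 * (2 / 5 - Y) ^ 2)
      + 180293187341 / 6628200000 * (Y ^ 3 * (2 / 5 - Y))
      + 15359352493 / 5302560000 * (Y ^ 4)"
    unfolding T_def crude_nodes_def by algebra
  then have "0 \<le> T * (1999 / 2000 - 2001 / 2000 * (9 / 50) * (3 / 5 + Y) - 4002 / 11047 * (3 / 5 + Y)) - (2001 / 2000 * ((3 / 5 + Y) * crude_nodes Y))" using Y by simp
  moreover have "(\<Sum>k<Suc 3. Y ^ k / fact k) = T"
    by (simp add: T_def eval_nat_numeral)
  ultimately have "exp (- Y) * (2001 / 2000 * ((3 / 5 + Y) * crude_nodes Y)) \<le> 1999 / 2000 - 2001 / 2000 * (9 / 50) * (3 / 5 + Y) - 4002 / 11047 * (3 / 5 + Y)"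
    using Y q by (intro crude_transfer[where n = 3]) auto
  then show ?thesis by (simp add: ratio_def field_simps)
qed

text \<open>Here \<open>u\<close> is treated by Cauchy--Schwarz; multiplication by \<open>Y\<close>
  makes the inequality polynomial.\<close>

lemma crude_middle:
  assumes Y: "2 / 5 \<le> Y" "Y \<le> 13 / 10"
  shows "2001 / 2000 * (70711 / 50000 * (1 + 3 / 5 / Y) / ratio + (3 / 5 + Y) * (9 / 50 + exp (- Y) * crude_nodes Y)) \<le> 1999 / 2000"
proof -
  have cn: "0 \<le> crude_nodes Y" using Y by (simp add: crude_nodes_def)
  have "Y ^ 3 \<le> Y\<^sup>2 * 2" using Y by (simp add: power3_eq_cube power2_eq_square mult_left_mono)
  then have "0 \<le> 1 + Y\<^sup>2 / 2 - Y ^ 3 / 6" using zero_le_power2[of Y] by linarith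
  then have q: "0 \<le> 2001 / 2000 * ((3 / 5 + Y) * crude_nodes Y * Y)" using Y cn by (intro mult_nonneg_nonneg add_nonneg_nonneg) auto
  define T where "T = 1 + Y + Y ^ 2 / 2 + Y ^ 3 / 6 + Y ^ 4 / 24 + Y ^ 5 / 120"
  have "T * ((1999 / 2000 - 2001 / 2000 * (9 / 50) * (3 / 5 + Y)) * Y - 141492711 / 1104700000 * (3 / 5 + Y)) - (2001 / 2000 * ((3 / 5 + Y) * crude_nodes Y * Y)) = 56932676597684 / 495351173840625 * ((13 / 10 - Y) ^ 7)
      + 3239240406881488 / 2476755869203125 * ((Y - 2 / 5) * (13 / 10 - Y) ^ 6)
      + 4218655483276432 / 825585289734375 * ((Y - 2 / 5) ^ 2 * (13 / 10 - Y) ^ 5)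
      + 38823473656948673 / 3962809390725000 * ((Y - 2 / 5) ^ 3 * (13 / 10 - Y) ^ 4)
      + 161221549239163367 / 15851237562900000 * ((Y - 2 / 5) ^ 4 * (13 / 10 - Y) ^ 3)
      + 59276322136426001 / 10567491708600000 * ((Y - 2 / 5) ^ 5 * (13 / 10 - Y) ^ 2)
      + 437775063322257113 / 317024751258000000 * ((Y - 2 / 5) ^ 6 * (13 / 10 - Y))
      + 38681126162474647 / 634049502516000000 * ((Y - 2 / 5) ^ 7)"
    unfolding T_def crude_nodes_def by algebra
  then have "0 \<le> T * ((1999 / 2000 - 2001 / 2000 * (9 / 50) * (3 / 5 + Y)) * Y - 141492711 / 1104700000 * (3 / 5 + Y)) - (2001 / 2000 * ((3 / 5 + Y) * crude_nodes Y * Y))" using Y by simp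
  moreover have "(\<Sum>k<Suc 5. Y ^ k / fact k) = T"
    by (simp add: T_def eval_nat_numeral)
  ultimately have "exp (- Y) * (2001 / 2000 * ((3 / 5 + Y) * crude_nodes Y * Y)) \<le> (1999 / 2000 - 2001 / 2000 * (9 / 50) * (3 / 5 + Y)) * Y - 141492711 / 1104700000 * (3 / 5 + Y)"
    using Y q by (intro crude_transfer[where n = 5]) auto
  then show ?thesis using Y by (simp add: ratio_def field_simps)
qed

text \<open>Near \<open>Y = 2\<close> the contribution of \<open>v\<close> alone is about 0.89 and
  Cauchy--Schwarz is too weak for \<open>u\<close>. It is replaced by the mean absolute value of the
  Krawtchouk polynomial in its Poisson limit, divided by \<open>Y\<^sup>2\<close>, which is
  \<open>exp (- Y)\<close> times \<open>2 (1 + Y\<^sup>2 / 2 - Y ^ 3 / 6)\<close>.\<close>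

lemma crude_large:
  assumes Y: "13 / 10 \<le> Y" "Y \<le> 2"
  shows "2001 / 2000 * ((3 / 5 + Y) * (exp (- Y) * (2 * (1 + Y ^ 2 / 2 - Y ^ 3 / 6))) / ratio + (3 / 5 + Y) * (9 / 50 + exp (- Y) * crude_nodes Y)) \<le> 1999 / 2000"
proof -
  have cn: "0 \<le> crude_nodes Y" using Y by (simp add: crude_nodes_def)
  have "Y ^ 3 \<le> Y\<^sup>2 * 2" using Y by (simp add: power3_eq_cube power2_eq_square mult_left_mono)
  then have "0 \<le> 1 + Y\<^sup>2 / 2 - Y ^ 3 / 6" using zero_le_power2[of Y] by linarith
  then have q: "0 \<le> 2001 / 2000 * ((3 / 5 + Y) * (crude_nodes Y + 2000 / 11047 * (1 + Y ^ 2 / 2 - Y ^ 3 / 6)))" using Y cn by (intro mult_nonneg_nonneg add_nonneg_nonneg) auto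
  define T where "T = 1 + Y + Y ^ 2 / 2 + Y ^ 3 / 6 + Y ^ 4 / 24 + Y ^ 5 / 120 + Y ^ 6 / 720 + Y ^ 7 / 5040 + Y ^ 8 / 40320"
  have "T * (1999 / 2000 - 2001 / 2000 * (9 / 50) * (3 / 5 + Y)) - (2001 / 2000 * ((3 / 5 + Y) * (crude_nodes Y + 2000 / 11047 * (1 + Y ^ 2 / 2 - Y ^ 3 / 6)))) = 9095549971337064345703 / 1797410347604928000000 * ((2 - Y) ^ 9)
      + 36339103891115380893151 / 898705173802464000000 * ((Y - 13 / 10) * (2 - Y) ^ 8)
      + 264226731011420207441 / 1872302445421800000 * ((Y - 13 / 10) ^ 2 * (2 - Y) ^ 7)
      + 601955806315727363 / 2139774223339200 * ((Y - 13 / 10) ^ 3 * (2 - Y) ^ 6)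
      + 176095518649334887 / 501509583595125 * ((Y - 13 / 10) ^ 4 * (2 - Y) ^ 5)
      + 5034836407472663 / 17831451861160 * ((Y - 13 / 10) ^ 5 * (2 - Y) ^ 4)
      + 1931271626348327 / 13373588895870 * ((Y - 13 / 10) ^ 6 * (2 - Y) ^ 3)
      + 1242171599579279 / 28084536681327 * ((Y - 13 / 10) ^ 7 * (2 - Y) ^ 2)
      + 65326901483600 / 9361512227109 * ((Y - 13 / 10) ^ 8 * (2 - Y))
      + 10213076338400 / 28084536681327 * ((Y - 13 / 10) ^ 9)"
    unfolding T_def crude_nodes_def by algebra
  then have "0 \<le> T * (1999 / 2000 - 2001 / 2000 * (9 / 50) * (3 / 5 + Y)) - (2001 / 2000 * ((3 / 5 + Y) * (crude_nodes Y + 2000 / 11047 * (1 + Y ^ 2 / 2 - Y ^ 3 / 6))))" using Y by simp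
  moreover have "(\<Sum>k<Suc 8. Y ^ k / fact k) = T"
    by (simp add: T_def eval_nat_numeral)
  ultimately have "exp (- Y) * (2001 / 2000 * ((3 / 5 + Y) * (crude_nodes Y + 2000 / 11047 * (1 + Y ^ 2 / 2 - Y ^ 3 / 6)))) \<le> 1999 / 2000 - 2001 / 2000 * (9 / 50) * (3 / 5 + Y)"
    using Y q by (intro crude_transfer[where n = 8]) auto
  then show ?thesis by (simp add: ratio_def field_simps)
qed

text \<open>In \<open>t = 1 / l\<close> the left side is a polynomial with nonnegative coefficients,
  hence largest at the smallest \<open>l\<close>. The value 193 / 20 is what
  \<open>n y \<ge> 10\<close> leaves after passing from \<open>n y\<close> to
  \<open>n x (1 - x)\<close>.\<close>

lemma bulk_numeric:
  fixes l :: real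
  assumes l: "193 / 20 \<le> l"
  shows "70711 / 50000 * (1 + 3 / 5 / l) / ratio + 2 * (l + 14 / 15) / l / ratio
    + 70711 / 50000 / (12 * l) * (1 / l + 3 / 5 / l\<^sup>2)
      * (231 / 200 * (3 * l\<^sup>2 + l / 3 + 2 / 81) + (15 * l ^ 3 + 10 * l\<^sup>2 + 2 * l + 2) / l\<^sup>2) \<le> 199 / 200"
proof -
  define t where "t = 1 / l"
  have t: "0 \<le> t" "t \<le> 20 / 193" using l by (auto simp: t_def field_simps)
  have l0: "0 < l" using l by simp
  have tp: "t ^ k \<le> (20 / 193) ^ k" for k using t by (intro power_mono) auto
  define p where "p t = 70711 / 50000 * (1 + 3 / 5 * t) / ratio + 2 * (1 + 14 / 15 * t) / ratio
    + 70711 / 50000 / 12 * ((1 + 3 / 5 * t) * (231 / 200 * (3 + t / 3 + 2 / 81 * t\<^sup>2) + (15 * t + 10 * t\<^sup>2 + 2 * t ^ 3 + 2 * t ^ 4)))" for t :: real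
  have "70711 / 50000 * (1 + 3 / 5 / l) / ratio + 2 * (l + 14 / 15) / l / ratio
    + 70711 / 50000 / (12 * l) * (1 / l + 3 / 5 / l\<^sup>2)
      * (231 / 200 * (3 * l\<^sup>2 + l / 3 + 2 / 81) + (15 * l ^ 3 + 10 * l\<^sup>2 + 2 * l + 2) / l\<^sup>2) = p t"
  proof -
    have "(l + 14 / 15) / l = 1 + 14 / 15 * t" using l0 by (simp add: t_def field_simps)
    moreover have "70711 / 50000 / (12 * l) * (1 / l + 3 / 5 / l\<^sup>2) = 70711 / 50000 / 12 * (t\<^sup>2 * (1 + 3 / 5 * t))"
      using l0 by (simp add: t_def field_simps power2_eq_square)
    moreover have "t\<^sup>2 * (231 / 200 * (3 * l\<^sup>2 + l / 3 + 2 / 81) + (15 * l ^ 3 + 10 * l\<^sup>2 + 2 * l + 2) / l\<^sup>2)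
      = 231 / 200 * (3 + t / 3 + 2 / 81 * t\<^sup>2) + (15 * t + 10 * t\<^sup>2 + 2 * t ^ 3 + 2 * t ^ 4)"
      using l0 by (simp add: t_def field_simps eval_nat_numeral)
    moreover have "C * (t\<^sup>2 * A) * Z = C * (A * (t\<^sup>2 * Z))" for A C Z by simp
    moreover have "2 * (l + 14 / 15) / l / ratio = 2 * ((l + 14 / 15) / l) / ratio" by simp
    moreover have "3 / 5 / l = 3 / 5 * t" by (simp add: t_def)
    ultimately show ?thesis unfolding p_def by metis
  qed
  also have "p t \<le> p (20 / 193)"
    unfolding p_def using t tp[of 2] tp[of 3] tp[of 4]
    by (intro add_mono mult_mono divide_right_mono) (auto simp: ratio_def)
  also have "\<dots> \<le> 199 / 200" by (simp add: p_def ratio_def eval_nat_numeral)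
  finally show ?thesis .
qed

section \<open>The self-improving bound\<close>

lemma sqrt2_le: "sqrt 2 \<le> 70711 / 50000"
  by (rule real_le_lsqrt) (simp_all add: power2_eq_square)

text \<open>Brings the weighted bound for the fourth derivative into the form required by the
  \<open>increment\<close> lemmas. To the right of \<open>y\<close> it is applied with
  \<open>1 - s\<close> in place of \<open>s\<close>.\<close>

lemma quartic_weight_le:
  fixes g s C c d :: real
  assumes b: "\<bar>g\<bar> * (s * (1 - s))\<^sup>2 \<le> C" and s: "0 < s" "s < 1" and c: "0 < c" "c \<le> 1 - s" and d: "0 \<le> d"
  shows "\<bar>g\<bar> * d ^ 3 / 6 \<le> C / (6 * c\<^sup>2) * d ^ 3 / s\<^sup>2"
proof -
  have "\<bar>g\<bar> * (s\<^sup>2 * c\<^sup>2) \<le> \<bar>g\<bar> * (s\<^sup>2 * (1 - s)\<^sup>2)"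
    using c s by (intro mult_left_mono power_mono) auto
  also have "\<dots> \<le> C" using b by (simp add: power_mult_distrib)
  finally have "\<bar>g\<bar> \<le> C / (s\<^sup>2 * c\<^sup>2)" using s c by (simp add: pos_le_divide_eq)
  then have "\<bar>g\<bar> * (d ^ 3 / 6) \<le> C / (s\<^sup>2 * c\<^sup>2) * (d ^ 3 / 6)" using d by (intro mult_right_mono) auto
  then show ?thesis by (simp add: field_simps)
qed

text \<open>On either side of \<open>y\<close> one of the factors \<open>s\<close> and
  \<open>1 - s\<close> is bounded below by its value at \<open>y\<close> and frozen there. The
  relative deviation \<open>(z - y) / (1 - y)\<close> on the right is at most
  \<open>(z - y) / y\<close> because \<open>y \<le> 1 / 2\<close>.\<close>

lemma taylor3_remainder_bulk:
  assumes g: "\<And>t. (g has_real_derivative g1 t) (at t)" "\<And>t. (g1 has_real_derivative g2 t) (at t)"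
    "\<And>t. (g2 has_real_derivative g3 t) (at t)" "\<And>t. (g3 has_real_derivative g4 t) (at t)"
    and C: "0 \<le> C" "\<And>s. 0 < s \<Longrightarrow> s < 1 \<Longrightarrow> \<bar>g4 s\<bar> * (s * (1 - s))\<^sup>2 \<le> C"
    and y: "0 < y" "y \<le> 1 / 2" and z: "0 \<le> z" "z \<le> 1"
  shows "taylor_error g g1 g2 g3 y z \<le> C / (24 * (y * (1 - y))\<^sup>2) * ((z - y) ^ 4 * (231 / 200 + ((z - y) / y)\<^sup>2))"
proof -
  define F where "F s = taylor3 g g1 g2 g3 s z" for s
  have F: "(F has_real_derivative g4 t * (z - t) ^ 3 / 6) (at t)" for t
    unfolding F_def[abs_def] by (rule taylor3_has_derivative[OF g])
  have Fz: "F z = g z" by (simp add: F_def taylor3_self)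
  have "\<bar>F z - F y\<bar> \<le> C / (24 * (y * (1 - y))\<^sup>2) * ((z - y) ^ 4 * (231 / 200 + ((z - y) / y)\<^sup>2))"
  proof (cases "z \<le> y")
    case True
    have "\<bar>F y - F z\<bar> \<le> C / (6 * (1 - y)\<^sup>2) * ((y - z) ^ 4 / (4 * y\<^sup>2) * (231 / 200 + ((y - z) / y)\<^sup>2))"
    proof (rule increment_left[OF z(1) True y(1) _ F])
      fix s assume s: "z < s" "s < y"
      have "\<bar>g4 s * (z - s) ^ 3 / 6\<bar> = \<bar>g4 s\<bar> * (s - z) ^ 3 / 6"
        using s by (simp add: abs_mult power_abs abs_minus_commute[of z s])
      also have "\<dots> \<le> C / (6 * (1 - y)\<^sup>2) * (s - z) ^ 3 / s\<^sup>2"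
        using s y z by (intro quartic_weight_le C) auto
      finally show "\<bar>g4 s * (z - s) ^ 3 / 6\<bar> \<le> C / (6 * (1 - y)\<^sup>2) * (s - z) ^ 3 / s\<^sup>2" .
    qed (use C in auto)
    also have "\<dots> = C / (24 * (y * (1 - y))\<^sup>2) * ((y - z) ^ 4 * (231 / 200 + ((y - z) / y)\<^sup>2))"
      by (simp add: power_mult_distrib)
    also have "(y - z) ^ 4 = (z - y) ^ 4" by algebra
    also have "((y - z) / y)\<^sup>2 = ((z - y) / y)\<^sup>2" by (simp add: power_divide power2_commute)
    finally show ?thesis by (simp add: abs_minus_commute)
  next
    case False
    then have yz: "y \<le> z" by simp
    have "\<bar>F z - F y\<bar> \<le> C / (6 * y\<^sup>2) * ((z - y) ^ 4 / (4 * (1 - y)\<^sup>2) * (231 / 200 + ((z - y) / (1 - y))\<^sup>2))"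
    proof (rule increment_right[OF yz z(2) _ _ F])
      fix s assume s: "y < s" "s < z"
      have "\<bar>g4 s * (z - s) ^ 3 / 6\<bar> = \<bar>g4 s\<bar> * (z - s) ^ 3 / 6"
        using s by (simp add: abs_mult)
      also have "\<dots> \<le> C / (6 * y\<^sup>2) * (z - s) ^ 3 / (1 - s)\<^sup>2"
        using s y z C(2)[of s] by (intro quartic_weight_le[where s = "1 - s"]) (auto simp: mult.commute)
      finally show "\<bar>g4 s * (z - s) ^ 3 / 6\<bar> \<le> C / (6 * y\<^sup>2) * (z - s) ^ 3 / (1 - s)\<^sup>2" .
    qed (use C y in auto)
    also have "\<dots> \<le> C / (6 * y\<^sup>2) * ((z - y) ^ 4 / (4 * (1 - y)\<^sup>2) * (231 / 200 + ((z - y) / y)\<^sup>2))"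
      using C y yz by (intro mult_left_mono add_left_mono power_mono divide_left_mono) auto
    also have "\<dots> = C / (24 * (y * (1 - y))\<^sup>2) * ((z - y) ^ 4 * (231 / 200 + ((z - y) / y)\<^sup>2))"
      by (simp add: power_mult_distrib)
    finally show ?thesis .
  qed
  then show ?thesis by (simp add: Fz) (simp add: F_def)
qed

abbreviation bernstein_d2 :: "nat \<Rightarrow> (real \<Rightarrow> real) \<Rightarrow> real \<Rightarrow> real" where
  "bernstein_d2 n f \<equiv> bern_d2 n (\<lambda>k. f (real k / real n))"

abbreviation weighted_d2 :: "nat \<Rightarrow> (real \<Rightarrow> real) \<Rightarrow> real \<Rightarrow> real" where
  "weighted_d2 n f x \<equiv> \<bar>bernstein_d2 n f x\<bar> * (x * (1 - x) + 3 / 5 / real n)"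

text \<open>The setting of the contraction argument. The assumption \<open>ratio * D \<le> H\<close>
  turns every occurrence of \<open>D\<close> into a multiple of \<open>H\<close>, so that all
  contributions can be compared with \<open>H\<close> alone.\<close>

locale smoothed_bernstein =
  fixes n :: nat and f :: "real \<Rightarrow> real" and D H :: real
  assumes n_large: "10 ^ 10 \<le> n"
    and D: "\<And>x. 0 \<le> x \<Longrightarrow> x \<le> 1 \<Longrightarrow> \<bar>f x - bernstein_op n f x\<bar> \<le> D"
    and H: "\<And>x. 0 \<le> x \<Longrightarrow> x \<le> 1 \<Longrightarrow>
      weighted_d2 n f x \<le> real n * H"
    and H_nonneg: "0 \<le> H" and D_le: "ratio * D \<le> H"
begin

definition v :: "nat \<Rightarrow> real" where "v k = bernstein_op n f (real k / real n)"
definition u :: "nat \<Rightarrow> real" where "u k = f (real k / real n) - v k"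

lemma N: "10 ^ 10 \<le> real n"
  using n_large by (metis of_nat_le_iff of_nat_numeral of_nat_power)

lemma node: "k \<le> n \<Longrightarrow> 0 \<le> real k / real n" "k \<le> n \<Longrightarrow> real k / real n \<le> 1"
  using N by (auto simp: field_simps)

lemma D_nonneg: "0 \<le> D"
  using D[of 0] by simp

lemma D_le': "D \<le> H / ratio"
  using D_le by (simp add: ratio_def field_simps)

lemma u_le: "k \<le> n \<Longrightarrow> \<bar>u k\<bar> \<le> D"
  using D node by (simp add: u_def v_def)

lemma bern_d2_split: "bernstein_d2 n f x = bern_d2 n u x + bern_d2 n v x"
proof -
  have "diff2 (\<lambda>k. f (real k / real n)) = (\<lambda>k. diff2 u k + diff2 v k)"
    by (rule ext) (simp add: diff2_def u_def)
  then show ?thesis by (simp add: bern_d2_def bern_add distrib_left)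
qed

lemma diff2_v:
  assumes k: "k \<le> n - 2"
  shows "\<bar>diff2 v k\<bar> \<le> H * Lw (real (k + 1) * (real n - real (k + 1)) / real n + 3 / 5)"
proof -
  have n2: "n = (n - 2) + 2" using n_large by simp
  obtain h1 where h: "\<And>t. (bernstein_op n f has_real_derivative h1 t) (at t)"
    "\<And>t. (h1 has_real_derivative bernstein_d2 n f t) (at t)"
    using bern_derivs[of "n - 2" "\<lambda>k. f (real k / real n)"] unfolding n2[symmetric] bernstein_op_bern by blast
  have "2 \<le> n" using n_large by simp
  then have "k + 2 \<le> n" using k by simp
  then have kn: "real (k + 1) \<le> real n - 1" by linarith
  have "\<bar>bernstein_op n f ((real (k + 1) + 1) / real n) - 2 * bernstein_op n f (real (k + 1) / real n)
      + bernstein_op n f ((real (k + 1) - 1) / real n)\<bar> \<le> H * Lw (real (k + 1) * (real n - real (k + 1)) / real n + 3 / 5)"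
    by (rule diff2_weighted_bound[OF h H _ _ kn H_nonneg]) (use N in auto)
  then show ?thesis by (simp add: diff2_def v_def add.commute)
qed

lemma diff2_v_sq:
  assumes k: "k \<le> n - 2"
  shows "(diff2 v k)\<^sup>2 * node_weight n k \<le> (H * real n)\<^sup>2"
proof -
  define j where "j = real (k + 1)"
  define p where "p = j * (real n - j) / real n"
  have "2 \<le> n" using n_large by simp
  then have k2: "k + 2 \<le> n" using k by simp
  then have j: "1 \<le> j" "j \<le> real n - 1" unfolding j_def by linarith+
  have jn: "real n - 1 \<le> j * (real n - j)"
  proof -
    have "j * (real n - j) - (real n - 1) = (j - 1) * (real n - 1 - j)" by (simp add: algebra_simps)
    then show ?thesis using j by (metis diff_ge_0_iff_ge mult_nonneg_nonneg)
  qed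
  have p: "99 / 100 \<le> p" using jn N by (simp add: p_def field_simps)
  have nw: "node_weight n k = (p * (p + 1 + 1 / real n)) * (real n)\<^sup>2"
  proof -
    have eqs: "real (n - 1 - k) = real n - j" "real (n - k) = real n - j + 1" "real (k + 2) = j + 1"
      using k2 by (auto simp: j_def of_nat_diff)
    have "node_weight n k = j * (j + 1) * (real n - j) * (real n - j + 1)"
      unfolding node_weight_def eqs by (simp only: j_def)
    also have "\<dots> = (p * (p + 1 + 1 / real n)) * (real n)\<^sup>2"
      using N by (simp add: p_def field_simps power2_eq_square)
    finally show ?thesis .
  qed
  have "(diff2 v k)\<^sup>2 \<le> (H * Lw (p + 3 / 5))\<^sup>2"
    using diff2_v[OF k] by (intro abs_le_square_iff[THEN iffD1] order_trans[OF _ abs_ge_self]) (simp add: p_def j_def)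
  then have "(diff2 v k)\<^sup>2 * node_weight n k \<le> (H * Lw (p + 3 / 5))\<^sup>2 * ((p * (p + 1 + 1 / real n)) * (real n)\<^sup>2)"
    unfolding nw using p N by (intro mult_right_mono mult_nonneg_nonneg) auto
  also have "\<dots> = (H * real n)\<^sup>2 * ((Lw (p + 3 / 5))\<^sup>2 * (p * (p + 1 + 1 / real n)))"
    by (simp add: power_mult_distrib)
  also have "\<dots> \<le> (H * real n)\<^sup>2 * 1"
    using p N by (intro mult_left_mono Lw_sq) (auto simp: field_simps)
  finally show ?thesis by simp
qed

text \<open>At a node \<open>v\<close> is the value of the Bernstein polynomial of \<open>f\<close>,
  so the error of \<open>bern n v\<close> there is the Bernstein sum of \<open>v - f\<close> and at
  most \<open>D\<close>. A further Bernstein average preserves this bound.\<close>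

lemma bern_v_close:
  assumes x: "0 \<le> x" "x \<le> 1"
  shows "\<bar>bern n (\<lambda>k. bern n v (real k / real n)) x - bern n v x\<bar> \<le> D"
proof -
  have "\<bar>bern n v (real k / real n) - v k\<bar> \<le> D" if k: "k \<le> n" for k
  proof -
    have "\<bar>bern n (\<lambda>i. v i - f (real i / real n)) (real k / real n)\<bar> \<le> D"
      using u_le by (intro bern_bound node k) (simp add: u_def abs_minus_commute)
    then show ?thesis by (simp add: bern_diff v_def[of k] bernstein_op_bern)
  qed
  then have "\<bar>bern n (\<lambda>k. bern n v (real k / real n) - v k) x\<bar> \<le> D"
    using x by (intro bern_bound) auto
  then show ?thesis by (simp add: bern_diff)
qed

lemma d4_bounds:
  assumes "0 < x" "x < 1"
  shows "\<bar>bern_d4 n v x\<bar> * (x * (1 - x))\<^sup>2 \<le> sqrt 2 * (real n)\<^sup>2 * H"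
    and "\<bar>bern_d4 n v x\<bar> * (x * (1 - x)) \<le> real n ^ 3 * H"
  using bern_d4_bounds[OF assms _ H_nonneg diff2_v_sq] n_large by simp_all

lemma bern_d2_u_le:
  assumes y: "0 < y" "y < 1"
  shows "\<bar>bern_d2 n u y\<bar> * (y * (1 - y) + 3 / 5 / real n)
    \<le> real n * (sqrt 2 * (1 + 3 / 5 / (real n * (y * (1 - y)))) * D)"
proof -
  define w where "w = y * (1 - y)"
  have w: "0 < w" using y by (simp add: w_def)
  have n0: "0 < real n" using N by simp
  have "\<bar>bern_d2 n u y\<bar> * w \<le> sqrt 2 * real n * D"
    unfolding w_def using n_large by (intro bern_d2_le_sqrt2 y u_le) auto
  then have "(\<bar>bern_d2 n u y\<bar> * w) * (1 + 3 / 5 / (real n * w)) \<le> (sqrt 2 * real n * D) * (1 + 3 / 5 / (real n * w))"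
    using w n0 by (intro mult_right_mono) auto
  moreover have "(\<bar>bern_d2 n u y\<bar> * w) * (1 + 3 / 5 / (real n * w)) = \<bar>bern_d2 n u y\<bar> * (w + 3 / 5 / real n)"
    using w n0 by (simp add: field_simps)
  moreover have "(sqrt 2 * real n * D) * (1 + 3 / 5 / (real n * w)) = real n * (sqrt 2 * (1 + 3 / 5 / (real n * w)) * D)"
    by (simp only: ac_simps)
  ultimately show ?thesis by (simp only: w_def)
qed

text \<open>Up to a factor \<open>n\<close>, \<open>2 (m + 3 / 5) / l\<close> is the quotient of the
  weight at \<open>y\<close>, where the second derivative is found, by the factor
  \<open>x (1 - x) / (2 n)\<close> that accompanies it in the average at \<open>x\<close>.\<close>

lemma combined_bound:
  assumes x: "0 < x" "x < 1" and y: "0 < y" "y < 1" and yx: "y = x + (1 - 2 * x) / (3 * real n)"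
    and g: "\<And>t. (bern n v has_real_derivative g1 t) (at t)"
      "\<And>t. (bern_d2 n v has_real_derivative g3 t) (at t)"
    and r: "\<And>k. k \<le> n \<Longrightarrow> taylor_error (bern n v) g1 (bern_d2 n v) g3 y (real k / real n) \<le> R k"
    and rx: "taylor_error (bern n v) g1 (bern_d2 n v) g3 y x \<le> Rx"
    and S: "bern n R x + Rx \<le> S"
    and l: "l = real n * (x * (1 - x))" and m: "m = real n * (y * (1 - y))"
  shows "weighted_d2 n f y
    \<le> real n * (sqrt 2 * (1 + 3 / 5 / m) * D + 2 * (m + 3 / 5) / l * (D + S))"
proof -
  define W where "W = y * (1 - y) + 3 / 5 / real n"
  have n0: "0 < real n" using N by simp
  have W: "0 \<le> W" using y n0 by (simp add: W_def)
  have Wm: "W = (m + 3 / 5) / real n" using n0 by (simp add: W_def m field_simps)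
  have l0: "0 < l" using x n0 by (simp add: l)
  have "\<bar>bern_d2 n v y\<bar> * (x * (1 - x)) / (2 * real n) \<le> D + bern n R x + Rx"
    using x n0 bern_v_close[of x] by (intro second_deriv_le_average[OF x _ yx _ r rx]) auto
  also have "\<dots> \<le> D + S" using S by simp
  finally have "\<bar>bern_d2 n v y\<bar> * l / (2 * (real n)\<^sup>2) \<le> D + S"
    using n0 by (simp add: l power2_eq_square)
  then have a: "\<bar>bern_d2 n v y\<bar> \<le> 2 * (real n)\<^sup>2 / l * (D + S)"
    using l0 n0 by (simp add: field_simps)
  have "\<bar>bern_d2 n v y\<bar> * W \<le> 2 * (real n)\<^sup>2 / l * (D + S) * W"
    using a W by (rule mult_right_mono)
  also have "\<dots> = real n * (2 * (m + 3 / 5) / l * (D + S))"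
    unfolding Wm using n0 l0 by (simp add: power2_eq_square)
  finally have "\<bar>bern_d2 n v y\<bar> * W \<le> real n * (2 * (m + 3 / 5) / l * (D + S))" .
  moreover have "\<bar>bern_d2 n u y\<bar> * W \<le> real n * (sqrt 2 * (1 + 3 / 5 / m) * D)"
    using bern_d2_u_le[OF y] by (simp add: W_def m)
  moreover have "\<bar>bernstein_d2 n f y\<bar> * W \<le> \<bar>bern_d2 n u y\<bar> * W + \<bar>bern_d2 n v y\<bar> * W"
    unfolding bern_d2_split distrib_right[symmetric] using W by (intro mult_right_mono) auto
  ultimately show ?thesis unfolding W_def[symmetric] by (simp add: distrib_left)
qed

text \<open>The map from \<open>x\<close> to \<open>y\<close> contracts towards 1 / 2 by the factor
  \<open>c\<close>. It sends 0 to \<open>1 / (3 n)\<close>, which is below \<open>1 / n\<close>, so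
  the preimage of \<open>y\<close> is positive.\<close>

lemma shifted_point:
  assumes y: "1 / real n \<le> y" "y \<le> 1 / 2"
  obtains x where "y = x + (1 - 2 * x) / (3 * real n)" "0 < x" "x \<le> 1 / 2" "x \<le> y"
proof
  define c where "c = 1 - 2 / (3 * real n)"
  define x where "x = 1 / 2 - (1 / 2 - y) / c"
  have c: "0 < c" "c \<le> 1" using N by (auto simp: c_def field_simps)
  show "y = x + (1 - 2 * x) / (3 * real n)"
  proof -
    have "x + (1 - 2 * x) / (3 * real n) = 1 / 2 - (1 / 2 - x) * c"
      using N by (simp add: c_def field_simps)
    also have "\<dots> = y" using c by (simp add: x_def)
    finally show ?thesis by simp
  qed
  show x2: "x \<le> 1 / 2" using y c by (simp add: x_def)
  have "0 \<le> (1 - 2 * x) / (3 * real n)" using x2 by simp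
  then show "x \<le> y" using \<open>y = x + _\<close> by simp
  have "(1 / 2 - y) / c < 1 / 2"
    using y N c by (simp add: c_def field_simps)
  then show "0 < x" by (simp add: x_def)
qed

theorem bulk_bound:
  assumes y: "y \<le> 1 / 2" "10 \<le> real n * y"
  shows "weighted_d2 n f y \<le> 1999 / 2000 * (real n * H)"
proof -
  have n0: "0 < real n" using N by simp
  have y0: "0 < y" using y n0 by (metis less_le_trans zero_less_mult_pos zero_less_numeral)
  have y1: "1 / real n \<le> y" using y n0 by (simp add: field_simps)
  obtain x where x: "y = x + (1 - 2 * x) / (3 * real n)" "0 < x" "x \<le> 1 / 2" "x \<le> y"
    using shifted_point[OF y1 y(1)] by blast
  define l m q where "l = real n * (x * (1 - x))" and "m = real n * (y * (1 - y))" and "q = 1 - 2 * x"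
  have q: "0 \<le> q" "q \<le> 1" using x by (auto simp: q_def)
  have nyx: "real n * y = real n * x + q / 3" using x(1) n0 by (simp add: q_def field_simps)
  have ml: "l \<le> m" "m \<le> l + 1 / 3"
  proof -
    have "m - l = (real n * y - real n * x) * (1 - x - y)" by (simp add: m_def l_def algebra_simps)
    also have "\<dots> = q / 3 * (1 - x - y)" by (simp add: nyx)
    finally have e: "m - l = q / 3 * (1 - x - y)" .
    have "0 \<le> q / 3 * (1 - x - y)" using q x(3) y(1) by (intro mult_nonneg_nonneg) auto
    moreover have "q / 3 * (1 - x - y) \<le> 1 / 3 * 1" using q x(2-4) y(1) y0 by (intro mult_mono) linarith+
    ultimately show "l \<le> m" "m \<le> l + 1 / 3" using e by auto
  qed
  have mny: "m \<le> real n * y" using y0 n0 by (simp add: m_def mult_left_le)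
  have m: "999 / 100 \<le> m"
  \<comment> \<open>For small \<open>y\<close> the factor \<open>1 - y\<close> costs little;
    otherwise the size of \<open>n\<close> makes \<open>m\<close> huge.\<close>
  proof (cases "y \<le> 1 / 1000")
    case True
    have "10 * (999 / 1000) \<le> (real n * y) * (1 - y)" using y True by (intro mult_mono) auto
    then show ?thesis by (simp add: m_def)
  next
    case False
    have "10 ^ 10 * (1 / 1000 * (1 / 2)) \<le> real n * (y * (1 - y))"
      using N False y by (intro mult_mono) auto
    then show ?thesis by (simp add: m_def)
  qed
  have l: "193 / 20 \<le> l" using m ml by simp
  have n4: "4 \<le> n" using n_large by simp
  obtain g1 g3 where g: "\<And>t. (bern n v has_real_derivative g1 t) (at t)"
    "\<And>t. (g1 has_real_derivative bern_d2 n v t) (at t)"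
    "\<And>t. (bern_d2 n v has_real_derivative g3 t) (at t)"
    "\<And>t. (g3 has_real_derivative bern_d4 n v t) (at t)"
    using bern_derivs4[of n v thesis] n4 by blast
  define A where "A = sqrt 2 * H / (24 * m\<^sup>2)"
  have A: "0 \<le> A" using H_nonneg by (simp add: A_def)
  define E where "E t = t ^ 4 * (231 / 200) + t ^ 6 / m\<^sup>2" for t :: real
  have rem: "taylor_error (bern n v) g1 (bern_d2 n v) g3 y z \<le> A * E (real n * z - real n * y)"
    if z: "0 \<le> z" "z \<le> 1" for z
  proof -
    define t where "t = real n * z - real n * y"
    have zy: "z - y = t / real n" using n0 by (simp add: t_def field_simps)
    have "taylor_error (bern n v) g1 (bern_d2 n v) g3 y z
      \<le> sqrt 2 * (real n)\<^sup>2 * H / (24 * (y * (1 - y))\<^sup>2) * ((z - y) ^ 4 * (231 / 200 + ((z - y) / y)\<^sup>2))"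
      using H_nonneg d4_bounds(1) y y0 z by (intro taylor3_remainder_bulk[OF g]) auto
    also have "\<dots> = A * (t ^ 4 * (231 / 200 + (t / (real n * y))\<^sup>2))"
      using n0 y0 y by (simp add: zy A_def m_def power_mult_distrib power_divide) (simp add: eval_nat_numeral ac_simps)
    also have "\<dots> \<le> A * (t ^ 4 * (231 / 200 + t\<^sup>2 / m\<^sup>2))"
    proof -
      have "m\<^sup>2 \<le> (real n * y)\<^sup>2" using mny m by (intro power_mono) auto
      then have "t\<^sup>2 / (real n * y)\<^sup>2 \<le> t\<^sup>2 / m\<^sup>2" using m y0 n0
        by (intro divide_left_mono mult_pos_pos zero_less_power) auto
      then show ?thesis using A by (intro mult_left_mono add_left_mono) (auto simp: power_divide)
    qed
    also have "\<dots> = A * E t" by (simp add: E_def distrib_left)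
    finally show ?thesis by (simp add: t_def)
  qed
  have rk: "taylor_error (bern n v) g1 (bern_d2 n v) g3 y (real k / real n)
      \<le> A * E (real k - real n * y)" if "k \<le> n" for k
    using rem[of "real k / real n"] node[OF that] n0 by simp
  have rx: "taylor_error (bern n v) g1 (bern_d2 n v) g3 y x \<le> A * (231 / 200 / 81 + 1 / m\<^sup>2)"
  proof -
    have d: "real n * x - real n * y = - (q / 3)" using nyx by simp
    have "q ^ 4 \<le> 1" "q ^ 6 \<le> 1" using q by (auto intro: power_le_one)
    then have "E (- (q / 3)) \<le> 231 / 200 / 81 + 1 / m\<^sup>2"
      unfolding E_def by (intro add_mono divide_right_mono) (auto simp: power_divide)
    then have "A * E (- (q / 3)) \<le> A * (231 / 200 / 81 + 1 / m\<^sup>2)" using A by (rule mult_left_mono)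
    moreover have "taylor_error (bern n v) g1 (bern_d2 n v) g3 y x \<le> A * E (- (q / 3))"
      using rem[of x] x(2,3) unfolding d by simp
    ultimately show ?thesis by linarith
  qed
  have "bern n (\<lambda>k. A * E (real k - real n * y)) x
     = A * (bern n (\<lambda>k. (real k - real n * y) ^ 4) x * (231 / 200) + bern n (\<lambda>k. (real k - real n * y) ^ 6) x / m\<^sup>2)"
  proof -
    have "(\<lambda>k. E (real k - real n * y)) = (\<lambda>k. (231 / 200) * (real k - real n * y) ^ 4 + (1 / m\<^sup>2) * (real k - real n * y) ^ 6)"
      by (simp add: E_def mult.commute)
    then show ?thesis
      unfolding bern_cmult[of n A "\<lambda>k. E (real k - real n * y)"] by (simp only: bern_add bern_cmult) simp
  qed
  also have "\<dots> \<le> A * ((3 * l\<^sup>2 + l / 3 + 1 / 81) * (231 / 200) + (15 * l ^ 3 + 10 * l\<^sup>2 + 2 * l + 1) / m\<^sup>2)"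
    using shift_moment_bounds(3,4)[OF x(2,3) _ x(1) l_def] n_large A
    by (intro mult_left_mono add_mono mult_right_mono divide_right_mono) auto
  finally have S: "bern n (\<lambda>k. A * E (real k - real n * y)) x + A * (231 / 200 / 81 + 1 / m\<^sup>2)
     \<le> A * (231 / 200 * (3 * l\<^sup>2 + l / 3 + 2 / 81) + (15 * l ^ 3 + 10 * l\<^sup>2 + 2 * l + 2) / m\<^sup>2)"
    by (simp add: add_divide_distrib algebra_simps)
  define Z where "Z = 231 / 200 * (3 * l\<^sup>2 + l / 3 + 2 / 81) + (15 * l ^ 3 + 10 * l\<^sup>2 + 2 * l + 2) / l\<^sup>2"
  have l2m: "l\<^sup>2 \<le> m\<^sup>2" using l ml by (intro power_mono) auto
  have Z: "0 \<le> Z" unfolding Z_def using l by (intro add_nonneg_nonneg divide_nonneg_nonneg mult_nonneg_nonneg) auto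
  have S': "bern n (\<lambda>k. A * E (real k - real n * y)) x + A * (231 / 200 / 81 + 1 / m\<^sup>2) \<le> A * Z"
  proof (rule order_trans[OF S], intro mult_left_mono A)
    have "(15 * l ^ 3 + 10 * l\<^sup>2 + 2 * l + 2) / m\<^sup>2 \<le> (15 * l ^ 3 + 10 * l\<^sup>2 + 2 * l + 2) / l\<^sup>2"
      using l ml l2m by (intro divide_left_mono mult_pos_pos zero_less_power) (auto intro!: add_nonneg_nonneg)
    then show "231 / 200 * (3 * l\<^sup>2 + l / 3 + 2 / 81) + (15 * l ^ 3 + 10 * l\<^sup>2 + 2 * l + 2) / m\<^sup>2 \<le> Z"
      by (simp add: Z_def)
  qed
  have yl: "y < 1" "x < 1" using x(3) y by linarith+
  have "weighted_d2 n f y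
    \<le> real n * (sqrt 2 * (1 + 3 / 5 / m) * D + 2 * (m + 3 / 5) / l * (D + A * Z))"
    by (rule combined_bound[OF x(2) yl(2) y0 yl(1) x(1) g(1,3) rk rx S' l_def m_def])
  also have "\<dots> \<le> real n * (199 / 200 * H)"
  proof (intro mult_left_mono)
    have "sqrt 2 * (1 + 3 / 5 / m) * D \<le> 70711 / 50000 * (1 + 3 / 5 / l) * (H / ratio)"
      using sqrt2_le l ml D_le' D_nonneg by (intro mult_mono add_left_mono divide_left_mono) auto
    moreover have "2 * (m + 3 / 5) / l * D \<le> 2 * (l + 14 / 15) / l * (H / ratio)"
      using l ml D_le' D_nonneg by (intro mult_mono divide_right_mono) auto
    moreover have "2 * (m + 3 / 5) / l * (A * Z) \<le> H * (70711 / 50000 / (12 * l) * (1 / l + 3 / 5 / l\<^sup>2) * Z)"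
    proof -
      have "2 * (m + 3 / 5) / l * (A * Z) = H * (sqrt 2 / (12 * l) * (1 / m + 3 / 5 / m\<^sup>2) * Z)"
        using l ml by (simp add: A_def field_simps power2_eq_square)
      also have "\<dots> \<le> H * (70711 / 50000 / (12 * l) * (1 / l + 3 / 5 / l\<^sup>2) * Z)"
        using l ml l2m sqrt2_le Z H_nonneg
        by (intro mult_left_mono mult_right_mono mult_mono add_mono divide_left_mono divide_right_mono) auto
      finally show ?thesis .
    qed
    ultimately have 3: "sqrt 2 * (1 + 3 / 5 / m) * D + (2 * (m + 3 / 5) / l * D + 2 * (m + 3 / 5) / l * (A * Z))
      \<le> 70711 / 50000 * (1 + 3 / 5 / l) * (H / ratio) + (2 * (l + 14 / 15) / l * (H / ratio)
        + H * (70711 / 50000 / (12 * l) * (1 / l + 3 / 5 / l\<^sup>2) * Z))"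
      by (intro add_mono)
    have gen: "h * (a / r + b / r + c) = a * (h / r) + (b * (h / r) + h * c)" for h a b c r :: real
      by (simp add: algebra_simps)
    have "sqrt 2 * (1 + 3 / 5 / m) * D + 2 * (m + 3 / 5) / l * (D + A * Z)
      \<le> H * (70711 / 50000 * (1 + 3 / 5 / l) / ratio + 2 * (l + 14 / 15) / l / ratio
        + 70711 / 50000 / (12 * l) * (1 / l + 3 / 5 / l\<^sup>2) * Z)"
      unfolding gen distrib_left[of "2 * (m + 3 / 5) / l"] by (rule 3)
    also have "\<dots> \<le> H * (199 / 200)"
      using bulk_numeric[OF l] H_nonneg unfolding Z_def by (intro mult_left_mono) auto
    finally show "sqrt 2 * (1 + 3 / 5 / m) * D + 2 * (m + 3 / 5) / l * (D + A * Z) \<le> 199 / 200 * H" by simp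
  qed (use n0 in auto)
  also have "\<dots> \<le> 1999 / 2000 * (real n * H)" using n0 H_nonneg by simp
  finally show ?thesis .
qed

end

lemma inverse_square_near_one:
  fixes y :: real
  assumes "0 \<le> y" "y \<le> 1 / 10000"
  shows "1 / (1 - y)\<^sup>2 \<le> 10003 / 10000"
proof -
  have "(9999 / 10000)\<^sup>2 \<le> (1 - y)\<^sup>2" using assms by (intro power_mono) auto
  then have "1 / (1 - y)\<^sup>2 \<le> 1 / (9999 / 10000)\<^sup>2" using assms by (intro divide_left_mono mult_pos_pos zero_less_power) auto
  then show ?thesis by (simp add: power2_eq_square)
qed

text \<open>For small \<open>n y\<close> the sixth-moment term of the bulk estimate is too large.
  The remainder is therefore bounded separately at 0, left of \<open>y\<close>, right of
  \<open>y\<close> and far away, and the bounds are then put under one polynomial.\<close>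

locale quartic_control =
  fixes n y H :: real and g g1 g2 g3 g4 :: "real \<Rightarrow> real"
  assumes g: "\<And>t. (g has_real_derivative g1 t) (at t)" "\<And>t. (g1 has_real_derivative g2 t) (at t)"
      "\<And>t. (g2 has_real_derivative g3 t) (at t)" "\<And>t. (g3 has_real_derivative g4 t) (at t)"
    and n: "10 ^ 10 \<le> n" and H: "0 \<le> H" and Y: "2 \<le> n * y" "n * y \<le> 10"
    and g4_sq: "\<And>s. 0 < s \<Longrightarrow> s < 1 \<Longrightarrow> \<bar>g4 s\<bar> * (s * (1 - s))\<^sup>2 \<le> sqrt 2 * n\<^sup>2 * H"
    and g4_lin: "\<And>s. 0 < s \<Longrightarrow> s < 1 \<Longrightarrow> \<bar>g4 s\<bar> * (s * (1 - s)) \<le> n ^ 3 * H"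
begin

definition A :: real where "A = sqrt 2 * H / (24 * (n * y)\<^sup>2)"
definition dev :: "real \<Rightarrow> real" where "dev z = n * z - n * y"

lemma A_nonneg: "0 \<le> A"
  using H by (simp add: A_def)

lemma y: "0 < y" "y \<le> 1 / 10 ^ 9" "y < 1"
proof -
  have "0 < n * y" using Y by linarith
  then show "0 < y" using n by (simp add: zero_less_mult_iff)
  have "10 ^ 10 * y \<le> n * y" using n \<open>0 < y\<close> by (intro mult_right_mono) auto
  then show "y \<le> 1 / 10 ^ 9" "y < 1" using Y by simp_all
qed

lemma diff_dev: "z - y = dev z / n"
  using n by (simp add: dev_def field_simps)

lemma A_scale: "sqrt 2 * n\<^sup>2 * H / (24 * y\<^sup>2) * (z - y) ^ 4 = A * dev z ^ 4"
  using n y unfolding diff_dev A_def by (simp add: power_mult_distrib power_divide) (simp add: eval_nat_numeral ac_simps)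

lemma F_derivative: "((\<lambda>s. taylor3 g g1 g2 g3 s z) has_real_derivative g4 t * (z - t) ^ 3 / 6) (at t)"
  by (rule taylor3_has_derivative[OF g])

lemma remainder_left:
  assumes z: "0 \<le> z" "z \<le> y"
  shows "taylor_error g g1 g2 g3 y z \<le> A * (10003 / 10000 * (2 * dev z ^ 4))"
proof -
  define C where "C = sqrt 2 * n\<^sup>2 * H"
  have C: "0 \<le> C" using H by (simp add: C_def)
  have "\<bar>taylor3 g g1 g2 g3 y z - taylor3 g g1 g2 g3 z z\<bar> \<le> C / (6 * (1 - y)\<^sup>2) * ((y - z) ^ 4 / (2 * y\<^sup>2))"
  proof (rule increment_left_coarse[OF z _ F_derivative])
    fix s assume s: "z < s" "s < y"
    have "\<bar>g4 s * (z - s) ^ 3 / 6\<bar> = \<bar>g4 s\<bar> * (s - z) ^ 3 / 6"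
      using s by (simp add: abs_mult power_abs abs_minus_commute[of z s])
    also have "\<dots> \<le> C / (6 * (1 - y)\<^sup>2) * (s - z) ^ 3 / s\<^sup>2"
      using s y z g4_sq[of s] by (intro quartic_weight_le) (auto simp: C_def)
    finally show "\<bar>g4 s * (z - s) ^ 3 / 6\<bar> \<le> C / (6 * (1 - y)\<^sup>2) * (s - z) ^ 3 / s\<^sup>2" .
  qed (use C in auto)
  also have "\<dots> = (C / (24 * y\<^sup>2) * (z - y) ^ 4) * (1 / (1 - y)\<^sup>2 * 2)"
  proof -
    have "(y - z) ^ 4 = (z - y) ^ 4" by algebra
    then show ?thesis by simp
  qed
  also have "\<dots> = (A * dev z ^ 4) * (1 / (1 - y)\<^sup>2 * 2)"
    unfolding C_def A_scale ..
  also have "\<dots> \<le> (A * dev z ^ 4) * (10003 / 10000 * 2)"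
    using A_nonneg y by (intro mult_left_mono mult_right_mono inverse_square_near_one mult_nonneg_nonneg) auto
  finally show ?thesis by (simp add: taylor3_self abs_minus_commute)
qed

lemma remainder_near:
  assumes z: "y \<le> z" "z \<le> 1 / 10000"
  shows "taylor_error g g1 g2 g3 y z \<le> A * (10003 / 10000 * dev z ^ 4)"
proof -
  define C where "C = sqrt 2 * n\<^sup>2 * H"
  define K where "K = C / (6 * y\<^sup>2) * (10003 / 10000)"
  have C: "0 \<le> C" using H by (simp add: C_def)
  have "\<bar>taylor3 g g1 g2 g3 z z - taylor3 g g1 g2 g3 y z\<bar> \<le> - (K * (z - z) ^ 4 / 4) - - (K * (z - y) ^ 4 / 4)"
  proof (rule abs_diff_le_of_deriv[OF z(1) F_derivative])
    show "((\<lambda>t. - (K * (z - t) ^ 4 / 4)) has_real_derivative K * (z - t) ^ 3) (at t)" for t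
      by (auto intro!: derivative_eq_intros)
    fix s assume s: "y < s" "s < z"
    have s01: "0 < s" "s < 1" using s y z by linarith+
    have "\<bar>g4 s * (z - s) ^ 3 / 6\<bar> = \<bar>g4 s\<bar> * (z - s) ^ 3 / 6" using s by (simp add: abs_mult)
    also have "\<dots> \<le> C / (6 * y\<^sup>2) * (z - s) ^ 3 / (1 - s)\<^sup>2"
      using s s01 y g4_sq[of s] by (intro quartic_weight_le[where s = "1 - s"]) (auto simp: C_def mult.commute)
    also have "\<dots> = (C / (6 * y\<^sup>2) * (z - s) ^ 3) * (1 / (1 - s)\<^sup>2)" by simp
    also have "\<dots> \<le> (C / (6 * y\<^sup>2) * (z - s) ^ 3) * (10003 / 10000)"
      using C s s01 z by (intro mult_left_mono inverse_square_near_one mult_nonneg_nonneg) auto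
    finally show "\<bar>g4 s * (z - s) ^ 3 / 6\<bar> \<le> K * (z - s) ^ 3" by (simp add: K_def ac_simps)
  qed
  also have "\<dots> = (C / (24 * y\<^sup>2) * (z - y) ^ 4) * (10003 / 10000)"
    by (simp add: K_def)
  also have "\<dots> = (A * dev z ^ 4) * (10003 / 10000)"
    unfolding C_def A_scale ..
  finally show ?thesis by (simp add: taylor3_self)
qed

text \<open>Here \<open>dev z / n\<close> is at least 9 / 100000, so two further powers of it can be
  inserted at the price of \<open>10 ^ 9\<close>. The sixth moment stays bounded for
  \<open>n y \<le> 10\<close>, and division by \<open>n\<^sup>2\<close> makes the term
  negligible.\<close>

lemma remainder_far:
  assumes z: "1 / 10000 \<le> z" "z \<le> 1"
  shows "taylor_error g g1 g2 g3 y z \<le> A * (10 ^ 9 / n\<^sup>2 * dev z ^ 6)"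
proof -
  define C where "C = sqrt 2 * n\<^sup>2 * H"
  have C: "0 \<le> C" using H by (simp add: C_def)
  have yz: "y \<le> z" using y z by simp
  have "\<bar>taylor3 g g1 g2 g3 z z - taylor3 g g1 g2 g3 y z\<bar> \<le> C / (6 * y\<^sup>2) * ((z - y) ^ 4 / (2 * (1 - y)\<^sup>2))"
  proof (rule increment_right_coarse[OF yz z(2) _ F_derivative])
    fix s assume s: "y < s" "s < z"
    have "\<bar>g4 s * (z - s) ^ 3 / 6\<bar> = \<bar>g4 s\<bar> * (z - s) ^ 3 / 6" using s by (simp add: abs_mult)
    also have "\<dots> \<le> C / (6 * y\<^sup>2) * (z - s) ^ 3 / (1 - s)\<^sup>2"
      using s y z g4_sq[of s] by (intro quartic_weight_le[where s = "1 - s"]) (auto simp: C_def mult.commute)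
    finally show "\<bar>g4 s * (z - s) ^ 3 / 6\<bar> \<le> C / (6 * y\<^sup>2) * (z - s) ^ 3 / (1 - s)\<^sup>2" .
  qed (use C in auto)
  also have "\<dots> = (C / (24 * y\<^sup>2) * (z - y) ^ 4) * (1 / (1 - y)\<^sup>2 * 2)" by simp
  also have "\<dots> = (A * dev z ^ 4) * (1 / (1 - y)\<^sup>2 * 2)"
    unfolding C_def A_scale ..
  also have "\<dots> \<le> (A * dev z ^ 4) * (10 ^ 9 / n\<^sup>2 * (dev z)\<^sup>2)"
  proof (rule mult_left_mono)
    have "1 / (1 - y)\<^sup>2 \<le> 10003 / 10000" using y by (intro inverse_square_near_one) auto
    moreover have "(9 / 100000)\<^sup>2 \<le> (dev z / n)\<^sup>2"
      unfolding diff_dev[symmetric] using y z by (intro power_mono) auto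
    moreover have "10 ^ 9 / n\<^sup>2 * (dev z)\<^sup>2 = 10 ^ 9 * (dev z / n)\<^sup>2" by (simp add: power_divide)
    ultimately show "1 / (1 - y)\<^sup>2 * 2 \<le> 10 ^ 9 / n\<^sup>2 * (dev z)\<^sup>2" by (simp add: power_divide)
  qed (use A_nonneg in auto)
  also have "\<dots> = A * (10 ^ 9 / n\<^sup>2 * dev z ^ 6)"
  proof -
    have "dev z ^ 6 = dev z ^ 4 * (dev z)\<^sup>2" by algebra
    then show ?thesis by simp
  qed
  finally show ?thesis by (simp add: taylor3_self)
qed

text \<open>Near zero the bound by \<open>n\<^sup>3 / s\<close> beats the one by \<open>n\<^sup>2 / s\<^sup>2\<close>; the two agree at \<open>s = sqrt 2 / n\<close>.\<close>

lemma remainder_zero: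
  "taylor_error g g1 g2 g3 y 0 \<le> A * (10003 / 10000 * (2 * (n * y) ^ 4 - 4 / 3 * (n * y)\<^sup>2))"
proof -
  define F where "F s = taylor3 g g1 g2 g3 s 0" for s
  define c where "c = (10003 / 10000 :: real)"
  define s0 where "s0 = sqrt 2 / n"
  have n0: "0 < n" using n by simp
  have r2: "sqrt 2 \<le> 2" by (rule real_le_lsqrt) auto
  have s0: "0 \<le> s0" "s0 \<le> y"
    using n0 r2 Y by (auto simp: s0_def field_simps)
  have F: "(F has_real_derivative g4 t * (0 - t) ^ 3 / 6) (at t)" for t
    unfolding F_def[abs_def] by (rule F_derivative)
  have ab: "\<bar>g4 s * (0 - s) ^ 3 / 6\<bar> = \<bar>g4 s\<bar> * s ^ 3 / 6" if "0 < s" for s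
    using that by (simp add: abs_mult power_abs)
  have in2: "1 / (1 - s)\<^sup>2 \<le> c" "1 / (1 - s) \<le> c" if s: "0 < s" "s < y" for s
  proof -
    show 1: "1 / (1 - s)\<^sup>2 \<le> c" unfolding c_def using s y by (intro inverse_square_near_one) auto
    have "(1 - s)\<^sup>2 \<le> 1 - s" using s y by (simp add: power2_eq_square mult_left_le)
    then have "1 / (1 - s) \<le> 1 / (1 - s)\<^sup>2" using s y by (intro divide_left_mono mult_pos_pos zero_less_power) auto
    then show "1 / (1 - s) \<le> c" using 1 by linarith
  qed
  have 1: "\<bar>F s0 - F 0\<bar> \<le> c * n ^ 3 * H * s0 ^ 3 / 18 - c * n ^ 3 * H * 0 ^ 3 / 18"
  proof (rule abs_diff_le_of_deriv[OF s0(1) F])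
    show "((\<lambda>t. c * n ^ 3 * H * t ^ 3 / 18) has_real_derivative c * n ^ 3 * H * t\<^sup>2 / 6) (at t)" for t
      by (auto intro!: derivative_eq_intros)
    fix s assume s: "0 < s" "s < s0"
    have s1: "s < y" "s < 1" using s s0 y by linarith+
    have "\<bar>g4 s\<bar> * s \<le> n ^ 3 * H / (1 - s)"
      using g4_lin[of s] s s1 by (simp add: pos_le_divide_eq mult.assoc)
    also have "\<dots> = n ^ 3 * H * (1 / (1 - s))" by simp
    also have "\<dots> \<le> n ^ 3 * H * c" using in2(2)[OF s(1) s1(1)] n0 H by (intro mult_left_mono) auto
    finally have le: "(\<bar>g4 s\<bar> * s) * (s\<^sup>2 / 6) \<le> n ^ 3 * H * c * (s\<^sup>2 / 6)" by (intro mult_right_mono) auto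
    have eq: "\<bar>g4 s\<bar> * s ^ 3 / 6 = (\<bar>g4 s\<bar> * s) * (s\<^sup>2 / 6)" by (simp add: eval_nat_numeral)
    have rhs: "c * n ^ 3 * H * s\<^sup>2 / 6 = n ^ 3 * H * c * (s\<^sup>2 / 6)" by simp
    from le show "\<bar>g4 s * (0 - s) ^ 3 / 6\<bar> \<le> c * n ^ 3 * H * s\<^sup>2 / 6"
      by (simp only: ab[OF s(1)] eq rhs)
  qed
  have 2: "\<bar>F y - F s0\<bar> \<le> c * sqrt 2 * n\<^sup>2 * H * y\<^sup>2 / 12 - c * sqrt 2 * n\<^sup>2 * H * s0\<^sup>2 / 12"
  proof (rule abs_diff_le_of_deriv[OF s0(2) F])
    show "((\<lambda>t. c * sqrt 2 * n\<^sup>2 * H * t\<^sup>2 / 12) has_real_derivative c * sqrt 2 * n\<^sup>2 * H * t / 6) (at t)" for t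
      by (auto intro!: derivative_eq_intros)
    fix s assume s: "s0 < s" "s < y"
    have s1: "0 < s" "s < 1" using s s0 y by linarith+
    have "(\<bar>g4 s\<bar> * s\<^sup>2) * (1 - s)\<^sup>2 \<le> sqrt 2 * n\<^sup>2 * H"
      using g4_sq[OF s1] by (simp add: power_mult_distrib mult.assoc)
    then have "\<bar>g4 s\<bar> * s\<^sup>2 \<le> sqrt 2 * n\<^sup>2 * H / (1 - s)\<^sup>2"
      using s1 by (subst pos_le_divide_eq) auto
    also have "\<dots> = sqrt 2 * n\<^sup>2 * H * (1 / (1 - s)\<^sup>2)" by simp
    also have "\<dots> \<le> sqrt 2 * n\<^sup>2 * H * c" using in2(1)[OF s1(1) s(2)] H by (intro mult_left_mono) auto
    finally have le: "(\<bar>g4 s\<bar> * s\<^sup>2) * (s / 6) \<le> sqrt 2 * n\<^sup>2 * H * c * (s / 6)" using s1 by (intro mult_right_mono) auto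
    have eq: "\<bar>g4 s\<bar> * s ^ 3 / 6 = (\<bar>g4 s\<bar> * s\<^sup>2) * (s / 6)" by (simp add: eval_nat_numeral)
    have rhs: "c * sqrt 2 * n\<^sup>2 * H * s / 6 = sqrt 2 * n\<^sup>2 * H * c * (s / 6)" by simp
    from le show "\<bar>g4 s * (0 - s) ^ 3 / 6\<bar> \<le> c * sqrt 2 * n\<^sup>2 * H * s / 6"
      by (simp only: ab[OF s1(1)] eq rhs)
  qed
  have "\<bar>F y - F 0\<bar> \<le> (c * n ^ 3 * H * s0 ^ 3 / 18 - c * n ^ 3 * H * 0 ^ 3 / 18)
      + (c * sqrt 2 * n\<^sup>2 * H * y\<^sup>2 / 12 - c * sqrt 2 * n\<^sup>2 * H * s0\<^sup>2 / 12)"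
    using 1 2 by linarith
  also have "\<dots> = c * H * (n ^ 3 * s0 ^ 3) / 18 + c * sqrt 2 * H * ((n * y)\<^sup>2 - (n * s0)\<^sup>2) / 12"
    by (simp add: power_mult_distrib right_diff_distrib diff_divide_distrib ac_simps)
  also have "\<dots> = c * sqrt 2 * H * ((n * y)\<^sup>2 / 12 - 1 / 18)"
  proof -
    have "n * s0 = sqrt 2" using n0 by (simp add: s0_def)
    then have "(n * s0)\<^sup>2 = 2" "n ^ 3 * s0 ^ 3 = 2 * sqrt 2"
      by (simp_all add: power_mult_distrib[symmetric]) (simp add: eval_nat_numeral)
    then show ?thesis by (simp add: field_simps)
  qed
  also have "\<dots> = A * (c * (2 * (n * y) ^ 4 - 4 / 3 * (n * y)\<^sup>2))"
  proof -
    have eq: "Y\<^sup>2 / 12 - 1 / 18 = 1 / (24 * Y\<^sup>2) * (2 * Y ^ 4 - 4 / 3 * Y\<^sup>2)" if "0 < Y" for Y :: real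
      using that by (simp add: field_simps eval_nat_numeral)
    have "0 < n * y" using Y by linarith
    from eq[OF this] show ?thesis by (simp add: A_def)
  qed
  finally show ?thesis by (simp add: F_def taylor3_self c_def abs_minus_commute)
qed

text \<open>The square is free to choose: it makes up for the loss at the nodes left of \<open>y\<close>, and its cubic
  part is harmless because the third moment is almost zero. The parameter \<open>b\<close> is tuned to \<open>n y\<close>.\<close>

definition envelope :: "real \<Rightarrow> real \<Rightarrow> real" where
  "envelope b t = t ^ 4 + t\<^sup>2 * ((1 - b) * (n * y - 1 / (n * y)) - b * t)\<^sup>2 + 10 ^ 9 / n\<^sup>2 * t ^ 6"

text \<open>Left of \<open>y\<close> the remainder costs \<open>2 t ^ 4\<close> with
  \<open>t = dev z\<close>, so the square has to supply a second \<open>t ^ 4\<close>. For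
  \<open>n z \<ge> 1\<close> it does, since
  \<open>\<bar>t\<bar> \<le> n y - 1 \<le> n y - 1 / (n y)\<close>. At \<open>z = 0\<close> it falls
  short by at most \<open>2 (1 - b) (n y)\<^sup>2\<close>, and the saving
  \<open>4 / 3 (n y)\<^sup>2\<close> of \<open>remainder_zero\<close> makes up for this exactly when
  \<open>b \<ge> 1 / 3\<close>. That nodes are multiples of \<open>1 / n\<close> is what excludes
  points in between.\<close>

lemma remainder_node:
  assumes b: "1 / 3 \<le> b" "b \<le> 1" and z: "z = 0 \<or> 1 \<le> n * z" "0 \<le> z" "z \<le> 1"
  shows "taylor_error g g1 g2 g3 y z \<le> A * (10003 / 10000 * envelope b (dev z))"
proof -
  define a where "a = (1 - b) * (n * y - 1 / (n * y))"
  have env: "envelope b (dev z) = dev z ^ 4 + (dev z)\<^sup>2 * (a - b * dev z)\<^sup>2 + 10 ^ 9 / n\<^sup>2 * dev z ^ 6"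
    by (simp add: envelope_def a_def)
  have pos: "0 \<le> dev z ^ 4" "0 \<le> (dev z)\<^sup>2 * (a - b * dev z)\<^sup>2" "0 \<le> 10 ^ 9 / n\<^sup>2 * dev z ^ 6"
    by auto
  have le_sum: "r \<le> 10003 / 10000 * (p + q + r)" if "0 \<le> p" "0 \<le> q" "0 \<le> r" for p q r :: real
    using that by simp
  consider "z = 0" | "1 \<le> n * z" "z \<le> y" | "y \<le> z" "z \<le> 1 / 10000" | "1 / 10000 \<le> z"
    using z y by fastforce
  then show ?thesis
  proof cases
    case 1
    define Z where "Z = n * y"
    have Z: "0 < Z" using Y by (simp add: Z_def)
    have dz: "dev z = - Z" by (simp add: dev_def Z_def 1)
    have "Z\<^sup>2 * (a - b * - Z)\<^sup>2 = (Z\<^sup>2 - (1 - b))\<^sup>2"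
    proof -
      have "Z * (a - b * - Z) = Z\<^sup>2 - (1 - b)" using Z by (simp add: a_def Z_def[symmetric] field_simps power2_eq_square)
      then show ?thesis by (simp add: power_mult_distrib[symmetric])
    qed
    also have "\<dots> = Z ^ 4 - 2 * (1 - b) * Z\<^sup>2 + (1 - b)\<^sup>2" by algebra
    finally have "Z\<^sup>2 * (a - b * - Z)\<^sup>2 \<ge> Z ^ 4 - 2 * (1 - b) * Z\<^sup>2" by simp
    moreover have "2 * (1 - b) * Z\<^sup>2 \<le> 4 / 3 * Z\<^sup>2" using b by (intro mult_right_mono) auto
    moreover note pos(3)[unfolded dz]
    ultimately have "2 * Z ^ 4 - 4 / 3 * Z\<^sup>2 \<le> Z ^ 4 + Z\<^sup>2 * (a - b * - Z)\<^sup>2 + 10 ^ 9 / n\<^sup>2 * (- Z) ^ 6"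
      by linarith
    also have "\<dots> = envelope b (dev z)" unfolding env unfolding dz by simp
    finally have "2 * Z ^ 4 - 4 / 3 * Z\<^sup>2 \<le> envelope b (dev z)" .
    then have "A * (10003 / 10000 * (2 * Z ^ 4 - 4 / 3 * Z\<^sup>2)) \<le> A * (10003 / 10000 * envelope b (dev z))"
      using A_nonneg by (intro mult_left_mono) auto
    then show ?thesis using remainder_zero unfolding 1 Z_def by linarith
  next
    case 2
    define t where "t = - dev z"
    have t: "0 \<le> t" "t \<le> n * y - 1"
      using 2 n by (auto simp: t_def dev_def)
    have "1 / (n * y) \<le> 1" using Y by simp
    then have "t \<le> n * y - 1 / (n * y)" using t by linarith
    then have "(1 - b) * t \<le> a" unfolding a_def using b by (intro mult_left_mono) auto
    then have "t \<le> a + b * t" by (simp add: algebra_simps)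
    then have "t\<^sup>2 \<le> (a + b * t)\<^sup>2" using t by (intro power_mono) auto
    then have "t\<^sup>2 * t\<^sup>2 \<le> t\<^sup>2 * (a + b * t)\<^sup>2" by (intro mult_left_mono) auto
    moreover have "t\<^sup>2 * t\<^sup>2 = dev z ^ 4" unfolding t_def by algebra
    ultimately have "dev z ^ 4 \<le> (dev z)\<^sup>2 * (a - b * dev z)\<^sup>2" by (simp add: t_def)
    then have "2 * dev z ^ 4 \<le> envelope b (dev z)" using pos(3) unfolding env by linarith
    then have "A * (10003 / 10000 * (2 * dev z ^ 4)) \<le> A * (10003 / 10000 * envelope b (dev z))"
      using A_nonneg by (intro mult_left_mono) auto
    then show ?thesis using remainder_left[OF z(2) 2(2)] by linarith
  next
    case 3
    have "A * (10003 / 10000 * dev z ^ 4) \<le> A * (10003 / 10000 * envelope b (dev z))"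
      using A_nonneg pos unfolding env by (intro mult_left_mono) auto
    then show ?thesis using remainder_near[OF 3] by linarith
  next
    case 4
    have "A * (10 ^ 9 / n\<^sup>2 * dev z ^ 6) \<le> A * (10003 / 10000 * envelope b (dev z))"
      unfolding env by (intro mult_left_mono A_nonneg le_sum pos)
    then show ?thesis using remainder_far[OF 4 z(3)] by linarith
  qed
qed

end
context smoothed_bernstein
begin

theorem boundary_bound_param:
  assumes Y: "2 \<le> real n * y" "real n * y \<le> 10" and b: "1 / 3 \<le> b" "b \<le> 1"
  shows "weighted_d2 n f y
    \<le> real n * (boundary_total b (real n * y) * H)"
proof -
  define Z where "Z = real n * y"
  define a where "a = (1 - b) * (Z - 1 / Z)"
  \<comment> \<open>\<open>y \<le> e\<close> follows from \<open>n y \<le> 10\<close>; the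
    deviations of \<open>l\<close> and \<open>m\<close> from their limits \<open>Z - 1 / 3\<close>
    and \<open>Z\<close> are controlled by \<open>e\<close>.\<close>
  define e where "e = (1 / 10 ^ 9 :: real)"
  have Z: "2 \<le> Z" "Z \<le> 10" "0 < Z" using Y by (auto simp: Z_def)
  have n0: "0 < real n" using N by simp
  have n4: "4 \<le> n" using n_large by simp
  obtain g1 g3 where g: "\<And>t. (bern n v has_real_derivative g1 t) (at t)"
    "\<And>t. (g1 has_real_derivative bern_d2 n v t) (at t)"
    "\<And>t. (bern_d2 n v has_real_derivative g3 t) (at t)"
    "\<And>t. (g3 has_real_derivative bern_d4 n v t) (at t)"
    using bern_derivs4[of n v thesis] n4 by blast
  interpret q: quartic_control "real n" y H "bern n v" g1 "bern_d2 n v" g3 "bern_d4 n v"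
    using g N H_nonneg Y d4_bounds by unfold_locales auto
  have dev: "q.dev z = real n * z - Z" for z by (simp add: q.dev_def Z_def)
  have y: "0 < y" "y \<le> e" "y < 1" "y \<le> 1 / 2" "1 / real n \<le> y"
    using q.y Y n0 by (auto simp: e_def field_simps)
  obtain x where x: "y = x + (1 - 2 * x) / (3 * real n)" "0 < x" "x \<le> 1 / 2" "x \<le> y"
    using shifted_point[OF y(5,4)] by blast
  define l m where "l = real n * (x * (1 - x))" and "m = real n * (y * (1 - y))"
  have x1: "x < 1" using x by linarith
  have nx: "real n * x = Z - (1 - 2 * x) / 3" using x(1) n0 by (simp add: Z_def field_simps)
  have l: "(Z - 1 / 3) * (1 - e) \<le> l" "l \<le> Z - 1 / 3 + e"
  proof -
    have xe: "x \<le> e" using x(4) y(2) by linarith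
    have "Z - 1 / 3 \<le> real n * x" unfolding nx using x(2) by simp
    then have "(Z - 1 / 3) * (1 - e) \<le> (real n * x) * (1 - x)"
      using xe x(2) n0 by (intro mult_mono) (auto simp: e_def)
    then show "(Z - 1 / 3) * (1 - e) \<le> l" by (simp add: l_def mult.assoc)
    have "l \<le> real n * x" using x n0 by (simp add: l_def mult_left_le)
    also have "\<dots> \<le> Z - 1 / 3 + e" unfolding nx using x(2) xe by (simp add: diff_divide_distrib)
    finally show "l \<le> Z - 1 / 3 + e" .
  qed
  have m: "Z * (1 - e) \<le> m" "m \<le> Z"
  proof -
    have "Z * (1 - e) \<le> (real n * y) * (1 - y)"
      unfolding Z_def using y(1,2) n0 by (intro mult_left_mono) auto
    then show "Z * (1 - e) \<le> m" by (simp add: m_def mult.assoc)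
    show "m \<le> Z" using y n0 by (simp add: m_def Z_def mult_left_le)
  qed
  define S where "S = q.A * (10003 / 10000 * (boundary_bracket b Z + 3 / 100))"
  define R where "R k = q.A * (10003 / 10000 * q.envelope b (real k - real n * y))" for k :: nat
  define Rx where "Rx = q.A * (10003 / 10000 * (2 / 81))"
  have r: "taylor_error (bern n v) g1 (bern_d2 n v) g3 y (real k / real n) \<le> R k"
    if k: "k \<le> n" for k
  proof -
    have "taylor_error (bern n v) g1 (bern_d2 n v) g3 y (real k / real n)
      \<le> q.A * (10003 / 10000 * q.envelope b (q.dev (real k / real n)))"
      using node[OF k] n0 by (intro q.remainder_node b) auto
    then show ?thesis using n0 by (simp add: R_def q.dev_def)
  qed
  have rx: "taylor_error (bern n v) g1 (bern_d2 n v) g3 y x \<le> Rx"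
  proof -
    define p where "p = (1 - 2 * x) / 3"
    have p: "0 \<le> p" "p \<le> 1 / 3" using x by (auto simp: p_def)
    have dx: "q.dev x = - p" by (simp add: dev nx p_def)
    have "p ^ 4 \<le> (1 / 3) ^ 4" using p by (intro power_mono)
    then have "2 * q.dev x ^ 4 \<le> 2 / 81" by (simp add: dx power_divide)
    then have "q.A * (10003 / 10000 * (2 * q.dev x ^ 4)) \<le> Rx"
      unfolding Rx_def using q.A_nonneg by (intro mult_left_mono) auto
    then show ?thesis using q.remainder_left[of x] x by simp
  qed
  have S: "bern n R x + Rx \<le> S"
  proof -
    define t where "t k = real k - real n * y" for k :: nat
    define w where "w = 10 ^ 9 / (real n)\<^sup>2"
    have a0: "0 \<le> a" "a \<le> 10"
    proof -
      have "0 \<le> Z - 1 / Z" using Z by (simp add: field_simps) (use mult_mono[of 1 Z 1 Z] in simp)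
      then show "0 \<le> a" using b by (simp add: a_def)
      have "a \<le> 1 * Z" unfolding a_def using b Z \<open>0 \<le> Z - 1 / Z\<close> by (intro mult_mono) auto
      then show "a \<le> 10" using Z by simp
    qed
    have env: "q.envelope b s = ((1 + b\<^sup>2) * s ^ 4 + a\<^sup>2 * s\<^sup>2) - (2 * a * b) * s ^ 3 + w * s ^ 6" for s
    proof -
      have "q.envelope b s = s ^ 4 + s\<^sup>2 * (a - b * s)\<^sup>2 + w * s ^ 6"
        by (simp add: q.envelope_def a_def w_def Z_def)
      then show ?thesis by algebra
    qed
    have bR: "bern n R x = q.A * (10003 / 10000 * bern n (\<lambda>k. q.envelope b (t k)) x)"
      unfolding R_def[abs_def] t_def by (simp only: bern_cmult)
    have bE: "bern n (\<lambda>k. q.envelope b (t k)) x = ((1 + b\<^sup>2) * bern n (\<lambda>k. t k ^ 4) x + a\<^sup>2 * bern n (\<lambda>k. (t k)\<^sup>2) x)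
        - (2 * a * b) * bern n (\<lambda>k. t k ^ 3) x + w * bern n (\<lambda>k. t k ^ 6) x"
      unfolding env by (simp only: bern_add bern_diff bern_cmult)
    also have "\<dots> \<le> boundary_bracket b Z + 1 / 200"
    proof -
      have n2: "2 \<le> n" using n4 by simp
      note M = shift_moment_bounds[OF x(2,3) n2 x(1) l_def, folded t_def]
      define k where "k = Z - 1 / 3"
      have k: "0 \<le> k" "k \<le> 10" using Z by (auto simp: k_def)
      have l0: "0 \<le> l" using x by (simp add: l_def)
      have lk: "l \<le> k + e" using l by (simp add: k_def)
      have l11: "l \<le> 11" using lk k by (simp add: e_def)
      have l2: "l\<^sup>2 \<le> k\<^sup>2 + 21 * e"
      proof -
        have "l\<^sup>2 \<le> (k + e)\<^sup>2" using l0 lk by (intro power_mono)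
        also have "\<dots> = k\<^sup>2 + (2 * k + e) * e" by algebra
        also have "\<dots> \<le> k\<^sup>2 + 21 * e" using k by (intro add_left_mono mult_right_mono) (auto simp: e_def)
        finally show ?thesis .
      qed
      have l3: "l ^ 3 \<le> 11 ^ 3" using l0 l11 by (intro power_mono)
      have l2': "l\<^sup>2 \<le> 11\<^sup>2" using l0 l11 by (intro power_mono)
      have b2: "b\<^sup>2 \<le> 1" using b by (intro power_le_one) auto
      have a2: "a\<^sup>2 \<le> 10\<^sup>2" using a0 by (intro power_mono)
      have 1: "(1 + b\<^sup>2) * bern n (\<lambda>k. t k ^ 4) x \<le> (1 + b\<^sup>2) * (3 * k\<^sup>2 + 1 / 3 * k + 1 / 81) + 1 / 1000"
      proof -
        have "(1 + b\<^sup>2) * bern n (\<lambda>k. t k ^ 4) x \<le> (1 + b\<^sup>2) * ((3 * k\<^sup>2 + 1 / 3 * k + 1 / 81) + 64 * e)"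
          using M(3) l2 lk by (intro mult_left_mono) (auto simp: e_def)
        also have "\<dots> = (1 + b\<^sup>2) * (3 * k\<^sup>2 + 1 / 3 * k + 1 / 81) + (1 + b\<^sup>2) * (64 * e)" by (rule distrib_left)
        also have "(1 + b\<^sup>2) * (64 * e) \<le> 2 * (64 * e)" using b2 by (intro mult_right_mono) (auto simp: e_def)
        finally have "(1 + b\<^sup>2) * bern n (\<lambda>k. t k ^ 4) x
          \<le> (1 + b\<^sup>2) * (3 * k\<^sup>2 + 1 / 3 * k + 1 / 81) + 2 * (64 * e)" by simp
        moreover have "2 * (64 * e) \<le> 1 / 1000" by (simp add: e_def)
        ultimately show ?thesis by linarith
      qed
      have 2: "a\<^sup>2 * bern n (\<lambda>k. (t k)\<^sup>2) x \<le> a\<^sup>2 * (k + 1 / 9) + 1 / 1000"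
      proof -
        have "a\<^sup>2 * bern n (\<lambda>k. (t k)\<^sup>2) x \<le> a\<^sup>2 * ((k + 1 / 9) + e)"
          using M(1) lk by (intro mult_left_mono) auto
        also have "\<dots> = a\<^sup>2 * (k + 1 / 9) + a\<^sup>2 * e" by (rule distrib_left)
        also have "a\<^sup>2 * e \<le> 10\<^sup>2 * e" using a2 by (intro mult_right_mono) (auto simp: e_def)
        finally have "a\<^sup>2 * bern n (\<lambda>k. (t k)\<^sup>2) x \<le> a\<^sup>2 * (k + 1 / 9) + 10\<^sup>2 * e" by simp
        moreover have "10\<^sup>2 * e \<le> 1 / 1000" by (simp add: e_def)
        ultimately show ?thesis by linarith
      qed
      have 3: "- ((2 * a * b) * bern n (\<lambda>k. t k ^ 3) x) \<le> 2 * b * a / 27"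
      proof -
        have "(2 * a * b) * (- bern n (\<lambda>k. t k ^ 3) x) \<le> (2 * a * b) * (1 / 27)"
          using M(2) a0 b by (intro mult_left_mono) auto
        also have "\<dots> = 2 * b * a / 27" by simp
        finally show ?thesis by (simp only: mult_minus_right)
      qed
      have 4: "w * bern n (\<lambda>k. t k ^ 6) x \<le> 1 / 1000"
      proof -
        have "(10 ^ 10)\<^sup>2 \<le> (real n)\<^sup>2" using N by (intro power_mono) auto
        then have "w \<le> 10 ^ 9 / (10 ^ 10)\<^sup>2" unfolding w_def using n0
            by (intro divide_left_mono mult_pos_pos zero_less_power) auto
        moreover have "bern n (\<lambda>k. t k ^ 6) x \<le> 10 ^ 5" using M(4) l2' l3 l11 by simp
        moreover have "0 \<le> bern n (\<lambda>k. t k ^ 6) x" using x x1 by (intro bern_nonneg) auto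
        ultimately have "w * bern n (\<lambda>k. t k ^ 6) x \<le> 10 ^ 9 / (10 ^ 10)\<^sup>2 * 10 ^ 5"
          by (intro mult_mono) auto
        then show ?thesis by simp
      qed
      have "boundary_bracket b Z = (1 + b\<^sup>2) * (3 * k\<^sup>2 + 1 / 3 * k + 1 / 81) + a\<^sup>2 * (k + 1 / 9) + 2 * b * a / 27"
        by (simp only: boundary_bracket_def k_def a_def)
      moreover have "p4 + p2 - p3 + p6 \<le> q4 + q2 + q3 + 1 / 200"
        if "p4 \<le> q4 + 1 / 1000" "p2 \<le> q2 + 1 / 1000" "- p3 \<le> q3" "p6 \<le> 1 / 1000"
        for p2 p3 p4 p6 q2 q3 q4 :: real using that by linarith
      note this[OF 1 2 3 4]
      ultimately show ?thesis by simp
    qed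
    finally have "bern n R x \<le> q.A * (10003 / 10000 * (boundary_bracket b Z + 1 / 200))"
      unfolding bR by (intro mult_left_mono q.A_nonneg) simp_all
    then have "bern n R x + Rx \<le> q.A * (10003 / 10000 * (boundary_bracket b Z + 1 / 200) + 10003 / 10000 * (2 / 81))"
      by (simp only: Rx_def distrib_left)
    also have "\<dots> \<le> S"
    proof -
      have "10003 / 10000 * (s + 1 / 200) + 10003 / 10000 * (2 / 81) \<le> 10003 / 10000 * (s + 3 / 100)" for s :: real
        by (simp add: field_simps)
      then show ?thesis unfolding S_def by (intro mult_left_mono q.A_nonneg)
    qed
    finally show ?thesis .
  qed
  have br: "0 \<le> boundary_bracket b Z"
  proof -
    have "1 / Z \<le> Z" using Z by (simp add: field_simps) (use mult_mono[of 1 Z 1 Z] in simp)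
    then show ?thesis unfolding boundary_bracket_def using Z b
      by (intro add_nonneg_nonneg mult_nonneg_nonneg divide_nonneg_nonneg) auto
  qed
  have l0: "0 < l" and m0: "0 < m" using x(2) x1 y(1,3) n0 by (simp_all add: l_def m_def)
  have "weighted_d2 n f y
    \<le> real n * (sqrt 2 * (1 + 3 / 5 / m) * D + 2 * (m + 3 / 5) / l * (D + S))"
    by (rule combined_bound[OF x(2) x1 y(1,3) x(1) g(1,3) r rx S l_def m_def])
  also have "\<dots> \<le> real n * (boundary_total b Z * H)"
  proof (rule mult_left_mono)
    define c where "c = (70711 / 50000 :: real)"
    define P where "P = c / (24 * Z\<^sup>2) * (boundary_bracket b Z + 3 / 100)"
    have P: "0 \<le> P" using br Z by (simp add: P_def c_def)
    have e2: "1 / (1 - e) \<le> 10001 / 10000" "0 < 1 - e" by (auto simp: e_def)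
    have "1 / m \<le> 1 / (Z * (1 - e))" using m Z e2 m0 by (intro divide_left_mono mult_pos_pos) auto
    also have "\<dots> = 1 / Z * (1 / (1 - e))" by simp
    also have "\<dots> \<le> 1 / Z * (10001 / 10000)" using e2 Z by (intro mult_left_mono) auto
    finally have im: "1 / m \<le> 1 / Z * (10001 / 10000)" .
    have "1 / l \<le> 1 / ((Z - 1 / 3) * (1 - e))" using l Z e2 l0 by (intro divide_left_mono mult_pos_pos) auto
    also have "\<dots> = 1 / (Z - 1 / 3) * (1 / (1 - e))" by simp
    also have "\<dots> \<le> 1 / (Z - 1 / 3) * (10001 / 10000)" using e2 Z by (intro mult_left_mono) auto
    finally have il: "1 / l \<le> 1 / (Z - 1 / 3) * (10001 / 10000)" .
    have i1: "1 + 3 / 5 / m \<le> 2001 / 2000 * (1 + 3 / 5 / Z)"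
    proof -
      have "1 + 3 / 5 * (1 / m) \<le> 10001 / 10000 * (1 + 3 / 5 * (1 / Z))" using im by simp
      also have "\<dots> \<le> 2001 / 2000 * (1 + 3 / 5 * (1 / Z))" using Z by (intro mult_right_mono) auto
      finally show ?thesis by simp
    qed
    have i2: "2 * (m + 3 / 5) / l \<le> 10001 / 10000 * (2 * (Z + 3 / 5) / (Z - 1 / 3))"
    proof -
      have "2 * (m + 3 / 5) * (1 / l) \<le> 2 * (Z + 3 / 5) * (1 / (Z - 1 / 3) * (10001 / 10000))"
        using m m0 l0 Z il by (intro mult_mono) auto
      moreover have "p * (1 / r * s) = s * (p / r)" "p * (1 / r) = p / r" for p r s :: real by simp_all
      ultimately show ?thesis by (simp only:)
    qed
    have i3: "D + S \<le> 10003 / 10000 * (H * (1 / ratio + P))"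
    proof -
      have "q.A \<le> H * (c / (24 * Z\<^sup>2))"
      proof -
        have "sqrt 2 * H \<le> c * H" using sqrt2_le H_nonneg by (intro mult_right_mono) (auto simp: c_def)
        then have "sqrt 2 * H / (24 * Z\<^sup>2) \<le> c * H / (24 * Z\<^sup>2)" by (intro divide_right_mono) auto
        then show ?thesis by (simp add: q.A_def Z_def mult.commute)
      qed
      then have "S \<le> H * (c / (24 * Z\<^sup>2)) * (10003 / 10000 * (boundary_bracket b Z + 3 / 100))"
        unfolding S_def using br by (intro mult_right_mono) auto
      also have "\<dots> = 10003 / 10000 * (H * P)" by (simp add: P_def)
      finally have "S \<le> 10003 / 10000 * (H * P)" .
      moreover have "D \<le> 10003 / 10000 * (H * (1 / ratio))"
        using D_le' D_nonneg H_nonneg by (simp add: ratio_def)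
      ultimately show ?thesis by (simp only: distrib_left)
    qed
    have j1: "sqrt 2 * (1 + 3 / 5 / m) * D \<le> c * (2001 / 2000 * (1 + 3 / 5 / Z)) * (H / ratio)"
      using sqrt2_le i1 D_le' D_nonneg m0 Z by (intro mult_mono) (auto simp: c_def)
    have j2: "2 * (m + 3 / 5) / l * (D + S)
       \<le> (10001 / 10000 * (2 * (Z + 3 / 5) / (Z - 1 / 3))) * (10003 / 10000 * (H * (1 / ratio + P)))"
      using i2 i3 D_nonneg Z br q.A_nonneg m0 l0 by (intro mult_mono add_nonneg_nonneg) (auto simp: S_def)
    have "(10001 / 10000 * (2 * (Z + 3 / 5) / (Z - 1 / 3))) * (10003 / 10000 * (H * (1 / ratio + P)))
      = (10001 / 10000 * (10003 / 10000)) * (2 * (Z + 3 / 5) / (Z - 1 / 3) * (H * (1 / ratio + P)))"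
      by (simp only: ac_simps)
    also have "\<dots> \<le> 2001 / 2000 * (2 * (Z + 3 / 5) / (Z - 1 / 3) * (H * (1 / ratio + P)))"
      using Z H_nonneg P by (intro mult_right_mono mult_nonneg_nonneg) (auto simp: ratio_def)
    finally have j3: "(10001 / 10000 * (2 * (Z + 3 / 5) / (Z - 1 / 3))) * (10003 / 10000 * (H * (1 / ratio + P)))
      \<le> 2001 / 2000 * (2 * (Z + 3 / 5) / (Z - 1 / 3) * (H * (1 / ratio + P)))" .
    have gen: "c * (2001 / 2000 * s) * (h / r) + 2001 / 2000 * (k * (h * p)) = 2001 / 2000 * (c * s / r + k * p) * h"
      for s h r k p :: real by (simp add: algebra_simps)
    have bt: "boundary_total b Z = 2001 / 2000 * (c * (1 + 3 / 5 / Z) / ratio + 2 * (Z + 3 / 5) / (Z - 1 / 3) * (1 / ratio + P))"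
      by (simp only: boundary_total_def c_def P_def)
    show "sqrt 2 * (1 + 3 / 5 / m) * D + 2 * (m + 3 / 5) / l * (D + S) \<le> boundary_total b Z * H"
      unfolding bt gen[symmetric] using j1 j2 j3 by linarith
  qed (use n0 in auto)
  finally show ?thesis by (simp only: Z_def)
qed

theorem boundary_bound:
  assumes Y: "2 \<le> real n * y" "real n * y \<le> 10"
  shows "weighted_d2 n f y \<le> 1999 / 2000 * (real n * H)"
proof -
  \<comment> \<open>\<open>b\<close> increases with \<open>n y\<close>: the term with
    \<open>(1 - b)\<^sup>2\<close> is of third order in \<open>n y\<close>, the one with
    \<open>1 + b\<^sup>2\<close> only of second order.\<close>
  obtain b where b: "1 / 3 \<le> b" "b \<le> 1" "0 \<le> boundary_poly b (real n * y)"
  proof -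
    consider "real n * y \<le> 7 / 2" | "7 / 2 \<le> real n * y" "real n * y \<le> 6" | "6 \<le> real n * y" by linarith
    then show thesis
    proof cases
      case 1 show thesis by (rule that[of "2 / 5"]) (use boundary_poly_nonneg1 1 Y in auto)
    next
      case 2 show thesis by (rule that[of "3 / 5"]) (use boundary_poly_nonneg2 2 in auto)
    next
      case 3 show thesis by (rule that[of "7 / 10"]) (use boundary_poly_nonneg3 3 Y in auto)
    qed
  qed
  have "real n * (boundary_total b (real n * y) * H) \<le> real n * (1999 / 2000 * H)"
    using boundary_total_le[OF Y(1) b(3)] H_nonneg by (intro mult_left_mono mult_right_mono) auto
  then show ?thesis using boundary_bound_param[OF Y b(1,2)] by simp
qed

end

section \<open>The range \<open>n y \<le> 2\<close>: comparison with the Poisson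
  distribution\<close>

lemma bern_point:
  assumes "j \<le> m"
  shows "bern m (\<lambda>k. if k = j then c else 0) y = c * Bernstein m j y"
proof -
  have "bern m (\<lambda>k. if k = j then c else 0) y = (\<Sum>k\<le>m. if k = j then c * Bernstein m j y else 0)"
    unfolding bern_def by (intro sum.cong) auto
  also have "\<dots> = c * Bernstein m j y" using assms by simp
  finally show ?thesis .
qed

text \<open>\<open>m choose k\<close> is at most \<open>n ^ k / fact k\<close>, and
  \<open>1 - y\<close> at most \<open>exp (- y)\<close>. Since \<open>m - k \<ge> n - 5\<close>, the
  exponent misses \<open>n y\<close> by at most \<open>5 y\<close>, which is negligible for such
  \<open>n\<close>.\<close>

lemma Bernstein_le_Poisson:
  fixes y :: real
  assumes n: "10 ^ 10 \<le> n" and m: "m \<le> n" "n \<le> m + 2" and k: "k \<le> 3" and y: "0 \<le> y" "real n * y \<le> 2"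
  shows "Bernstein m k y \<le> 10001 / 10000 * (exp (- (real n * y)) * ((real n * y) ^ k / fact k))"
proof -
  define Y where "Y = real n * y"
  have nn: "10 ^ 10 \<le> real n" using n by (metis of_nat_le_iff of_nat_numeral of_nat_power)
  have Y: "0 \<le> Y" using y by (simp add: Y_def)
  have "10 ^ 10 * y \<le> real n * y" using nn y by (intro mult_right_mono) auto
  then have ys: "y \<le> 2 / 10 ^ 10" using y by simp
  have y1: "y \<le> 1" using ys by simp
  have km: "k \<le> m" using n m k by simp
  have "real (m choose k) * fact k \<le> real m ^ k"
    using binomial_fact_pow[of m k] by (metis of_nat_fact of_nat_le_iff of_nat_mult of_nat_power)
  also have "\<dots> \<le> real n ^ k" using m by (intro power_mono) auto
  finally have "real (m choose k) \<le> real n ^ k / fact k" by (simp add: pos_le_divide_eq)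
  then have "real (m choose k) * y ^ k \<le> real n ^ k / fact k * y ^ k" using y by (intro mult_right_mono) auto
  also have "\<dots> = Y ^ k / fact k" by (simp add: Y_def power_mult_distrib)
  finally have c: "real (m choose k) * y ^ k \<le> Y ^ k / fact k" .
  have e: "(1 - y) ^ (m - k) \<le> 10001 / 10000 * exp (- Y)"
  proof -
    have "(1 - y) ^ (m - k) \<le> exp (- y) ^ (m - k)"
      using y1 exp_ge_add_one_self[of "- y"] by (intro power_mono) auto
    also have "\<dots> = exp (real (m - k) * (- y))" by (simp only: exp_of_nat_mult)
    also have "\<dots> \<le> exp (5 * y + - Y)"
    proof -
      have "real n - 5 \<le> real (m - k)" using m k n by linarith
      then have "(real n - 5) * y \<le> real (m - k) * y" using y by (intro mult_right_mono) auto
      then show ?thesis by (simp add: Y_def left_diff_distrib)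
    qed
    also have "\<dots> = exp (5 * y) * exp (- Y)" by (rule exp_add)
    also have "\<dots> \<le> 10001 / 10000 * exp (- Y)"
    proof (rule mult_right_mono)
      have z: "0 \<le> 5 * y" "5 * y \<le> 1 / 100000" using y ys by auto
      have "(5 * y)\<^sup>2 \<le> (1 / 100000)\<^sup>2" using z by (intro power_mono) auto
      moreover have "exp (5 * y) \<le> 1 + 5 * y + (5 * y)\<^sup>2" using z by (intro exp_bound) auto
      ultimately show "exp (5 * y) \<le> 10001 / 10000" using z by (simp add: power2_eq_square)
    qed simp
    finally show ?thesis .
  qed
  have "Bernstein m k y \<le> (Y ^ k / fact k) * (10001 / 10000 * exp (- Y))"
    unfolding Bernstein_def using c e y y1 Y by (intro mult_mono) auto
  also have "\<dots> = 10001 / 10000 * (exp (- Y) * (Y ^ k / fact k))" by (simp only: ac_simps)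
  finally show ?thesis by (simp only: Y_def)
qed

lemma Lw_le:
  assumes "Lw c \<le> r" "1 < c" "c \<le> c'"
  shows "Lw c' \<le> r"
  using Lw_antimono[OF assms(2,3)] assms(1) by linarith

text \<open>The arguments are \<open>j + 3 / 5 - 1 / 10000\<close> for \<open>j\<close> from 1 to 5,
  just below \<open>j (n - j) / n + 3 / 5\<close>.\<close>

lemma Lw_values:
  "Lw (15999 / 10000) \<le> 692 / 1000" "Lw (25999 / 10000) \<le> 396 / 1000" "Lw (35999 / 10000) \<le> 282 / 1000"
  "Lw (45999 / 10000) \<le> 220 / 1000" "Lw (55999 / 10000) \<le> 180 / 1000"
  by (simp_all add: Lw_def power2_eq_square)

text \<open>The excess of the first four bounds in \<open>Lw_values\<close> over the fifth, 180 /
  1000.\<close>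

definition node_head :: "nat \<Rightarrow> real" where
  "node_head k = (if k = 0 then 64 / 125 else 0) + (if k = 1 then 27 / 125 else 0)
     + (if k = 2 then 51 / 500 else 0) + (if k = 3 then 1 / 25 else 0)"

text \<open>With \<open>Y = n x\<close>, the first group is the Charlier polynomial
  \<open>k (k - 1) - 2 k Y + Y\<^sup>2\<close>, the Poisson limit; the rest carries the small factor
  \<open>x\<close>.\<close>

lemma krav_alt: "krav n x k = (real k * (real k - 1) - 2 * real k * (real n * x) + (real n * x)\<^sup>2) + x * (2 * real k - real n * x)"
  unfolding krav_def by algebra

text \<open>For \<open>Y \<le> 2\<close> the Charlier polynomial can be negative only at 1, 2 and 3.
  The correction is nonnegative for \<open>k \<ge> 4\<close>, and at \<open>k = 0\<close> it is
  dominated by \<open>Y\<^sup>2\<close> because \<open>x \<le> Y\<close>.\<close>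

lemma krav_nonneg:
  assumes x: "0 \<le> x" "real n * x \<le> 2" and n: "1 \<le> n" and k: "k = 0 \<or> 4 \<le> k"
  shows "0 \<le> krav n x k"
proof -
  define Y where "Y = real n * x"
  have "1 * x \<le> real n * x" using n x by (intro mult_right_mono) auto
  then have xY: "x \<le> Y" by (simp add: Y_def)
  have Y: "0 \<le> Y" "Y \<le> 2" using x xY by (auto simp: Y_def)
  show ?thesis
  proof (cases "k = 0")
    case True
    have "0 \<le> Y * (Y - x)" using Y xY by simp
    moreover have "krav n x k = Y * (Y - x)"
      unfolding krav_alt Y_def[symmetric] by (simp add: True power2_eq_square algebra_simps)
    ultimately show ?thesis by simp
  next
    case False
    then have k: "4 \<le> real k" using k by simp
    have "0 \<le> (real k - 1) * (real k - 4) + (2 - Y) * (2 * real k - 2 - Y)"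
      using k Y by (intro add_nonneg_nonneg mult_nonneg_nonneg) auto
    also have "\<dots> = real k * (real k - 1) - 2 * real k * Y + Y\<^sup>2" by algebra
    finally have "0 \<le> real k * (real k - 1) - 2 * real k * Y + Y\<^sup>2" .
    moreover have "0 \<le> x * (2 * real k - Y)" using x k Y by (intro mult_nonneg_nonneg) auto
    ultimately show ?thesis by (simp add: krav_alt Y_def[symmetric])
  qed
qed

context smoothed_bernstein
begin

text \<open>In the right half, where \<open>Lw\<close> grows again, the linear term
  \<open>2 (k + 1) / n\<close> is at least 1 and suffices. Its mean is of order \<open>1 / n\<close>
  when \<open>n y\<close> is bounded.\<close>

lemma diff2_v_head:
  assumes k: "k \<le> n - 2"
  shows "\<bar>diff2 v k\<bar> \<le> H * (9 / 50 + 2 / real n * real (k + 1) + node_head k)"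
proof -
  define j where "j = real (k + 1)"
  define p where "p = j * (real n - j) / real n"
  have "2 \<le> n" using n_large by simp
  then have "k + 2 \<le> n" using k by simp
  then have j: "1 \<le> j" "j \<le> real n - 1" unfolding j_def by linarith+
  have n0: "0 < real n" using N by simp
  have pj: "p = j - j\<^sup>2 / real n" using n0 by (simp add: p_def field_simps power2_eq_square)
  have small: "i - 1 / 10000 \<le> p" if "j = i" "i\<^sup>2 \<le> 100" for i
  proof -
    have "i\<^sup>2 / real n \<le> 100 / 10 ^ 10" using that N by (intro frac_le) auto
    also have "\<dots> \<le> 1 / 10000" by simp
    finally show ?thesis using that by (simp add: pj)
  qed
  have "Lw (p + 3 / 5) \<le> 9 / 50 + 2 / real n * j + node_head k"
  proof -
    have r: "0 \<le> 2 / real n * j" using j n0 by simp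
    consider "k = 0" | "k = 1" | "k = 2" | "k = 3" | "4 \<le> k" "2 * j \<le> real n" | "4 \<le> k" "real n \<le> 2 * j" by linarith
    then show ?thesis
    proof cases
      case 1
      have "Lw (p + 3 / 5) \<le> 692 / 1000"
        by (rule Lw_le[OF Lw_values(1)]) (use small[of 1] in \<open>auto simp: j_def 1\<close>)
      then show ?thesis using r by (simp add: node_head_def 1)
    next
      case 2
      have "Lw (p + 3 / 5) \<le> 396 / 1000"
        by (rule Lw_le[OF Lw_values(2)]) (use small[of 2] in \<open>auto simp: j_def 2\<close>)
      then show ?thesis using r by (simp add: node_head_def 2)
    next
      case 3
      have "Lw (p + 3 / 5) \<le> 282 / 1000"
        by (rule Lw_le[OF Lw_values(3)]) (use small[of 3] in \<open>auto simp: j_def 3\<close>)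
      then show ?thesis using r by (simp add: node_head_def 3)
    next
      case 4
      have "Lw (p + 3 / 5) \<le> 220 / 1000"
        by (rule Lw_le[OF Lw_values(4)]) (use small[of 4] in \<open>auto simp: j_def 4\<close>)
      then show ?thesis using r by (simp add: node_head_def 4)
    next
      case 5
      have j5: "5 \<le> j" using 5 by (simp add: j_def)
      have "0 \<le> (j - 5) * (real n - 5 - j)" using 5 j5 N by (intro mult_nonneg_nonneg) auto
      also have "\<dots> = j * (real n - j) - (5 * real n - 25)" by algebra
      finally have "(5 * real n - 25) / real n \<le> p" unfolding p_def using n0 by (intro divide_right_mono) auto
      moreover have "49999 / 10000 \<le> (5 * real n - 25) / real n" using N by (simp add: field_simps)
      ultimately have "55999 / 10000 \<le> p + 3 / 5" by linarith
      then have "Lw (p + 3 / 5) \<le> 180 / 1000" by (intro Lw_le[OF Lw_values(5)]) auto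
      then show ?thesis using r 5 by (simp add: node_head_def)
    next
      case 6
      have "0 \<le> (j - 1) * (real n - 1 - j)" using j by (intro mult_nonneg_nonneg) auto
      also have "\<dots> = j * (real n - j) - (real n - 1)" by algebra
      finally have "(real n - 1) / real n \<le> p" unfolding p_def using n0 by (intro divide_right_mono) auto
      moreover have "9999 / 10000 \<le> (real n - 1) / real n" using N by (simp add: field_simps)
      ultimately have "15999 / 10000 \<le> p + 3 / 5" by linarith
      then have "Lw (p + 3 / 5) \<le> 692 / 1000" by (intro Lw_le[OF Lw_values(1)]) auto
      moreover have "1 \<le> 2 / real n * j" using 6 n0 by (simp add: field_simps)
      ultimately show ?thesis using 6 by (simp add: node_head_def)
    qed
  qed
  then have "H * Lw (p + 3 / 5) \<le> H * (9 / 50 + 2 / real n * j + node_head k)"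
    using H_nonneg by (rule mult_left_mono)
  then show ?thesis using diff2_v[OF k] by (simp add: p_def j_def)
qed

lemma bern_d2_v_crude:
  assumes y: "0 \<le> y" "real n * y \<le> 2"
  shows "\<bar>bern_d2 n v y\<bar> \<le> (real n)\<^sup>2 * (H * (2001 / 2000 * (9 / 50 + exp (- (real n * y)) * crude_nodes (real n * y))))"
proof -
  define Y where "Y = real n * y"
  define m where "m = n - 2"
  define E where "E = exp (- Y)"
  have n0: "0 < real n" using N by simp
  have m: "m \<le> n" "n \<le> m + 2" "3 \<le> m" using n_large by (auto simp: m_def)
  have Y: "0 \<le> Y" "Y \<le> 2" using y by (auto simp: Y_def)
  have "10 ^ 10 * y \<le> real n * y" using N y by (intro mult_right_mono) auto
  then have y1: "y \<le> 1" using y by simp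
  have P: "Bernstein m k y \<le> 10001 / 10000 * (E * (Y ^ k / fact k))" if "k \<le> 3" for k
    using Bernstein_le_Poisson[OF n_large m(1,2) that y] by (simp add: E_def Y_def)
  have head: "bern m node_head y \<le> 10001 / 10000 * (E * crude_nodes Y)"
  proof -
    have "bern m node_head y = 64 / 125 * Bernstein m 0 y + 27 / 125 * Bernstein m 1 y
        + 51 / 500 * Bernstein m 2 y + 1 / 25 * Bernstein m 3 y"
      unfolding node_head_def[abs_def] using m(3) by (simp only: bern_add bern_point)
    also have "\<dots> \<le> 64 / 125 * (10001 / 10000 * (E * (Y ^ 0 / fact 0))) + 27 / 125 * (10001 / 10000 * (E * (Y ^ 1 / fact 1)))
        + 51 / 500 * (10001 / 10000 * (E * (Y ^ 2 / fact 2))) + 1 / 25 * (10001 / 10000 * (E * (Y ^ 3 / fact 3)))"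
      by (intro add_mono mult_left_mono P) auto
    also have "\<dots> = 10001 / 10000 * (E * crude_nodes Y)"
      by (simp add: crude_nodes_def fact_numeral algebra_simps)
    finally show ?thesis .
  qed
  have "\<bar>bern m (diff2 v) y\<bar> \<le> bern m (\<lambda>k. \<bar>diff2 v k\<bar>) y" using y y1 by (intro bern_abs_le)
  also have "\<dots> \<le> bern m (\<lambda>k. H * (9 / 50 + 2 / real n * real (k + 1) + node_head k)) y"
    using y y1 diff2_v_head by (intro bern_mono) (auto simp: m_def)
  also have "\<dots> = H * (9 / 50 + 2 / real n * (real m * y + 1) + bern m node_head y)"
  proof -
    have "bern m (\<lambda>k. real (k + 1)) y = real m * y + 1"
      unfolding of_nat_add by (simp add: bern_add bern_const bern_id)
    then show ?thesis by (simp only: bern_add bern_cmult bern_const)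
  qed
  also have "\<dots> \<le> H * (2001 / 2000 * (9 / 50 + E * crude_nodes Y))"
  proof (rule mult_left_mono[OF _ H_nonneg])
    have "real m * y \<le> Y" unfolding Y_def using m y by (intro mult_right_mono) auto
    then have "2 / real n * (real m * y + 1) \<le> 2 / 10 ^ 10 * 3" using N n0 Y y by (intro mult_mono divide_left_mono) auto
    moreover have "2 / 10 ^ 10 * 3 \<le> 2001 / 2000 * (9 / 50) - (9 / 50 :: real)" by simp
    ultimately have "9 / 50 + 2 / real n * (real m * y + 1) \<le> 2001 / 2000 * (9 / 50)" by linarith
    moreover have "10001 / 10000 * (E * crude_nodes Y) \<le> 2001 / 2000 * (E * crude_nodes Y)"
      using Y by (intro mult_right_mono mult_nonneg_nonneg) (auto simp: E_def crude_nodes_def)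
    ultimately show "9 / 50 + 2 / real n * (real m * y + 1) + bern m node_head y \<le> 2001 / 2000 * (9 / 50 + E * crude_nodes Y)"
      using head by (simp only: distrib_left)
  qed
  finally have b: "\<bar>bern m (diff2 v) y\<bar> \<le> H * (2001 / 2000 * (9 / 50 + E * crude_nodes Y))" .
  have "\<bar>bern_d2 n v y\<bar> = (real n * real (n - 1)) * \<bar>bern m (diff2 v) y\<bar>"
    by (simp add: bern_d2_def m_def abs_mult)
  also have "\<dots> \<le> (real n)\<^sup>2 * (H * (2001 / 2000 * (9 / 50 + E * crude_nodes Y)))"
    unfolding power2_eq_square by (intro mult_mono b) auto
  finally show ?thesis by (simp only: E_def Y_def)
qed

text \<open>For data bounded by \<open>D\<close> the mean absolute value of the Krawtchouk
  polynomial is decisive. As its mean is zero, this is twice the mean of its negative part, which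
  lives on the nodes 1, 2 and 3 only.\<close>

lemma bern_d2_u_Poisson:
  assumes y: "13 / 10 \<le> real n * y" "real n * y \<le> 2"
  shows "\<bar>bern_d2 n u y\<bar> \<le> (real n)\<^sup>2 * (2001 / 2000 * (exp (- (real n * y)) * (2 * (1 + (real n * y) ^ 2 / 2 - (real n * y) ^ 3 / 6))) * D)"
proof -
  define Y where "Y = real n * y"
  define E where "E = exp (- Y)"
  define Q where "Q k = 2 * real k * Y - Y\<^sup>2 - real k * (real k - 1)" for k
  define neg where "neg k = (if k = 1 then Q 1 else 0) + (if k = 2 then Q 2 else 0) + (if k = 3 then Q 3 else 0)" for k :: nat
  have n0: "0 < real n" using N by simp
  have n2: "2 \<le> n" "3 \<le> n" "1 \<le> n" using n_large by auto
  have Y: "13 / 10 \<le> Y" "Y \<le> 2" using y by (auto simp: Y_def)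
  have "0 < real n * y" using y by linarith
  then have y0: "0 < y" using n0 by (simp add: zero_less_mult_iff)
  have "10 ^ 10 * y \<le> real n * y" using N y0 by (intro mult_right_mono) auto
  then have ys: "y \<le> 2 / 10 ^ 10" using y by simp
  have y1: "y < 1" using ys by simp
  \<comment> \<open>\<open>Q k\<close> is minus the Charlier polynomial. \<open>Q 3 \<ge> 0\<close>
    requires \<open>Y \<ge> 3 - sqrt 3\<close>, about 1.268, hence the threshold 13 / 10;
    \<open>Q 1 \<ge> 0\<close> requires \<open>Y \<le> 2\<close>.\<close>
  have Q: "0 \<le> Q 1" "0 \<le> Q 2" "0 \<le> Q 3"
  proof -
    have YY: "Y\<^sup>2 \<le> 2 * Y" using Y by (simp add: power2_eq_square)
    have "0 \<le> (Y - 13 / 10) * (2 - Y)" using Y by simp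
    also have "\<dots> = 33 / 10 * Y - 26 / 10 - Y\<^sup>2" by (simp add: power2_eq_square field_simps)
    finally have "Y\<^sup>2 \<le> 33 / 10 * Y - 26 / 10" by simp
    then show "0 \<le> Q 1" "0 \<le> Q 2" "0 \<le> Q 3" using YY Y by (simp_all add: Q_def)
  qed
  have kr: "\<bar>krav n y k\<bar> \<le> krav n y k + 2 * neg k" if "k \<le> n" for k
  proof (cases "k = 0 \<or> 4 \<le> k")
    case True
    then have "0 \<le> krav n y k" using y0 y n2 by (intro krav_nonneg) auto
    moreover have "neg k = 0" using True by (auto simp: neg_def)
    ultimately show ?thesis by simp
  next
    case False
    then have k: "k = 1 \<or> k = 2 \<or> k = 3" by linarith
    then have nk: "neg k = Q k" "0 \<le> Q k" using Q by (auto simp: neg_def)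
    have "0 \<le> y * (2 * real k - Y)" using y0 k Y by (intro mult_nonneg_nonneg) auto
    then have "- Q k \<le> krav n y k" by (simp add: krav_alt Q_def Y_def[symmetric])
    then show ?thesis using nk by linarith
  qed
  have P: "Bernstein n k y \<le> 10001 / 10000 * (E * (Y ^ k / fact k))" if "k \<le> 3" for k
    using Bernstein_le_Poisson[OF n_large _ _ that, of n y] y y0 by (simp add: E_def Y_def)
  have negb: "bern n neg y \<le> 10001 / 10000 * (E * (Y\<^sup>2 * (1 + Y ^ 2 / 2 - Y ^ 3 / 6)))"
  proof -
    have "bern n neg y = Q 1 * Bernstein n 1 y + Q 2 * Bernstein n 2 y + Q 3 * Bernstein n 3 y"
      unfolding neg_def[abs_def] using n2 by (simp only: bern_add bern_point)
    also have "\<dots> \<le> Q 1 * (10001 / 10000 * (E * (Y ^ 1 / fact 1))) + Q 2 * (10001 / 10000 * (E * (Y ^ 2 / fact 2)))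
        + Q 3 * (10001 / 10000 * (E * (Y ^ 3 / fact 3)))"
      using Q by (intro add_mono mult_left_mono P) auto
    also have "\<dots> = 10001 / 10000 * (E * (Q 1 * Y + Q 2 * (Y\<^sup>2 / 2) + Q 3 * (Y ^ 3 / 6)))"
      by (simp add: fact_numeral algebra_simps)
    also have "Q 1 * Y + Q 2 * (Y\<^sup>2 / 2) + Q 3 * (Y ^ 3 / 6) = Y\<^sup>2 * (1 + Y ^ 2 / 2 - Y ^ 3 / 6)"
      by (simp add: Q_def eval_nat_numeral field_simps)
    finally show ?thesis .
  qed
  define G where "G = 1 + Y ^ 2 / 2 - Y ^ 3 / 6"
  have G: "0 \<le> G"
  proof -
    have "Y ^ 3 \<le> 2 ^ 3" using Y by (intro power_mono) auto
    moreover have "1 \<le> Y\<^sup>2" using Y by simp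
    ultimately show ?thesis by (simp add: G_def)
  qed
  have "\<bar>bern_d2 n u y * (y * (1 - y))\<^sup>2\<bar> \<le> bern n (\<lambda>k. \<bar>krav n y k * u k\<bar>) y"
    unfolding bern_d2_krav[OF y0 y1 n2(1)] using y0 y1 by (intro bern_abs_le) auto
  also have "\<dots> \<le> bern n (\<lambda>k. D * (krav n y k + 2 * neg k)) y"
  proof (rule bern_mono)
    fix k assume k: "k \<le> n"
    have "\<bar>krav n y k\<bar> * \<bar>u k\<bar> \<le> (krav n y k + 2 * neg k) * D" using kr[OF k] u_le[OF k] by (intro mult_mono) auto
    then show "\<bar>krav n y k * u k\<bar> \<le> D * (krav n y k + 2 * neg k)" by (simp add: abs_mult mult.commute)
  qed (use y0 y1 in auto)
  also have "\<dots> = D * (2 * bern n neg y)" by (simp add: bern_cmult bern_add bern_krav[OF y0 y1])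
  also have "\<dots> \<le> D * (2 * (10001 / 10000 * (E * (Y\<^sup>2 * G))))"
    using negb D_nonneg by (intro mult_left_mono) (auto simp: G_def)
  finally have "\<bar>bern_d2 n u y\<bar> * (y * (1 - y))\<^sup>2 \<le> D * (2 * (10001 / 10000 * (E * (Y\<^sup>2 * G))))"
    by (simp add: abs_mult)
  then have "\<bar>bern_d2 n u y\<bar> \<le> D * (2 * (10001 / 10000 * (E * (Y\<^sup>2 * G)))) / (y * (1 - y))\<^sup>2"
    using y0 y1 by (subst pos_le_divide_eq) auto
  also have "\<dots> = (D * ((real n)\<^sup>2 * (10001 / 10000 * (E * (2 * G))))) * (1 / (1 - y)\<^sup>2)"
    using y0 by (simp add: Y_def power_mult_distrib)
  also have "\<dots> \<le> (D * ((real n)\<^sup>2 * (10001 / 10000 * (E * (2 * G))))) * (10003 / 10000)"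
    using D_nonneg G y0 ys by (intro mult_left_mono inverse_square_near_one mult_nonneg_nonneg) (auto simp: E_def)
  also have "\<dots> = ((real n)\<^sup>2 * ((E * (2 * G)) * D)) * (10001 / 10000 * (10003 / 10000))"
    by (simp only: ac_simps)
  also have "\<dots> \<le> ((real n)\<^sup>2 * ((E * (2 * G)) * D)) * (2001 / 2000)"
    using D_nonneg G by (intro mult_left_mono mult_nonneg_nonneg) (auto simp: E_def)
  also have "\<dots> = (real n)\<^sup>2 * (2001 / 2000 * (E * (2 * G)) * D)"
    by (simp only: ac_simps)
  finally show ?thesis by (simp only: E_def G_def Y_def)
qed

text \<open>As long as \<open>n y \<le> 2\<close>, the second differences of \<open>v\<close>,
  averaged with Poisson weights, contribute a factor far enough below 1 to leave room for
  \<open>u\<close>, so no Taylor expansion is involved.\<close>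

theorem crude_bound:
  assumes y: "0 \<le> y" "real n * y \<le> 2"
  shows "weighted_d2 n f y \<le> 1999 / 2000 * (real n * H)"
proof -
  define Y where "Y = real n * y"
  define W where "W = y * (1 - y) + 3 / 5 / real n"
  define M where "M = (3 / 5 + Y) * (9 / 50 + exp (- Y) * crude_nodes Y)"
  have n0: "0 < real n" using N by simp
  have n2: "2 \<le> n" using n_large by simp
  have Y: "0 \<le> Y" "Y \<le> 2" using y by (auto simp: Y_def)
  have "10 ^ 10 * y \<le> real n * y" using N y by (intro mult_right_mono) auto
  then have ys: "y \<le> 2 / 10 ^ 10" using y by simp
  have y1: "y < 1" using ys by simp
  have W: "0 \<le> W" "W \<le> (3 / 5 + Y) / real n"
  proof -
    show "0 \<le> W" using y y1 by (simp add: W_def)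
    have "y * (1 - y) \<le> y" using y by (simp add: mult_left_le)
    then show "W \<le> (3 / 5 + Y) / real n" using n0 by (simp add: W_def Y_def add_divide_distrib)
  qed
  have WY: "(real n)\<^sup>2 * q * W \<le> real n * ((3 / 5 + Y) * q)" if "0 \<le> q" for q
  proof -
    have "(real n)\<^sup>2 * q * W \<le> (real n)\<^sup>2 * q * ((3 / 5 + Y) / real n)"
      using W that by (intro mult_left_mono) auto
    also have "\<dots> = real n * ((3 / 5 + Y) * q)" using n0 by (simp add: power2_eq_square)
    finally show ?thesis .
  qed
  have cn: "0 \<le> crude_nodes Y" using Y by (simp add: crude_nodes_def)
  have v: "\<bar>bern_d2 n v y\<bar> * W \<le> real n * (H * (2001 / 2000 * M))"
  proof -
    have "\<bar>bern_d2 n v y\<bar> * W \<le> (real n)\<^sup>2 * (H * (2001 / 2000 * (9 / 50 + exp (- Y) * crude_nodes Y))) * W"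
      unfolding Y_def using bern_d2_v_crude[OF y] W(1) by (rule mult_right_mono)
    also have "\<dots> \<le> real n * ((3 / 5 + Y) * (H * (2001 / 2000 * (9 / 50 + exp (- Y) * crude_nodes Y))))"
      using H_nonneg cn by (intro WY) auto
    also have "\<dots> = real n * (H * (2001 / 2000 * M))" by (simp only: M_def ac_simps)
    finally show ?thesis .
  qed
  obtain U where u: "\<bar>bern_d2 n u y\<bar> * W \<le> real n * (H * (2001 / 2000 * U))" and U: "2001 / 2000 * (U + M) \<le> 1999 / 2000"
  proof -
    consider "Y \<le> 2 / 5" | "2 / 5 \<le> Y" "Y \<le> 13 / 10" | "13 / 10 \<le> Y" by linarith
    then show thesis
    proof cases
      case 1
      show thesis
      proof (rule that[of "4 * (3 / 5 + Y) / ratio"])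
        have "\<bar>bern_d2 n u y\<bar> * W \<le> (real n)\<^sup>2 * (4 * D) * W"
          using bern_d2_le_4[of y n u D] y y1 n2 u_le W(1) by (intro mult_right_mono) (auto simp: power2_eq_square)
        also have "\<dots> \<le> real n * ((3 / 5 + Y) * (4 * D))" using D_nonneg by (intro WY) auto
        also have "\<dots> \<le> real n * ((3 / 5 + Y) * (4 * (2001 / 2000 * (H / ratio))))"
        proof -
          have "D \<le> 2001 / 2000 * (H / ratio)" using D_le' H_nonneg by (simp add: ratio_def)
          then show ?thesis using Y n0 by (intro mult_left_mono) auto
        qed
        also have "\<dots> = real n * (H * (2001 / 2000 * (4 * (3 / 5 + Y) / ratio)))"
        proof -
          have "N * (p * (4 * (c * (h / r)))) = N * (h * (c * (4 * p / r)))" for N p c h r :: real by simp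
          then show ?thesis .
        qed
        finally show "\<bar>bern_d2 n u y\<bar> * W \<le> real n * (H * (2001 / 2000 * (4 * (3 / 5 + Y) / ratio)))" .
        show "2001 / 2000 * (4 * (3 / 5 + Y) / ratio + M) \<le> 1999 / 2000"
          unfolding M_def by (rule crude_small[OF Y(1) 1])
      qed
    next
      case 2
      show thesis
      proof (rule that[of "70711 / 50000 * (1 + 3 / 5 / Y) / ratio"])
        have "0 < real n * y" using 2 by (simp add: Y_def)
        then have y0: "0 < y" using n0 by (simp add: zero_less_mult_iff)
        have i: "1 + 3 / 5 / (real n * (y * (1 - y))) \<le> 2001 / 2000 * (1 + 3 / 5 / Y)"
        proof -
          have "1 / (1 - y) \<le> 1 / (9999 / 10000)" using ys by (intro divide_left_mono) auto
          then have "1 / (1 - y) \<le> 2001 / 2000" by simp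
          then have le: "3 / 5 / Y * (1 / (1 - y)) \<le> 3 / 5 / Y * (2001 / 2000)" using 2 by (intro mult_left_mono) auto
          have eq: "3 / 5 / (real n * (y * (1 - y))) = 3 / 5 / Y * (1 / (1 - y))" by (simp add: Y_def)
          have gen: "1 + q \<le> 2001 / 2000 * (1 + p)" if "q \<le> p * (2001 / 2000)" for p q :: real
            using that by simp
          show ?thesis unfolding eq by (rule gen[OF le])
        qed
        have "\<bar>bern_d2 n u y\<bar> * W \<le> real n * (sqrt 2 * (1 + 3 / 5 / (real n * (y * (1 - y)))) * D)"
          unfolding W_def by (rule bern_d2_u_le[OF y0 y1])
        also have "\<dots> \<le> real n * (70711 / 50000 * (2001 / 2000 * (1 + 3 / 5 / Y)) * (H / ratio))"
          using sqrt2_le i D_le' D_nonneg y0 y1 Y n0 by (intro mult_left_mono mult_mono) auto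
        also have "\<dots> = real n * (H * (2001 / 2000 * (70711 / 50000 * (1 + 3 / 5 / Y) / ratio)))"
        proof -
          have "N * (b * (c * s) * (h / r)) = N * (h * (c * (b * s / r)))" for N b c s h r :: real by simp
          then show ?thesis .
        qed
        finally show "\<bar>bern_d2 n u y\<bar> * W \<le> real n * (H * (2001 / 2000 * (70711 / 50000 * (1 + 3 / 5 / Y) / ratio)))" .
        show "2001 / 2000 * (70711 / 50000 * (1 + 3 / 5 / Y) / ratio + M) \<le> 1999 / 2000"
          unfolding M_def by (rule crude_middle[OF 2])
      qed
    next
      case 3
      define L where "L = exp (- Y) * (2 * (1 + Y ^ 2 / 2 - Y ^ 3 / 6))"
      have L: "0 \<le> L"
      proof -
        have "Y ^ 3 \<le> 2 ^ 3" using Y by (intro power_mono) auto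
        moreover have "1 \<le> Y\<^sup>2" using 3 by simp
        ultimately show ?thesis by (simp add: L_def)
      qed
      show thesis
      proof (rule that[of "(3 / 5 + Y) * L / ratio"])
        have "\<bar>bern_d2 n u y\<bar> * W \<le> (real n)\<^sup>2 * (2001 / 2000 * L * D) * W"
          unfolding L_def Y_def using bern_d2_u_Poisson[of y] 3 y W(1) by (intro mult_right_mono) (auto simp: Y_def)
        also have "\<dots> \<le> real n * ((3 / 5 + Y) * (2001 / 2000 * L * D))" using D_nonneg L by (intro WY) auto
        also have "\<dots> \<le> real n * ((3 / 5 + Y) * (2001 / 2000 * L * (H / ratio)))"
          using D_le' L Y n0 by (intro mult_left_mono) auto
        also have "\<dots> = real n * (H * (2001 / 2000 * ((3 / 5 + Y) * L / ratio)))" by simp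
        finally show "\<bar>bern_d2 n u y\<bar> * W \<le> real n * (H * (2001 / 2000 * ((3 / 5 + Y) * L / ratio)))" .
        show "2001 / 2000 * ((3 / 5 + Y) * L / ratio + M) \<le> 1999 / 2000"
          unfolding M_def L_def by (rule crude_large[OF 3 Y(2)])
      qed
    qed
  qed
  have "\<bar>bernstein_d2 n f y\<bar> * W \<le> \<bar>bern_d2 n u y\<bar> * W + \<bar>bern_d2 n v y\<bar> * W"
    unfolding bern_d2_split distrib_right[symmetric] using W by (intro mult_right_mono) auto
  also have "\<dots> \<le> real n * (H * (2001 / 2000 * U)) + real n * (H * (2001 / 2000 * M))" using u v by (rule add_mono)
  also have "\<dots> = (real n * H) * (2001 / 2000 * (U + M))" by (simp only: distrib_left mult.assoc)
  also have "\<dots> \<le> (real n * H) * (1999 / 2000)" using U H_nonneg by (intro mult_left_mono) auto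
  finally show ?thesis by (simp add: W_def mult.commute)
qed

end

section \<open>Conclusion\<close>

lemma bern_d2_reflect: "bern_d2 n v (1 - x) = bern_d2 n (\<lambda>k. v (n - k)) x" if "2 \<le> n"
proof -
  have "diff2 v (n - 2 - k) = diff2 (\<lambda>k. v (n - k)) k" if "k \<le> n - 2" for k
  proof -
    have "n - 2 - k + 2 = n - k" "n - 2 - k + 1 = n - (k + 1)" "n - 2 - k = n - (k + 2)"
      using that \<open>2 \<le> n\<close> by auto
    then show ?thesis by (simp only: diff2_def)
  qed
  then have "bern (n - 2) (diff2 v) (1 - x) = bern (n - 2) (diff2 (\<lambda>k. v (n - k))) x"
    unfolding bern_reflect by (intro bern_cong)
  then show ?thesis by (simp add: bern_d2_def)
qed

lemma bern_d2_cong: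
  assumes "2 \<le> n" "\<And>k. k \<le> n \<Longrightarrow> v k = w k"
  shows "bern_d2 n v x = bern_d2 n w x"
proof -
  have "bern (n - 2) (diff2 v) x = bern (n - 2) (diff2 w) x"
    using assms by (intro bern_cong) (auto simp: diff2_def)
  then show ?thesis by (simp add: bern_d2_def)
qed

lemma continuous_on_bern: "continuous_on S (bern n v)"
  unfolding bern_def[abs_def] Bernstein_def by (intro continuous_intros)

lemma continuous_on_bern_d2: "continuous_on S (bern_d2 n v)"
  unfolding bern_d2_def[abs_def] by (intro continuous_intros continuous_on_bern)

context smoothed_bernstein
begin

lemma left_half_bound:
  assumes y: "0 \<le> y" "y \<le> 1 / 2"
  shows "weighted_d2 n f y \<le> 1999 / 2000 * (real n * H)"
proof -
  consider "real n * y \<le> 2" | "2 \<le> real n * y" "real n * y \<le> 10" | "10 \<le> real n * y" by linarith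
  then show ?thesis
    using crude_bound[OF y(1)] boundary_bound bulk_bound[OF y(2)] by cases auto
qed

lemma reflected: "smoothed_bernstein n (\<lambda>x. f (1 - x)) D H"
  and bern_d2_reflected: "bern_d2 n (\<lambda>k. f (1 - real k / real n)) x = bernstein_d2 n f (1 - x)"
proof -
  have n0: "0 < real n" using N by simp
  have n2: "2 \<le> n" using n_large by simp
  have fk: "f (1 - real k / real n) = f (real (n - k) / real n)" if "k \<le> n" for k
    using that n0 by (simp add: of_nat_diff diff_divide_distrib)
  have d2: "bern_d2 n (\<lambda>k. f (1 - real k / real n)) x = bernstein_d2 n f (1 - x)" for x
    unfolding bern_d2_reflect[OF n2] by (intro bern_d2_cong n2 fk)
  show "bern_d2 n (\<lambda>k. f (1 - real k / real n)) x = bernstein_d2 n f (1 - x)"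
    by (rule d2)
  have op: "bernstein_op n (\<lambda>x. f (1 - x)) x = bernstein_op n f (1 - x)" for x
    unfolding bernstein_op_bern bern_reflect by (intro bern_cong fk)
  show "smoothed_bernstein n (\<lambda>x. f (1 - x)) D H"
  proof
    fix x :: real assume x: "0 \<le> x" "x \<le> 1"
    show "\<bar>f (1 - x) - bernstein_op n (\<lambda>x. f (1 - x)) x\<bar> \<le> D" unfolding op using D[of "1 - x"] x by simp
    show "\<bar>bern_d2 n (\<lambda>k. f (1 - real k / real n)) x\<bar> * (x * (1 - x) + 3 / 5 / real n) \<le> real n * H"
      unfolding d2 using H[of "1 - x"] x by (simp add: mult.commute)
  qed (use n_large H_nonneg D_le in auto)
qed

lemma contraction:
  assumes y: "0 \<le> y" "y \<le> 1"
  shows "weighted_d2 n f y \<le> 1999 / 2000 * (real n * H)"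
proof (cases "y \<le> 1 / 2")
  case True
  then show ?thesis using y left_half_bound by simp
next
  case False
  interpret r: smoothed_bernstein n "\<lambda>x. f (1 - x)" D H by (rule reflected)
  show ?thesis using r.left_half_bound[of "1 - y"] y False unfolding bern_d2_reflected by (simp add: mult.commute)
qed

end

text \<open>The weighted second derivative attains its maximum; if that were larger than \<open>ratio * D\<close>,
  it would contract strictly below itself.\<close>

theorem bernstein_second_deriv_le:
  assumes n: "10 ^ 10 \<le> n" and D: "\<And>x. 0 \<le> x \<Longrightarrow> x \<le> 1 \<Longrightarrow> \<bar>f x - bernstein_op n f x\<bar> \<le> D"
    and y: "0 \<le> y" "y \<le> 1"
  shows "weighted_d2 n f y \<le> real n * (ratio * D)"
proof -
  define G where "G x = weighted_d2 n f x" for x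
  have n0: "0 < real n" using n by simp
  have "continuous_on {0..1} G"
    unfolding G_def[abs_def] by (intro continuous_intros continuous_on_bern_d2)
  then obtain x0 where x0: "x0 \<in> {0..1}" "\<And>x. x \<in> {0..1} \<Longrightarrow> G x \<le> G x0"
    using continuous_attains_sup[of "{0..1::real}" G] by auto
  have G0: "0 \<le> G x0" using x0(1) by (simp add: G_def)
  have D0: "0 \<le> D" using D[of 0] by simp
  have "G x0 \<le> real n * (ratio * D)"
  proof (rule ccontr)
    assume a: "\<not> G x0 \<le> real n * (ratio * D)"
    define H where "H = G x0 / real n"
    have nH: "real n * H = G x0" using n0 by (simp add: H_def)
    interpret smoothed_bernstein n f D H
    proof
      show "ratio * D \<le> H" using a n0 by (simp add: H_def pos_le_divide_eq mult.commute)
      show "weighted_d2 n f x \<le> real n * H"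
        if "0 \<le> x" "x \<le> 1" for x
        using x0(2)[of x] that unfolding nH by (simp add: G_def)
    qed (use n D G0 n0 in \<open>auto simp: H_def\<close>)
    have "G x0 \<le> 1999 / 2000 * G x0"
      using contraction[of x0] x0(1) unfolding nH by (simp add: G_def)
    then have "G x0 = 0" using G0 by simp
    then show False using a D0 n0 by (simp add: ratio_def)
  qed
  moreover have "G y \<le> G x0" using x0(2) y by simp
  ultimately show ?thesis by (simp add: G_def)
qed

lemma abs_le_sup_norm:
  assumes "continuous_on {0..1} g" "x \<in> {0..1}"
  shows "\<bar>g x\<bar> \<le> sup_norm g"
  unfolding sup_norm_def
proof (rule cSUP_upper[OF assms(2)])
  have "compact ((\<lambda>x. \<bar>g x\<bar>) ` {0..1})"
    using assms(1) by (intro compact_continuous_image continuous_intros) auto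
  then show "bdd_above ((\<lambda>x. \<bar>g x\<bar>) ` {0..1})" by (rule bounded_imp_bdd_above[OF compact_imp_bounded])
qed

theorem omega2_phi_le:
  assumes f: "continuous_on {0..1} f" and n: "10 ^ 10 \<le> n"
  shows "omega2_phi f (1 / sqrt (real n)) \<le> (4 + ratio) * sup_norm (\<lambda>x. bernstein_op n f x - f x)"
proof -
  define g where "g = bernstein_op n f"
  define D where "D = sup_norm (\<lambda>x. g x - f x)"
  have nn: "10 ^ 10 \<le> real n" using n by (metis of_nat_le_iff of_nat_numeral of_nat_power)
  have cg: "continuous_on {0..1} (\<lambda>x. g x - f x)"
    unfolding g_def bernstein_op_bern by (intro continuous_intros f continuous_on_bern)
  have gf: "\<bar>g x - f x\<bar> \<le> D" if "x \<in> {0..1}" for x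
    unfolding D_def by (rule abs_le_sup_norm[OF cg that])
  then have D: "\<bar>f x - bernstein_op n f x\<bar> \<le> D" if "0 \<le> x" "x \<le> 1" for x
    using that by (simp add: g_def abs_minus_commute)
  have D0: "0 \<le> D" using D[of 0] by simp
  have n2: "n = (n - 2) + 2" using n by simp
  obtain g1 where g: "\<And>t. (g has_real_derivative g1 t) (at t)"
    "\<And>t. (g1 has_real_derivative bernstein_d2 n f t) (at t)"
    using bern_derivs[of "n - 2" "\<lambda>k. f (real k / real n)"] unfolding n2[symmetric] g_def bernstein_op_bern by blast
  have "\<bar>sym_diff2 (h * phi x) f x\<bar> \<le> (4 + ratio) * D"
    if h: "0 \<le> h" "h \<le> 1 / sqrt (real n)" and x: "x \<in> {0..1}" "x + h * phi x \<in> {0..1}" "x - h * phi x \<in> {0..1}" for h x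
  proof -
    have "h\<^sup>2 \<le> (1 / sqrt (real n))\<^sup>2" using h by (intro power_mono)
    then have h2: "h\<^sup>2 \<le> 1 / real n" by (simp add: power_divide)
    have "\<bar>sym_diff2 (h * phi x) g x\<bar> \<le> ratio * D"
      using x h(1) h2 nn D0 bernstein_second_deriv_le[OF n D]
      by (intro sym_diff_phi_le[OF g]) (auto simp: ratio_def)
    moreover have "\<bar>sym_diff2 (h * phi x) g x - sym_diff2 (h * phi x) f x\<bar> \<le> 4 * D"
      using gf[OF x(1)] gf[OF x(2)] gf[OF x(3)] by (simp add: sym_diff2_def)
    ultimately have "\<bar>sym_diff2 (h * phi x) f x\<bar> \<le> 4 * D + ratio * D" by linarith
    then show ?thesis by (simp only: distrib_right)
  qed
  moreover have "{\<bar>sym_diff2 (h * phi x) f x\<bar> | h x. 0 \<le> h \<and> h \<le> 1 / sqrt (real n) \<and> x \<in> {0..1}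
      \<and> x + h * phi x \<in> {0..1} \<and> x - h * phi x \<in> {0..1}} \<noteq> {}"
    by (auto intro!: exI[of _ 0])
  ultimately have "omega2_phi f (1 / sqrt (real n)) \<le> (4 + ratio) * D"
    unfolding omega2_phi_def by (intro cSup_least) auto
  then show ?thesis by (simp only: D_def g_def)
qed

section \<open>Numerical value of the constant\<close>

lemma ln_2_bounds: "693147 / 1000000 \<le> ln (2 :: real)" "ln (2 :: real) \<le> 693148 / 1000000"
  using ln_approx_bounds[of 2 6] by (simp_all add: eval_nat_numeral)

lemma bound_const_bounds: "15.0477 \<le> bound_const" "bound_const < 15.0478"
proof -
  have s2: "1414213 / 1000000 \<le> sqrt 2" "sqrt 2 \<le> 1414214 / 1000000"
    by (rule real_le_rsqrt real_le_lsqrt; simp add: power2_eq_square)+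
  have s3: "173205 / 100000 \<le> sqrt 3" "sqrt 3 \<le> 1732051 / 1000000"
    by (rule real_le_rsqrt real_le_lsqrt; simp add: power2_eq_square)+
  define q where "q = 1 - 99 / 100 / sqrt 3"
  have "99 / 100 / sqrt 3 \<le> 99 / 100 / (173205 / 100000)" using s3 by (intro divide_left_mono mult_pos_pos) auto
  then have q1: "4284229 / 10000000 \<le> q" by (simp add: q_def)
  have "99 / 100 / (1732051 / 1000000) \<le> 99 / 100 / sqrt 3" using s3 by (intro divide_left_mono mult_pos_pos) auto
  then have q2: "q \<le> 42842365 / 100000000" by (simp add: q_def)
  have "ln (4 :: real) = ln (2 ^ 2)" by simp
  also have "\<dots> = 2 * ln 2" by (subst ln_realpow) simp_all
  finally have l4: "ln (4 :: real) = 2 * ln 2" .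
  have b: "bound_const = 4 + (2 + sqrt 2) / q * (2 * ln 2)"
    unfolding bound_const_def q_def l4 by (simp add: distrib_left)
  have "(2 + 1414213 / 1000000) / (42842365 / 100000000) * (2 * (693147 / 1000000)) \<le> (2 + sqrt 2) / q * (2 * ln 2)"
    using s2 q1 q2 ln_2_bounds by (intro mult_mono frac_le) auto
  then show "15.0477 \<le> bound_const" unfolding b by simp
  have "(2 + sqrt 2) / q * (2 * ln 2) \<le> (2 + 1414214 / 1000000) / (4284229 / 10000000) * (2 * (693148 / 1000000))"
    using s2 q1 q2 ln_2_bounds by (intro mult_mono frac_le) auto
  then show "bound_const < 15.0478" unfolding b by simp
qed

section \<open>Continuously differentiable functions\<close>

lemma mean_value_within:
  fixes f f' :: "real \<Rightarrow> real"
  assumes f: "\<And>x. x \<in> {0..1} \<Longrightarrow> (f has_real_derivative f' x) (at x within {0..1})"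
    and ab: "0 \<le> a" "a \<le> b" "b \<le> 1"
  obtains c where "a \<le> c" "c \<le> b" "f b - f a = f' c * (b - a)"
proof -
  have "\<exists>c\<in>{a..b}. f b - f a = f' c * (b - a)"
  proof (rule mvt_very_simple[OF ab(2)])
    fix x assume x: "a \<le> x" "x \<le> b"
    have "(f has_real_derivative f' x) (at x within {a..b})"
      by (rule DERIV_subset[OF f]) (use x ab in auto)
    then show "(f has_derivative (*) (f' x)) (at x within {a..b})" by (simp add: has_field_derivative_def)
  qed
  then show ?thesis using that by auto
qed

text \<open>By the mean value theorem on both halves, a second difference is \<open>h\<close> times
  a difference of two values of \<open>f'\<close>, which uniform continuity makes small.\<close>

lemma C1_unit_omega2_le:
  assumes f: "f \<in> C1_unit" and e: "0 < e"
  obtains d where "0 < d" "\<And>\<delta>. 0 < \<delta> \<Longrightarrow> \<delta> < d \<Longrightarrow> \<bar>omega2 f \<delta> / \<delta>\<bar> \<le> e"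
proof -
  obtain f' where f': "continuous_on {0..1} f'"
    "\<And>x. x \<in> {0..1} \<Longrightarrow> (f has_real_derivative f' x) (at x within {0..1})"
    using f by (auto simp: C1_unit_def)
  have "uniformly_continuous_on {0..1} f'" by (rule compact_uniformly_continuous[OF f'(1)]) simp
  then obtain d where d: "0 < d" "\<And>s t. s \<in> {0..1} \<Longrightarrow> t \<in> {0..1} \<Longrightarrow> dist t s < d \<Longrightarrow> dist (f' t) (f' s) < e"
    unfolding uniformly_continuous_on_def using e by metis
  \<comment> \<open>The two intermediate points may be \<open>2 h\<close> apart, hence
    \<open>d / 2\<close>.\<close>
  have "\<bar>omega2 f \<delta> / \<delta>\<bar> \<le> e" if \<delta>: "0 < \<delta>" "\<delta> < d / 2" for \<delta>
  proof -
    let ?S = "{\<bar>sym_diff2 h f x\<bar> | h x. 0 \<le> h \<and> h \<le> \<delta> \<and> x + h \<in> {0..1} \<and> x - h \<in> {0..1}}"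
    have le: "\<bar>sym_diff2 h f x\<bar> \<le> e * \<delta>"
      if h: "0 \<le> h" "h \<le> \<delta>" and x: "x + h \<in> {0..1}" "x - h \<in> {0..1}" for h x
    proof -
      obtain c where c: "x \<le> c" "c \<le> x + h" "f (x + h) - f x = f' c * (x + h - x)"
        by (rule mean_value_within[OF f'(2), of x "x + h"]) (use h x in auto)
      obtain c' where c': "x - h \<le> c'" "c' \<le> x" "f x - f (x - h) = f' c' * (x - (x - h))"
        by (rule mean_value_within[OF f'(2), of "x - h" x]) (use h x in auto)
      have "dist (f' c) (f' c') < e"
        using c(1,2) c'(1,2) h x \<delta> by (intro d(2)) (auto simp: dist_real_def)
      then have "\<bar>f' c - f' c'\<bar> * h \<le> e * \<delta>"
        using h e by (intro mult_mono) (auto simp: dist_real_def)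
      moreover have "sym_diff2 h f x = (f' c - f' c') * h"
        using c(3) c'(3) by (simp add: sym_diff2_def algebra_simps)
      ultimately show ?thesis using h by (simp add: abs_mult)
    qed
    have ne: "0 \<in> ?S" using \<delta> by (auto simp: sym_diff2_def intro!: exI[of _ 0])
    have "omega2 f \<delta> \<le> e * \<delta>" unfolding omega2_def using le ne by (intro cSup_least) auto
    moreover have "0 \<le> omega2 f \<delta>" unfolding omega2_def
      by (rule cSup_upper[OF ne]) (use le in \<open>auto intro!: bdd_aboveI[where M = "e * \<delta>"]\<close>)
    ultimately show ?thesis using \<delta> by (simp add: pos_divide_le_eq)
  qed
  then show ?thesis using that[of "d / 2"] d(1) by auto
qed

lemma FF_C1_unit_subset_GG: "FF \<inter> C1_unit \<subseteq> GG"
proof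
  fix f assume f: "f \<in> FF \<inter> C1_unit"
  have "((\<lambda>\<delta>. omega2 f \<delta> / \<delta>) \<longlongrightarrow> 0) (at_right 0)"
  proof (rule tendstoI)
    fix e :: real assume e: "0 < e"
    obtain d where d: "0 < d" "\<And>\<delta>. 0 < \<delta> \<Longrightarrow> \<delta> < d \<Longrightarrow> \<bar>omega2 f \<delta> / \<delta>\<bar> \<le> e / 2"
      using C1_unit_omega2_le[of f "e / 2"] f e by auto
    show "\<forall>\<^sub>F \<delta> in at_right 0. dist (omega2 f \<delta> / \<delta>) 0 < e"
      unfolding eventually_at_right_field
    proof (intro exI[of _ d] conjI allI impI d(1))
      fix \<delta> assume "0 < \<delta>" "\<delta> < d"
      then have "\<bar>omega2 f \<delta> / \<delta>\<bar> \<le> e / 2" by (rule d(2))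
      then show "dist (omega2 f \<delta> / \<delta>) 0 < e" using e unfolding dist_real_def diff_0_right by linarith
    qed
  qed
  then show "f \<in> GG" using f by (auto simp: GG_def)
qed

theorem theorem2:
  shows "limsup (\<lambda>n. SUP f\<in>GG. ereal (omega2_phi f (1 / sqrt (real n)))
             / ereal (sup_norm (\<lambda>x. bernstein_op n f x - f x))) \<le> ereal bound_const
         \<and> 15.0477 \<le> bound_const \<and> bound_const < 15.0478
         \<and> FF \<inter> C1_unit \<subseteq> GG"
proof (intro conjI bound_const_bounds FF_C1_unit_subset_GG Limsup_bounded)
  show "\<forall>\<^sub>F n in sequentially. (SUP f\<in>GG. ereal (omega2_phi f (1 / sqrt (real n)))
             / ereal (sup_norm (\<lambda>x. bernstein_op n f x - f x))) \<le> ereal bound_const"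
  proof (rule eventually_sequentiallyI[of "10 ^ 10"], rule SUP_least)
    fix n :: nat and f assume n: "10 ^ 10 \<le> n" and f: "f \<in> GG"
    define D where "D = sup_norm (\<lambda>x. bernstein_op n f x - f x)"
    have cf: "continuous_on {0..1} f" using f by (simp add: GG_def FF_def)
    have "continuous_on {0..1} (\<lambda>x. bernstein_op n f x - f x)"
      unfolding bernstein_op_bern by (intro continuous_intros cf continuous_on_bern)
    from abs_le_sup_norm[OF this, of 0] have D0: "0 \<le> D" by (simp add: D_def)
    have w: "omega2_phi f (1 / sqrt (real n)) \<le> (4 + ratio) * D"
      using omega2_phi_le[OF cf n] by (simp add: D_def)
    have r: "4 + ratio \<le> bound_const" using bound_const_bounds(1) by (simp add: ratio_def)
    have "ereal (omega2_phi f (1 / sqrt (real n))) / ereal D \<le> ereal bound_const"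
    proof (cases "D = 0")
      case True
      have "0 \<le> bound_const" using bound_const_bounds(1) by simp
      moreover have "omega2_phi f (1 / sqrt (real n)) \<le> 0" using w True by simp
      \<comment> \<open>\<open>0 / 0 = 0\<close> and \<open>a / 0 = - \<infinity>\<close> for \<open>a < 0\<close> in \<^typ>\<open>ereal\<close>\<close>
      ultimately show ?thesis
        by (cases "omega2_phi f (1 / sqrt (real n)) = 0") (auto simp: True divide_ereal_def)
    next
      case False
      then have "omega2_phi f (1 / sqrt (real n)) / D \<le> 4 + ratio" using w D0 by (simp add: pos_divide_le_eq)
      then show ?thesis using False r by simp
    qed
    then show "ereal (omega2_phi f (1 / sqrt (real n))) / ereal (sup_norm (\<lambda>x. bernstein_op n f x - f x)) \<le> ereal bound_const"
      by (simp add: D_def)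
  qed
qed

end
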